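(* Let $\hat\beta^{(\varepsilon)}=\{\hat\beta^{(\varepsilon)}_{jk}\}$ be the wavelet general empirical Bayes (GEB) estimator defined in the context, with positive constants $(j_*,\rho_0,b_0)$. Let $0<\alpha<\infty$, $1/(\alpha+1/2)<p\le\infty$, $0<q\le\infty$, $0<C<\infty$, and let $B$ be a class of sequences $\beta$ with $$B\subseteq B^\alpha_{p,q}(C),\qquad\liminf_{\varepsilon\to0+}\varepsilon^{-2\alpha/(\alpha+1/2)}\mathcal R^{(\varepsilon)}(B)>0 .$$ Let $\widetilde R^{(\varepsilon,* )}(\beta)$ be functionals with $\widetilde R^{(\varepsilon,* )}(\beta)\ge R^{(\varepsilon,* )}(\beta)$, and let $\tilde\beta^{(\varepsilon)}$ be estimators satisfying $$\sup_{\beta\in B}\{\widetilde R^{(\varepsilon,* )}(\beta)-R^{(\varepsilon)}(\tilde\beta^{(\varepsilon)},\beta)\}\le o(1)\,\varepsilon^{2\alpha/(\alpha+1/2)}\quad\text{as }\varepsilon\to0+.$$ Then $$\limsup_{\varepsilon\to0+}\frac{\sup\{R^{(\varepsilon)}(\hat\beta^{(\varepsilon)},\beta)-R^{(\varepsilon)}(\tilde\beta^{(\varepsilon)},\beta):\beta\in B\}}{\mathcal R^{(\varepsilon)}(B)}\le0.$$ Consequently, $$\limsup_{\varepsilon\to0+}\frac{\sup_{\beta\in B}R^{(\varepsilon)}(\hat\beta^{(\varepsilon)},\beta)}{\sup_{\beta\in B}R^{(\varepsilon)}(\tilde\beta^{(\varepsilon)},\beta)}\le1.$$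
   Context: Model: $y_{jk}=\beta_{jk}+\varepsilon z_{jk}$, $1\le k\le\max(2^j,1)$, $j=-1,0,1,\dots$, with $\varepsilon>0$ known, $z_{jk}$ i.i.d. $N(0,1)$; $\beta$ deterministic; $E^{(\varepsilon)}_\beta$ is the expectation. Risk: $R^{(\varepsilon)}(\hat\beta,\beta)\equiv\sum_{j=-1}^\infty\sum_{k=1}^{2^j\vee1}E_\beta^{(\varepsilon)}(\hat\beta_{jk}-\beta_{jk})^2$. Ideal risk: $R^{(\varepsilon,* )}(\beta)\equiv\inf R^{(\varepsilon)}(\hat\beta,\beta)$ over all separable estimators $\hat\beta_{jk}=h_j(y_{jk})$ with Borel $h_j$ (allowed to depend on $\beta$). Minimax risk: $\mathcal R^{(\varepsilon)}(B)\equiv\inf_{\hat\beta}\sup_{\beta\in B}R^{(\varepsilon)}(\hat\beta,\beta)$ over all estimators based on $y$. Besov balls: $B^\alpha_{p,q}(C)=\{\beta:\|\beta\|^\alpha_{p,q}\le C\}$ with $$\|\beta\|^\alpha_{p,q}\equiv\Big[|\beta_{-1,1}|^q+\sum_{j=0}^\infty\Big(2^{j(\alpha+1/2-1/p)}\Big(\sum_{k=1}^{2^j}|\beta_{jk}|^p\Big)^{1/p}\Big)^q\Big]^{1/q}$$ (usual modifications if $p$ or $q$ is $\infty$). GEB estimator: fix constants $n_*>2$, $\rho_0>0$, $b_0>0$ and $\eta_n\to0$; let $j_*$ be the largest integer with $2^{j_*}\le n_*$, $\rho(n)=(1+\eta_n)\rho_0\sqrt{2(\log n)/n}>0$, $b(n)=b_0(\log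 n)/\sqrt n$. Put $\hat\beta^{(\varepsilon)}_{jk}=y_{jk}$ for $j<j_*$ and $\hat\beta^{(\varepsilon)}_{jk}=\varepsilon\,\hat t_{[j]}(y_{jk}/\varepsilon)$ for $j\ge j_*$, where with $n_j=2^j$, $$\hat t_{[j]}(x)\equiv\begin{cases}x+\hat\varphi_{[j]}'(x)/\max\{\rho(n_j),\hat\varphi_{[j]}(x)\},&\hat\kappa_{[j]}>b(n_j),\\ \operatorname{sgn}(x)(|x|-\sqrt{2\log n_j})^+,&\hat\kappa_{[j]}\le b(n_j),\end{cases}$$ $$\hat\varphi_{[j]}(x)\equiv\frac{\sqrt{2\log n_j}}{n_j}\sum_{k=1}^{2^j}K\big(\sqrt{2\log n_j}(x-y_{jk}/\varepsilon)\big),\quad K(x)\equiv\frac{\sin x}{\pi x},\qquad\hat\kappa_{[j]}\equiv1-\frac{\sqrt2}{n_j}\sum_{k=1}^{2^j}e^{-(y_{jk}/\varepsilon)^2/2}.$$ *)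

theory Defs
  imports "HOL-Probability.Probability"
begin

type_synonym coeffs = "int \<times> nat \<Rightarrow> real"

text \<open>Since \<^term>\<open>nat (-1) = 0\<close>, this is \<open>max(2^j, 1)\<close> for every \<open>j \<ge> -1\<close>.\<close>

definition level_size :: "int \<Rightarrow> nat" where
  "level_size j = 2 ^ nat j"

definition idx :: "(int \<times> nat) set" where
  "idx = (SIGMA j:{-1..}. {1..level_size j})"

definition noise :: "coeffs measure" where
  "noise = PiM idx (\<lambda>_. density lborel std_normal_density)"

definition obs :: "real \<Rightarrow> coeffs \<Rightarrow> coeffs \<Rightarrow> coeffs" where
  "obs \<epsilon> \<beta> z = (\<lambda>i\<in>idx. \<beta> i + \<epsilon> * z i)"

definition estimators :: "(coeffs \<Rightarrow> coeffs) set" where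
  "estimators = {\<delta>. \<forall>i\<in>idx. (\<lambda>y. \<delta> y i) \<in> borel_measurable (PiM idx (\<lambda>_. borel))}"

text \<open>
  The risk is an extended nonnegative real, so the sums and expectations always exist.
  Every integrand is measurable when the estimator lies in
  \<^const>\<open>estimators\<close>.
\<close>

definition risk :: "real \<Rightarrow> (coeffs \<Rightarrow> coeffs) \<Rightarrow> coeffs \<Rightarrow> ennreal" where
  "risk \<epsilon> \<delta> \<beta> =
    (\<Sum>\<^sub>\<infinity>j\<in>{-1..}. \<Sum>k = 1..level_size j.
       \<integral>\<^sup>+ z. ennreal ((\<delta> (obs \<epsilon> \<beta> z) (j, k) - \<beta> (j, k))\<^sup>2) \<partial>noise)"

text \<open>The functions \<open>h j\<close> depend on the level only and may depend on \<open>\<beta>\<close>.\<close>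

definition ideal_risk :: "real \<Rightarrow> coeffs \<Rightarrow> ennreal" where
  "ideal_risk \<epsilon> \<beta> =
    (INF h\<in>{h :: int \<Rightarrow> real \<Rightarrow> real. \<forall>j\<ge>-1. h j \<in> borel_measurable borel}.
       risk \<epsilon> (\<lambda>y (j, k). h j (y (j, k))) \<beta>)"

definition minimax_risk :: "real \<Rightarrow> coeffs set \<Rightarrow> ennreal" where
  "minimax_risk \<epsilon> B = (INF \<delta>\<in>estimators. SUP \<beta>\<in>B. risk \<epsilon> \<delta> \<beta>)"

text \<open>
  The exponents \<open>p\<close> and \<open>q\<close> range over \<open>(0, \<infinity>]\<close>; note that
  \<^term>\<open>enn2real (1 / \<infinity>) = 0\<close>.
\<close>

definition level_norm :: "ennreal \<Rightarrow> nat \<Rightarrow> coeffs \<Rightarrow> real" where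
  "level_norm p j \<beta> =
    (if p = \<infinity> then Max ((\<lambda>k. \<bar>\<beta> (int j, k)\<bar>) ` {1..2 ^ j})
     else (\<Sum>k = 1..2 ^ j. \<bar>\<beta> (int j, k)\<bar> powr enn2real p) powr (1 / enn2real p))"

definition weighted_level_norm :: "real \<Rightarrow> ennreal \<Rightarrow> nat \<Rightarrow> coeffs \<Rightarrow> real" where
  "weighted_level_norm \<alpha> p j \<beta> =
    2 powr (real j * (\<alpha> + 1 / 2 - enn2real (1 / p))) * level_norm p j \<beta>"

definition ennpowr :: "ennreal \<Rightarrow> real \<Rightarrow> ennreal" where
  "ennpowr x r = (if x = \<infinity> then \<infinity> else ennreal (enn2real x powr r))"

definition besov_norm :: "real \<Rightarrow> ennreal \<Rightarrow> ennreal \<Rightarrow> coeffs \<Rightarrow> ennreal" where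
  "besov_norm \<alpha> p q \<beta> =
    (if q = \<infinity>
     then max (ennreal \<bar>\<beta> (-1, 1)\<bar>) (SUP j. ennreal (weighted_level_norm \<alpha> p j \<beta>))
     else ennpowr
       (ennreal (\<bar>\<beta> (-1, 1)\<bar> powr enn2real q)
         + (\<Sum>j. ennreal (weighted_level_norm \<alpha> p j \<beta> powr enn2real q)))
       (1 / enn2real q))"

definition besov_ball :: "real \<Rightarrow> ennreal \<Rightarrow> ennreal \<Rightarrow> real \<Rightarrow> coeffs set" where
  "besov_ball \<alpha> p q C = {\<beta>. besov_norm \<alpha> p q \<beta> \<le> ennreal C}"

text \<open>\<open>sin x / (\<pi> x)\<close>, extended continuously to 0 (HOL division would give 0 there).\<close>

definition sinc_kernel :: "real \<Rightarrow> real" where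
  "sinc_kernel x = (if x = 0 then 1 / pi else sin x / (pi * x))"

definition phi_hat :: "real \<Rightarrow> coeffs \<Rightarrow> int \<Rightarrow> real \<Rightarrow> real" where
  "phi_hat \<epsilon> y j x =
    (let n = level_size j; s = sqrt (2 * ln (real n))
     in s / real n * (\<Sum>k = 1..n. sinc_kernel (s * (x - y (j, k) / \<epsilon>))))"

definition kappa_hat :: "real \<Rightarrow> coeffs \<Rightarrow> int \<Rightarrow> real" where
  "kappa_hat \<epsilon> y j =
    (let n = level_size j
     in 1 - sqrt 2 / real n * (\<Sum>k = 1..n. exp (- ((y (j, k) / \<epsilon>)\<^sup>2 / 2))))"

definition geb_rho :: "real \<Rightarrow> (nat \<Rightarrow> real) \<Rightarrow> nat \<Rightarrow> real" where
  "geb_rho \<rho>\<^sub>0 \<eta> n = (1 + \<eta> n) * \<rho>\<^sub>0 * sqrt (2 * ln (real n) / real n)"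

definition geb_b :: "real \<Rightarrow> nat \<Rightarrow> real" where
  "geb_b b\<^sub>0 n = b\<^sub>0 * ln (real n) / sqrt (real n)"

definition soft_threshold :: "real \<Rightarrow> real \<Rightarrow> real" where
  "soft_threshold t x = sgn x * max 0 (\<bar>x\<bar> - t)"

definition t_hat ::
  "real \<Rightarrow> real \<Rightarrow> (nat \<Rightarrow> real) \<Rightarrow> real \<Rightarrow> coeffs \<Rightarrow> int \<Rightarrow> real \<Rightarrow> real" where
  "t_hat \<rho>\<^sub>0 b\<^sub>0 \<eta> \<epsilon> y j x =
    (let n = level_size j
     in if kappa_hat \<epsilon> y j > geb_b b\<^sub>0 n
        then x + deriv (phi_hat \<epsilon> y j) x / max (geb_rho \<rho>\<^sub>0 \<eta> n) (phi_hat \<epsilon> y j x)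
        else soft_threshold (sqrt (2 * ln (real n))) x)"

definition j_star :: "real \<Rightarrow> int" where
  "j_star nstar = (GREATEST j :: int. 2 powr real_of_int j \<le> nstar)"

definition geb ::
  "real \<Rightarrow> real \<Rightarrow> real \<Rightarrow> (nat \<Rightarrow> real) \<Rightarrow> real \<Rightarrow> coeffs \<Rightarrow> coeffs" where
  "geb nstar \<rho>\<^sub>0 b\<^sub>0 \<eta> \<epsilon> y =
    (\<lambda>(j, k). if j < j_star nstar then y (j, k)
              else \<epsilon> * t_hat \<rho>\<^sub>0 b\<^sub>0 \<eta> \<epsilon> y j (y (j, k) / \<epsilon>))"

end

theory Submission
  imports Defs
begin

text \<open>
  After rescaling by \<open>\<epsilon>\<close> a level is a compound decision problem with \<open>n\<close> independent
  \<open>N(\<theta>\<^sub>k, 1)\<close> observations, whose best separable rule is the Bayes rule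
  \<open>x + \<phi>'(x) / \<phi>(x)\<close> for the Gaussian mixture density \<open>\<phi>\<close> of the means. Conditionally on the
  observation at which the rule is evaluated, Hoeffding's inequality shows that the sinc kernel
  estimates of \<open>\<phi>\<close> and \<open>\<phi>'\<close> err by at most a logarithmic power times \<open>1 / \<surd>n\<close>, which is also
  the size of the regularization \<open>\<rho>(n)\<close>. Integrating the resulting pointwise loss against \<open>\<phi>\<close>
  costs \<open>n powr (\<delta> - 1/2)\<close> on \<open>\<bar>x\<bar> \<le> 2 * n powr \<delta>\<close>, and outside this interval it is controlled by the
  number of large means. When the sparsity index \<open>\<kappa>\<close> is below the threshold \<open>b(n)\<close>, soft
  thresholding has risk of the order of a logarithmic power times \<open>n \<kappa>\<close>.

  On a Besov ball the \<open>r\<close>-th moment of the means at level \<open>j\<close> is at most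
  \<open>T = C powr r * (N / 2 ^ j) powr (1 + c)\<close> with \<open>N = \<epsilon> powr (- 1 / (\<alpha> + 1/2))\<close>,
  \<open>r = min p 2\<close> and \<open>c = (\<alpha> + 1/2) * r - 1 > 0\<close>. Interpolating between the two kinds of bounds makes
  the excess at level \<open>j\<close> at most a constant times \<open>\<epsilon>\<^sup>2 * N powr (1 - \<gamma>) * 2 powr (- \<gamma> * j)\<close>, up to a
  summable multiple of \<open>\<epsilon>\<^sup>2\<close>. Summing over the levels gives \<open>o(\<epsilon>\<^sup>2 * N)\<close>, and
  \<open>\<epsilon>\<^sup>2 * N = \<epsilon> powr (2 * \<alpha> / (\<alpha> + 1/2))\<close>.
\<close>

section \<open>Sinc kernel and Gaussian Fourier inversion\<close>

text \<open>The rule applied to the k-th observation is estimated from data that contain it.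
  Freezing the k-th noise coordinate and integrating over the others first makes the evaluation
  point a constant, so that concentration at a single point is enough and nothing uniform in
  \<open>x\<close> has to be proved. The price is that the conditional law of the estimated rule
  depends on k: the cross term between estimation error and Bayes error need not cancel by
  orthogonality, and the weight \<omega> in (a + b)^2 <= (1 + \<omega>) a^2 + (1 + 1 / \<omega>) b^2
  has to absorb it. On the exceptional events the rule is controlled only by the deterministic bound
  s^2 / \<rho> on its shift, with s^2 = 2 ln n, which can grow like a power of n; therefore all
  failure probabilities are made smaller than every power of 1 / n. The competitor is one arbitrary
  separable rule throughout, and the infimum over such rules is taken only after the levels have
  been summed.\<close>

abbreviation gauss :: "real \<Rightarrow> real" where "gauss \<equiv> std_normal_density"

text \<open>
  Written as a Fourier integral over \<open>{-s..s}\<close>, the rescaled sinc kernel differs in mean from the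
  Gaussian density by a Gaussian tail integral only, and it may be differentiated under the integral.
\<close>

definition band_kernel :: "real \<Rightarrow> real \<Rightarrow> real" where
  "band_kernel s x = integral {-s..s} (\<lambda>u. cos (u * x)) / (2 * pi)"

definition band_kernel' :: "real \<Rightarrow> real \<Rightarrow> real" where
  "band_kernel' s x = integral {-s..s} (\<lambda>u. - (u * sin (u * x))) / (2 * pi)"

lemma sinc_kernel_eq_band_kernel:
  assumes "s \<ge> 0"
  shows "s * sinc_kernel (s * x) = band_kernel s x"
proof (cases "x = 0")
  case True
  then show ?thesis using assms
    by (simp add: band_kernel_def sinc_kernel_def)
next
  case False
  have "((\<lambda>u. cos (u * x)) has_integral (sin (s * x) / x - sin (- s * x) / x)) {-s..s}"
    by (rule fundamental_theorem_of_calculus)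
       (use assms False in \<open>auto intro!: derivative_eq_intros simp: has_real_derivative_iff_has_vector_derivative[symmetric]\<close>)
  then have "integral {-s..s} (\<lambda>u. cos (u * x)) = 2 * sin (s * x) / x"
    by (simp add: integral_unique)
  then show ?thesis using False by (cases "s = 0") (simp_all add: band_kernel_def sinc_kernel_def)
qed

lemma band_kernel_has_derivative:
  "(band_kernel s has_real_derivative band_kernel' s x) (at x)"
proof -
  have "((\<lambda>x. integral (cbox (-s) s) (\<lambda>u. cos (u * x))) has_field_derivative
         integral (cbox (-s) s) (\<lambda>u. - (u * sin (u * x)))) (at x within UNIV)"
    by (rule leibniz_rule_field_derivative)
       (auto intro!: derivative_eq_intros integrable_continuous_interval continuous_intros
         simp: case_prod_beta)
  then have "((\<lambda>x. integral {-s..s} (\<lambda>u. cos (u * x)) / (2 * pi)) has_field_derivative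
         integral {-s..s} (\<lambda>u. - (u * sin (u * x))) / (2 * pi)) (at x)"
    by (intro DERIV_cdivide) simp
  then show ?thesis unfolding band_kernel_def[abs_def] band_kernel'_def .
qed

lemma abs_band_kernel_le:
  assumes "s \<ge> 0"
  shows "\<bar>band_kernel s x\<bar> \<le> s"
proof -
  have "norm (integral (cbox (-s) s) (\<lambda>u. cos (u * x))) \<le> 1 * measure lborel (cbox (-s) s)"
    by (rule integrable_bound) (auto intro!: integrable_continuous_interval continuous_intros)
  then have "\<bar>integral {-s..s} (\<lambda>u. cos (u * x))\<bar> \<le> 2 * s"
    using assms by simp
  then have "\<bar>integral {-s..s} (\<lambda>u. cos (u * x))\<bar> / \<bar>2 * pi\<bar> \<le> 2 * s / \<bar>2 * pi\<bar>"
    by (rule divide_right_mono) simp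
  then have "\<bar>band_kernel s x\<bar> \<le> 2 * s / (2 * pi)"
    by (simp add: band_kernel_def abs_divide)
  also have "\<dots> \<le> s" using assms pi_ge_two by (simp add: divide_le_eq mult_le_cancel_left1)
  finally show ?thesis .
qed

lemma abs_band_kernel'_le:
  assumes "s \<ge> 0"
  shows "\<bar>band_kernel' s x\<bar> \<le> s\<^sup>2"
proof -
  have "norm (integral (cbox (-s) s) (\<lambda>u. - (u * sin (u * x)))) \<le> s * measure lborel (cbox (-s) s)"
  proof (rule integrable_bound)
    show "norm (- (u * sin (u * x))) \<le> s" if "u \<in> cbox (-s) s" for u
    proof -
      have "\<bar>u\<bar> * \<bar>sin (u * x)\<bar> \<le> s * 1" using that assms by (intro mult_mono) auto
      then show ?thesis by (simp add: abs_mult)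
    qed
  qed (use assms in \<open>auto intro!: integrable_continuous_interval continuous_intros\<close>)
  then have "\<bar>integral {-s..s} (\<lambda>u. - (u * sin (u * x)))\<bar> \<le> 2 * s\<^sup>2"
    using assms by (simp add: power2_eq_square)
  then have "\<bar>integral {-s..s} (\<lambda>u. - (u * sin (u * x)))\<bar> / \<bar>2 * pi\<bar> \<le> 2 * s\<^sup>2 / \<bar>2 * pi\<bar>"
    by (rule divide_right_mono) simp
  then have "\<bar>band_kernel' s x\<bar> \<le> 2 * s\<^sup>2 / (2 * pi)"
    by (simp add: band_kernel'_def abs_divide)
  also have "\<dots> \<le> s\<^sup>2" using assms pi_ge_two by (simp add: divide_le_eq mult_le_cancel_left1)
  finally show ?thesis .
qed

lemma borel_measurable_band_kernel [measurable]: "band_kernel s \<in> borel_measurable borel"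
  by (intro borel_measurable_continuous_onI continuous_at_imp_continuous_on ballI
       DERIV_isCont[OF band_kernel_has_derivative])

lemma continuous_band_kernel': "continuous_on UNIV (band_kernel' s)"
proof -
  have "continuous_on UNIV (\<lambda>x. integral (cbox (-s) s) (\<lambda>u. - (u * sin (u * x))))"
    by (rule integral_continuous_on_param) (auto intro!: continuous_intros simp: case_prod_beta)
  then show ?thesis unfolding band_kernel'_def[abs_def] by (intro continuous_intros) auto
qed

lemma borel_measurable_band_kernel' [measurable]: "band_kernel' s \<in> borel_measurable borel"
  by (rule borel_measurable_continuous_onI[OF continuous_band_kernel'])

interpretation std_normal: prob_space std_normal_distribution
  by (rule prob_space_normal_density) simp

text \<open>Real and imaginary part of \<open>iexp (u * d)\<close> times the normal characteristic
  function at \<open>-u\<close>.\<close>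

lemma char_std_normal_shift:
  "(\<integral>z. cos (u * (d - z)) \<partial>std_normal_distribution) = cos (u * d) * exp (- u\<^sup>2 / 2)"
  "(\<integral>z. sin (u * (d - z)) \<partial>std_normal_distribution) = sin (u * d) * exp (- u\<^sup>2 / 2)"
proof -
  have int: "integrable std_normal_distribution (\<lambda>z. iexp (- u * z))"
    by (rule std_normal.integrable_iexp) simp_all
  have "(\<integral>z. iexp (u * d) * iexp (- u * z) \<partial>std_normal_distribution)
      = iexp (u * d) * (\<integral>z. iexp (- u * z) \<partial>std_normal_distribution)"
    by (simp only: integral_mult_right_zero)
  also have "(\<integral>z. iexp (- u * z) \<partial>std_normal_distribution) = exp (- u\<^sup>2 / 2)"
    using fun_cong[OF char_std_normal_distribution, of "-u"] by (simp add: char_def)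
  finally have eq: "(\<integral>z. iexp (u * d) * iexp (- u * z) \<partial>std_normal_distribution)
      = iexp (u * d) * exp (- u\<^sup>2 / 2)" .
  have split: "iexp (u * d) * iexp (- u * z) = iexp (u * (d - z))" for z
    by (simp add: exp_add[symmetric] algebra_simps)
  have int2: "integrable std_normal_distribution (\<lambda>z. iexp (u * (d - z)))"
    unfolding split[symmetric] by (intro integrable_mult_right int)
  have eq2: "(\<integral>z. iexp (u * (d - z)) \<partial>std_normal_distribution) = iexp (u * d) * exp (- u\<^sup>2 / 2)"
    using eq unfolding split .
  have "(\<integral>z. Re (iexp (u * (d - z))) \<partial>std_normal_distribution) = Re (iexp (u * d) * exp (- u\<^sup>2 / 2))"
    using integral_Re[OF int2] eq2 by simp
  then show "(\<integral>z. cos (u * (d - z)) \<partial>std_normal_distribution) = cos (u * d) * exp (- u\<^sup>2 / 2)"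
    by (simp add: Re_exp)
  have "(\<integral>z. Im (iexp (u * (d - z))) \<partial>std_normal_distribution) = Im (iexp (u * d) * exp (- u\<^sup>2 / 2))"
    using integral_Im[OF int2] eq2 by simp
  then show "(\<integral>z. sin (u * (d - z)) \<partial>std_normal_distribution) = sin (u * d) * exp (- u\<^sup>2 / 2)"
    by (simp add: Im_exp)
qed

text \<open>Integration by parts: the difference of the two integrands is the derivative of
  \<open>gauss u * sin (u * d)\<close>, which vanishes at both ends. It yields the Fourier integral
  for the derivative of the Gaussian without differentiating an improper integral.\<close>

lemma integral_gauss_mult_sin:
  "(\<integral>u. gauss u * (u * sin (u * d)) \<partial>lborel) = d * (\<integral>u. gauss u * cos (u * d) \<partial>lborel)"
proof -
  have int1: "integrable lborel (\<lambda>u. gauss u * cos (u * d))"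
    by (rule Bochner_Integration.integrable_bound[OF integrable_normal_density[of 1 0]])
       (auto simp: abs_mult mult_left_le)
  have int2: "integrable lborel (\<lambda>u. gauss u * (u * sin (u * d)))"
  proof (rule Bochner_Integration.integrable_bound[OF integrable_std_normal_moment_abs[of 1]])
    show "AE u in lborel. norm (gauss u * (u * sin (u * d))) \<le> norm (gauss u * \<bar>u\<bar> ^ 1)"
      by (intro always_eventually allI) (auto simp: abs_mult intro!: mult_left_mono mult_left_le)
  qed simp
  let ?F = "\<lambda>u. gauss u * sin (u * d)" and ?f = "\<lambda>u. d * (gauss u * cos (u * d)) - gauss u * (u * sin (u * d))"
  have deriv_gauss: "(gauss has_real_derivative - (u * gauss u)) (at u)" for u
  proof -
    have "((\<lambda>u. exp (- u\<^sup>2 / 2)) has_real_derivative - u * exp (- u\<^sup>2 / 2)) (at u)"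
      by (auto intro!: derivative_eq_intros)
    from DERIV_cmult[OF this, of "1 / sqrt (2 * pi)"] show ?thesis
      by (simp add: std_normal_density_def[abs_def])
  qed
  have lim: "((?F \<circ> real_of_ereal) \<longlongrightarrow> 0) F" 
    if "((\<lambda>x. gauss (real_of_ereal x)) \<longlongrightarrow> 0) F" for F
    by (rule Lim_null_comparison[OF _ that])
       (auto intro!: always_eventually mult_left_le simp: abs_mult)
  have g_top: "(gauss \<longlongrightarrow> 0) at_top" and g_bot: "(gauss \<longlongrightarrow> 0) at_bot"
    unfolding std_normal_density_def[abs_def] by real_asymp+
  have "(LBINT u=-\<infinity>..\<infinity>. ?f u) = 0 - 0"
  proof (rule interval_integral_FTC_integrable)
    show "(?F has_vector_derivative ?f u) (at u)" for u
      unfolding has_real_derivative_iff_has_vector_derivative[symmetric]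
      by (auto intro!: derivative_eq_intros deriv_gauss simp: algebra_simps)
    show "isCont ?f u" for u
      unfolding std_normal_density_def[abs_def] by (auto intro!: continuous_intros)
    show "set_integrable lborel (einterval (-\<infinity>) \<infinity>) ?f"
      using int1 int2 by (auto simp: set_integrable_def)
    show "((?F \<circ> real_of_ereal) \<longlongrightarrow> 0) (at_right (-\<infinity>))"
      by (rule lim) (use g_bot in \<open>simp add: at_right_MInf filterlim_filtermap\<close>)
    show "((?F \<circ> real_of_ereal) \<longlongrightarrow> 0) (at_left \<infinity>)"
      by (rule lim) (use g_top in \<open>simp add: at_left_PInf filterlim_filtermap\<close>)
  qed simp
  then have "(\<integral>u. ?f u \<partial>lborel) = 0"
    by (simp add: interval_lebesgue_integral_def set_lebesgue_integral_def)
  then show ?thesis using int1 int2 by simp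
qed

text \<open>The Gaussian is its own Fourier transform up to a factor. Keeping \<open>gauss u\<close>
  as the weight makes the difference to the truncated integral a plain tail integral.\<close>

lemma gauss_fourier:
  "gauss d = (\<integral>u. gauss u * cos (u * d) \<partial>lborel) / sqrt (2 * pi)"
  "- (d * gauss d) = (\<integral>u. gauss u * (- (u * sin (u * d))) \<partial>lborel) / sqrt (2 * pi)"
proof -
  have "(\<integral>u. gauss u * cos (u * d) \<partial>lborel) = (\<integral>u. cos (d * (0 - u)) \<partial>std_normal_distribution)"
    by (subst integral_density) (auto simp: mult.commute)
  also have "\<dots> = exp (- d\<^sup>2 / 2)" by (subst char_std_normal_shift) simp
  finally have *: "(\<integral>u. gauss u * cos (u * d) \<partial>lborel) = exp (- d\<^sup>2 / 2)" .
  show "gauss d = (\<integral>u. gauss u * cos (u * d) \<partial>lborel) / sqrt (2 * pi)"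
    unfolding * by (simp add: std_normal_density_def)
  show "- (d * gauss d) = (\<integral>u. gauss u * (- (u * sin (u * d))) \<partial>lborel) / sqrt (2 * pi)"
  proof -
    have "(\<integral>u. gauss u * (- (u * sin (u * d))) \<partial>lborel) = - (d * exp (- d\<^sup>2 / 2))"
      using integral_gauss_mult_sin[of d] * by simp
    then show ?thesis by (simp only: std_normal_density_def) simp
  qed
qed

lemma Fubini_std_normal_interval:
  assumes cont: "continuous_on UNIV (\<lambda>p :: real \<times> real. g (fst p) (snd p) :: real)"
    and bound: "\<And>u x. u \<in> {-s..s} \<Longrightarrow> \<bar>g u x\<bar> \<le> M"
  shows "(\<integral>z. integral {-s..s} (\<lambda>u. g u (d - z)) \<partial>std_normal_distribution)
    = (\<integral>u. indicator {-s..s} u * (\<integral>z. g u (d - z) \<partial>std_normal_distribution) \<partial>lborel)"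
proof -
  interpret P: pair_sigma_finite lborel std_normal_distribution
    by unfold_locales
  have g: "(\<lambda>p. g (fst p) (snd p)) \<in> borel_measurable (borel \<Otimes>\<^sub>M borel)"
    by (simp add: borel_prod borel_measurable_continuous_onI[OF cont])
  have "(\<lambda>p. (fst p, d - snd p)) \<in> borel \<Otimes>\<^sub>M borel \<rightarrow>\<^sub>M borel \<Otimes>\<^sub>M (borel :: real measure)"
    by measurable
  from measurable_compose[OF this g]
  have [measurable]: "(\<lambda>p. g (fst p) (d - snd p)) \<in> borel_measurable (borel \<Otimes>\<^sub>M borel)"
    by simp
  have "integral {-s..s} (\<lambda>u. g u (d - z)) = (\<integral>u. indicator {-s..s} u * g u (d - z) \<partial>lborel)" for z
  proof -
    have "set_integrable lborel {-s..s} (\<lambda>u. g u (d - z))"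
      unfolding set_integrable_def
      by (rule borel_integrable_compact) 
        (auto intro!: continuous_on_compose2[OF cont, where f="\<lambda>u. (u, d - z)", simplified] continuous_intros)
    from set_borel_integral_eq_integral(2)[OF this] show ?thesis
      by (simp add: set_lebesgue_integral_def)
  qed
  then have "(\<integral>z. integral {-s..s} (\<lambda>u. g u (d - z)) \<partial>std_normal_distribution)
    = (\<integral>z. (\<integral>u. indicator {-s..s} u * g u (d - z) \<partial>lborel) \<partial>std_normal_distribution)" by simp
  also have "\<dots> = (\<integral>u. (\<integral>z. indicator {-s..s} u * g u (d - z) \<partial>std_normal_distribution) \<partial>lborel)"
  proof (rule P.Fubini_integral)
    show "integrable (lborel \<Otimes>\<^sub>M std_normal_distribution) (\<lambda>(u, z). indicator {-s..s} u * g u (d - z))"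
    proof (rule integrableI_bounded_set[where A="{-s..s} \<times> UNIV" and B=M])
      show "{-s..s} \<times> UNIV \<in> sets (lborel \<Otimes>\<^sub>M std_normal_distribution)" by measurable
      have "emeasure (lborel \<Otimes>\<^sub>M std_normal_distribution) ({-s..s} \<times> UNIV)
          = emeasure lborel {-s..s} * emeasure std_normal_distribution UNIV"
        by (intro std_normal.emeasure_pair_measure_Times) auto
      also have "\<dots> < \<infinity>" using std_normal.emeasure_space_1 by (simp add: emeasure_lborel_Icc_eq)
      finally show "emeasure (lborel \<Otimes>\<^sub>M std_normal_distribution) ({-s..s} \<times> UNIV) < \<infinity>" .
    qed (auto simp: case_prod_beta bound indicator_def intro!: always_eventually split: if_splits)
  qed
  finally show ?thesis by simp
qed

text \<open>The exponent u^2 / 2 is shared out: u^2 / 4 >= s^2 / 4 gives the small factor, one u^2 /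
  8 absorbs \<open>1 + \<bar>u\<bar>\<close>, and the other is the exponent of a normal density of
  standard deviation 2, whose integral is known.\<close>

lemma gauss_tail_dominated:
  assumes "s \<ge> 0"
  shows "(1 - indicator {-s..s} u) * (gauss u * (1 + \<bar>u\<bar>)) \<le> 8 * exp (- s\<^sup>2 / 4) * normal_density 0 2 u"
proof (cases "u \<in> {-s..s}")
  case False
  then have "s\<^sup>2 \<le> u\<^sup>2" using assms power_mono[of s "\<bar>u\<bar>" 2] by auto
  then have e: "exp (- u\<^sup>2 / 2) \<le> exp (- s\<^sup>2 / 4) * exp (- u\<^sup>2 / 8) * exp (- u\<^sup>2 / 8)"
    unfolding exp_add[symmetric] by simp
  have "1 + \<bar>u\<bar> \<le> 4 * (1 + u\<^sup>2 / 8)"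
  proof -
    have "0 \<le> (\<bar>u\<bar> - 1)\<^sup>2" by simp
    then show ?thesis by (simp add: power2_eq_square algebra_simps)
  qed
  also have "\<dots> \<le> 4 * exp (u\<^sup>2 / 8)" by (intro mult_left_mono exp_ge_add_one_self) simp
  finally have "exp (- u\<^sup>2 / 2) * (1 + \<bar>u\<bar>) \<le> (exp (- s\<^sup>2 / 4) * exp (- u\<^sup>2 / 8) * exp (- u\<^sup>2 / 8)) * (4 * exp (u\<^sup>2 / 8))"
    by (intro mult_mono e) auto
  also have "\<dots> = 4 * exp (- s\<^sup>2 / 4) * exp (- u\<^sup>2 / 8)"
    by (simp add: exp_minus)
  finally have "exp (- u\<^sup>2 / 2) * (1 + \<bar>u\<bar>) / sqrt (2 * pi) \<le> 4 * exp (- s\<^sup>2 / 4) * exp (- u\<^sup>2 / 8) / sqrt (2 * pi)"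
    by (intro divide_right_mono) auto
  moreover have "sqrt (2 * pi * 2\<^sup>2) = 2 * sqrt (2 * pi)"
    by (simp only: real_sqrt_mult real_sqrt_abs)
  ultimately show ?thesis using False
    by (simp add: std_normal_density_def normal_density_def)
qed (auto intro!: mult_nonneg_nonneg)

text \<open>The two expressions differ by an integral over \<bar>u\<bar> > s. The growth bound
  \<open>1 + \<bar>u\<bar>\<close> is met both by cos (u d) and by its derivative in d, so that one
  tail estimate serves the kernel and its derivative. At \<open>s = univ_thr n\<close> the bound is
  4 / sqrt n.\<close>

lemma truncated_fourier_bias:
  assumes "s \<ge> 0" and [measurable]: "f \<in> borel_measurable borel"
    and f: "\<And>u. \<bar>f u\<bar> \<le> 1 + \<bar>u\<bar>"
  shows "\<bar>(\<integral>u. indicator {-s..s} u * (f u * exp (- u\<^sup>2 / 2)) \<partial>lborel) / (2 * pi)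
      - (\<integral>u. gauss u * f u \<partial>lborel) / sqrt (2 * pi)\<bar> \<le> 4 * exp (- s\<^sup>2 / 4)"
proof -
  have int0: "integrable lborel (\<lambda>u. gauss u * (1 + \<bar>u\<bar>))"
    using integrable_std_normal_moment_abs[of 1] integrable_normal_density[of 1 0]
    by (simp add: distrib_left)
  have int: "integrable lborel (\<lambda>u. gauss u * f u)"
  proof (rule Bochner_Integration.integrable_bound[OF int0])
    show "AE u in lborel. norm (gauss u * f u) \<le> norm (gauss u * (1 + \<bar>u\<bar>))"
    proof (intro always_eventually allI)
      fix u
      have "gauss u * \<bar>f u\<bar> \<le> gauss u * (1 + \<bar>u\<bar>)" by (intro mult_left_mono f) simp
      then show "norm (gauss u * f u) \<le> norm (gauss u * (1 + \<bar>u\<bar>))"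
        by (simp only: real_norm_def abs_mult) simp
    qed
  qed measurable
  have inti: "integrable lborel (\<lambda>u. indicator {-s..s} u * (gauss u * f u))"
    by (rule Bochner_Integration.integrable_bound[OF int]) (auto split: split_indicator)
  have "exp (- u\<^sup>2 / 2) = gauss u * sqrt (2 * pi)" for u
    by (simp add: std_normal_density_def)
  then have "(\<integral>u. indicator {-s..s} u * (f u * exp (- u\<^sup>2 / 2)) \<partial>lborel) / (2 * pi)
      = (\<integral>u. indicator {-s..s} u * (gauss u * f u) * sqrt (2 * pi) \<partial>lborel) / (2 * pi)"
    by (simp only: mult.assoc mult.commute[of "f _"])
  also have "\<dots> = (\<integral>u. indicator {-s..s} u * (gauss u * f u) \<partial>lborel) / sqrt (2 * pi)"
    unfolding integral_mult_left_zero times_divide_eq_right[symmetric]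
    by (subst sqrt_divide_self_eq) (simp_all add: divide_inverse)
  finally have eq: "(\<integral>u. indicator {-s..s} u * (f u * exp (- u\<^sup>2 / 2)) \<partial>lborel) / (2 * pi)
      = (\<integral>u. indicator {-s..s} u * (gauss u * f u) \<partial>lborel) / sqrt (2 * pi)" .
  have eq2: "(\<integral>u. (1 - indicator {-s..s} u) * (gauss u * f u) \<partial>lborel)
     = (\<integral>u. gauss u * f u \<partial>lborel) - (\<integral>u. indicator {-s..s} u * (gauss u * f u) \<partial>lborel)"
    unfolding left_diff_distrib mult_1 by (rule Bochner_Integration.integral_diff[OF int inti])
  have "\<bar>(\<integral>u. indicator {-s..s} u * (f u * exp (- u\<^sup>2 / 2)) \<partial>lborel) / (2 * pi)
      - (\<integral>u. gauss u * f u \<partial>lborel) / sqrt (2 * pi)\<bar>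
     = \<bar>\<integral>u. (1 - indicator {-s..s} u) * (gauss u * f u) \<partial>lborel\<bar> / sqrt (2 * pi)"
    unfolding eq eq2 diff_divide_distrib[symmetric] abs_divide by (simp add: abs_minus_commute)
  also have "\<dots> \<le> (\<integral>u. 8 * exp (- s\<^sup>2 / 4) * normal_density 0 2 u \<partial>lborel) / sqrt (2 * pi)"
  proof (intro divide_right_mono)
    show "\<bar>\<integral>u. (1 - indicator {-s..s} u) * (gauss u * f u) \<partial>lborel\<bar> \<le> (\<integral>u. 8 * exp (- s\<^sup>2 / 4) * normal_density 0 2 u \<partial>lborel)"
      unfolding real_norm_def[symmetric]
    proof (rule Bochner_Integration.integral_norm_bound_integral)
      show "norm ((1 - indicator {-s..s} u) * (gauss u * f u)) \<le> 8 * exp (- s\<^sup>2 / 4) * normal_density 0 2 u" for u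
      proof -
        have "norm ((1 - indicator {-s..s} u) * (gauss u * f u)) = (1 - indicator {-s..s} u) * (gauss u * \<bar>f u\<bar>)"
          by (simp add: abs_mult split: split_indicator)
        also have "\<dots> \<le> (1 - indicator {-s..s} u) * (gauss u * (1 + \<bar>u\<bar>))"
          by (intro mult_left_mono f) (auto split: split_indicator)
        finally show ?thesis using gauss_tail_dominated[OF assms(1), of u] by linarith
      qed
      show "integrable lborel (\<lambda>u. (1 - indicator {-s..s} u) * (gauss u * f u))"
        unfolding left_diff_distrib mult_1 by (rule Bochner_Integration.integrable_diff[OF int inti])
    qed (auto intro!: integrable_mult_right)
  qed simp
  also have "\<dots> = 8 * exp (- s\<^sup>2 / 4) / sqrt (2 * pi)" by simp
  also have "\<dots> \<le> 8 * exp (- s\<^sup>2 / 4) / 2"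
  proof (rule divide_left_mono)
    show "2 \<le> sqrt (2 * pi)" using pi_ge_two by (intro real_le_rsqrt) simp
  qed auto
  finally show ?thesis by simp
qed

lemma band_kernel_bias:
  assumes "s \<ge> 0"
  shows "\<bar>(\<integral>z. band_kernel s (d - z) \<partial>std_normal_distribution) - gauss d\<bar> \<le> 4 * exp (- s\<^sup>2 / 4)"
proof -
  have "(\<integral>z. band_kernel s (d - z) \<partial>std_normal_distribution)
    = (\<integral>u. indicator {-s..s} u * (\<integral>z. cos (u * (d - z)) \<partial>std_normal_distribution) \<partial>lborel) / (2 * pi)"
    unfolding band_kernel_def integral_divide_zero
    by (subst Fubini_std_normal_interval[where g="\<lambda>u x. cos (u * x)" and M=1])
       (auto intro!: continuous_intros)
  then have eq: "(\<integral>z. band_kernel s (d - z) \<partial>std_normal_distribution)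
    = (\<integral>u. indicator {-s..s} u * (cos (u * d) * exp (- u\<^sup>2 / 2)) \<partial>lborel) / (2 * pi)"
    unfolding char_std_normal_shift .
  have "\<bar>cos (u * d)\<bar> \<le> 1 + \<bar>u\<bar>" for u
    using abs_cos_le_one[of "u * d"] by linarith
  then show ?thesis
    unfolding eq gauss_fourier(1)[of d] by (intro truncated_fourier_bias[OF assms]) simp_all
qed

lemma band_kernel'_bias:
  assumes "s \<ge> 0"
  shows "\<bar>(\<integral>z. band_kernel' s (d - z) \<partial>std_normal_distribution) - (- (d * gauss d))\<bar> \<le> 4 * exp (- s\<^sup>2 / 4)"
proof -
  have inner: "(\<integral>z. - (u * sin (u * (d - z))) \<partial>std_normal_distribution) = (- (u * sin (u * d))) * exp (- u\<^sup>2 / 2)" for u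
  proof -
    have "(\<integral>z. (- u) * sin (u * (d - z)) \<partial>std_normal_distribution)
        = (- u) * (\<integral>z. sin (u * (d - z)) \<partial>std_normal_distribution)"
      by (rule integral_mult_right_zero)
    then show ?thesis unfolding char_std_normal_shift(2) by (simp only: mult_minus_left mult.assoc)
  qed
  have bound: "\<bar>- (u * sin (u * x))\<bar> \<le> s" if "u \<in> {-s..s}" for u x
  proof -
    have "\<bar>u\<bar> * \<bar>sin (u * x)\<bar> \<le> s * 1" using that assms by (intro mult_mono) auto
    then show ?thesis by (simp add: abs_mult)
  qed
  have cont: "continuous_on UNIV (\<lambda>p :: real \<times> real. - (fst p * sin (fst p * snd p)))"
    by (intro continuous_intros)
  note F = Fubini_std_normal_interval[where g="\<lambda>u x. - (u * sin (u * x))", OF cont bound, where d=d]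
  have "(\<integral>z. band_kernel' s (d - z) \<partial>std_normal_distribution)
    = (\<integral>u. indicator {-s..s} u * (\<integral>z. - (u * sin (u * (d - z))) \<partial>std_normal_distribution) \<partial>lborel) / (2 * pi)"
    unfolding band_kernel'_def integral_divide_zero by (subst F) (assumption, rule refl)
  also have "\<dots> = (\<integral>u. indicator {-s..s} u * ((- (u * sin (u * d))) * exp (- u\<^sup>2 / 2)) \<partial>lborel) / (2 * pi)"
    unfolding inner ..
  finally have eq: "(\<integral>z. band_kernel' s (d - z) \<partial>std_normal_distribution)
    = (\<integral>u. indicator {-s..s} u * ((- (u * sin (u * d))) * exp (- u\<^sup>2 / 2)) \<partial>lborel) / (2 * pi)" .
  have "\<bar>- (u * sin (u * d))\<bar> \<le> 1 + \<bar>u\<bar>" for u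
    using mult_left_le[of "\<bar>sin (u * d)\<bar>" "\<bar>u\<bar>"] by (simp add: abs_mult)
  then show ?thesis
    unfolding eq gauss_fourier(2)[of d] by (intro truncated_fourier_bias[OF assms]) simp_all
qed

section \<open>Concentration given one coordinate\<close>

lemma prob_space_std_normal: "prob_space std_normal_distribution"
  by (rule prob_space_normal_density) simp

lemma prob_space_PiM_std_normal: "prob_space (PiM I (\<lambda>_. std_normal_distribution))"
  by (rule prob_space_PiM) (rule prob_space_std_normal)

text \<open>This freezes an evaluation point: the inner integral runs over all noise coordinates
  except \<open>i\<close>.\<close>

lemma nn_integral_PiM_split:
  assumes i: "i \<in> I"
    and F: "F \<in> borel_measurable (PiM I (\<lambda>_. std_normal_distribution))"
  shows "(\<integral>\<^sup>+ z. F z \<partial>PiM I (\<lambda>_. std_normal_distribution))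
    = (\<integral>\<^sup>+ t. \<integral>\<^sup>+ w. F (w(i := t)) \<partial>PiM (I - {i}) (\<lambda>_. std_normal_distribution) \<partial>std_normal_distribution)"
proof -
  let ?N = "std_normal_distribution" and ?Q = "PiM (I - {i}) (\<lambda>_. std_normal_distribution)"
  interpret Q: prob_space ?Q by (rule prob_space_PiM_std_normal)
  have ins: "insert i (I - {i}) = I" using i by auto
  have upd: "(\<lambda>(x, X). X(i := x)) \<in> ?N \<Otimes>\<^sub>M ?Q \<rightarrow>\<^sub>M PiM I (\<lambda>_. ?N)"
    using measurable_compose[OF measurable_pair_swap' measurable_add_dim[of i "I - {i}" "\<lambda>_. ?N"]]
    unfolding ins by (simp add: case_prod_beta)
  have "distr (?N \<Otimes>\<^sub>M ?Q) (PiM I (\<lambda>_. ?N)) (\<lambda>(x, X). X(i := x)) = PiM I (\<lambda>_. ?N)"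
    using distr_pair_PiM_eq_PiM[of "I - {i}" "\<lambda>_. ?N" i] unfolding ins by (simp add: prob_space_std_normal)
  then have "(\<integral>\<^sup>+ z. F z \<partial>PiM I (\<lambda>_. ?N)) = (\<integral>\<^sup>+ z. F z \<partial>distr (?N \<Otimes>\<^sub>M ?Q) (PiM I (\<lambda>_. ?N)) (\<lambda>(x, X). X(i := x)))"
    by simp
  also have "\<dots> = (\<integral>\<^sup>+ p. F (case p of (x, X) \<Rightarrow> X(i := x)) \<partial>(?N \<Otimes>\<^sub>M ?Q))"
    by (rule nn_integral_distr[OF upd]) (use F in simp)
  also have "\<dots> = (\<integral>\<^sup>+ t. \<integral>\<^sup>+ w. F (case (t, w) of (x, X) \<Rightarrow> X(i := x)) \<partial>?Q \<partial>?N)"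
    by (rule Q.nn_integral_fst[symmetric]) (rule measurable_compose[OF upd F])
  finally show ?thesis by simp
qed

lemma indep_vars_PiM_std_normal:
  assumes "A \<noteq> {}" "inj_on \<iota> A" "\<iota> ` A \<subseteq> I"
  shows "prob_space.indep_vars (PiM I (\<lambda>_. std_normal_distribution)) (\<lambda>_. std_normal_distribution) (\<lambda>l w. w (\<iota> l)) A"
proof -
  let ?N = "std_normal_distribution" and ?Q = "PiM I (\<lambda>_. std_normal_distribution)"
  interpret Q: prob_space ?Q by (rule prob_space_PiM_std_normal)
  have comp: "distr ?Q ?N (\<lambda>w. w (\<iota> l)) = ?N" if "l \<in> A" for l
    using distr_PiM_component[of I "\<lambda>_. ?N" "\<iota> l"] that assms prob_space_std_normal by auto
  have "distr ?Q (\<Pi>\<^sub>M l\<in>A. ?N) (\<lambda>w. \<lambda>l\<in>A. w (\<iota> l)) = (\<Pi>\<^sub>M l\<in>A. ?N)"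
    using distr_PiM_reindex[of I "\<lambda>_. ?N" \<iota> A] assms prob_space_std_normal by auto
  also have "\<dots> = (\<Pi>\<^sub>M l\<in>A. distr ?Q ?N (\<lambda>w. w (\<iota> l)))"
    by (intro PiM_cong) (simp_all add: comp)
  finally show ?thesis
    using assms by (subst Q.indep_vars_iff_distr_eq_PiM') (auto intro!: measurable_component_singleton)
qed

text \<open>
  The summand \<open>f x\<close> of the fixed coordinate costs \<open>2 * M / n\<close>; the factor \<open>exp 1\<close> and the constant
  4 absorb it, so that no condition linking \<open>r\<close> and \<open>n\<close> is needed.
\<close>

lemma leave_one_out_concentration:
  fixes \<iota> :: "nat \<Rightarrow> 'i" and \<theta> :: "nat \<Rightarrow> real"
  assumes n: "n \<ge> 2" and k: "k \<in> {1..n}"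
    and \<iota>: "inj_on \<iota> {1..n}" "\<iota> ` ({1..n} - {k}) \<subseteq> I"
    and [measurable]: "f \<in> borel_measurable borel"
    and M: "M > 0" "\<And>x. \<bar>f x\<bar> \<le> M" and r: "r \<ge> 0"
  defines "Q \<equiv> PiM I (\<lambda>_. std_normal_distribution)"
  shows "measure Q {w \<in> space Q. r \<le> \<bar>(f x + (\<Sum>l\<in>{1..n} - {k}. f (\<theta> l + w (\<iota> l)))) / real n
      - (\<Sum>l=1..n. \<integral>z. f (\<theta> l + z) \<partial>std_normal_distribution) / real n\<bar>} \<le> 2 * exp (1 - real n * r\<^sup>2 / (4 * M\<^sup>2))"
    (is "measure Q ?E \<le> _")
proof -
  let ?N = "std_normal_distribution"
  interpret Q: prob_space Q unfolding Q_def by (rule prob_space_PiM_std_normal)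
  define A where "A = {1..n} - {k}"
  define m where "m l = (\<integral>z. f (\<theta> l + z) \<partial>?N)" for l
  define e where "e = real n * r - 2 * M"
  have cardA: "card A = n - 1" using k by (simp add: A_def)
  have "card A \<noteq> 0" using cardA n by linarith
  then have A: "finite A" "A \<noteq> {}" by (auto intro: card_ge_0_finite)
  have \<iota>A: "inj_on \<iota> A" "\<iota> ` A \<subseteq> I" using \<iota>(2) inj_on_subset[OF \<iota>(1), of A] by (simp_all add: A_def)
  have int: "integrable ?N (\<lambda>z. f (\<theta> l + z))" for l
    by (rule std_normal.integrable_const_bound[where B=M]) (use M in auto)
  have m_le: "\<bar>m l\<bar> \<le> M" for l
  proof -
    have "norm (m l) \<le> (\<integral>z. M \<partial>?N)" unfolding m_def
      by (rule Bochner_Integration.integral_norm_bound_integral) (use M int in auto)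
    then show ?thesis using std_normal.prob_space by simp
  qed
  show ?thesis
  proof (cases "e < 0")
    \<comment> \<open>For negative \<open>e\<close> Hoeffding's inequality says nothing, but then n
      r < 2 M makes the exponent nonnegative and the claimed bound at least 2.\<close>
    case True
    then have "real n * r < 2 * M" by (simp add: e_def)
    then have "(real n * r)\<^sup>2 \<le> (2 * M)\<^sup>2" using r by (intro power_mono) auto
    then have "real n * r\<^sup>2 / (4 * M\<^sup>2) * real n \<le> 1 * 1"
      using M by (simp add: field_simps power2_eq_square)
    then have "real n * r\<^sup>2 / (4 * M\<^sup>2) \<le> 1"
      using n mult_left_mono[of 1 "real n" "real n * r\<^sup>2 / (4 * M\<^sup>2)"] by simp
    then have "1 \<le> exp (1 - real n * r\<^sup>2 / (4 * M\<^sup>2))" by simp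
    then show ?thesis using Q.prob_le_1[of ?E] by linarith
  next
    case False
    have meas: "(\<lambda>w. f (\<theta> l + w (\<iota> l))) \<in> borel_measurable Q" if "l \<in> A" for l
    proof -
      have "(\<lambda>w. w (\<iota> l)) \<in> Q \<rightarrow>\<^sub>M ?N" unfolding Q_def
        using that \<iota>A by (intro measurable_component_singleton) auto
      from measurable_compose[OF this, of "\<lambda>z. f (\<theta> l + z)" borel] show ?thesis by simp
    qed
    have "Q.indep_vars (\<lambda>_. ?N) (\<lambda>l w. w (\<iota> l)) A"
      unfolding Q_def by (rule indep_vars_PiM_std_normal) (use A \<iota>A in auto)
    then have indep: "Q.indep_vars (\<lambda>_. borel) (\<lambda>l w. f (\<theta> l + w (\<iota> l))) A"
      by (rule Q.indep_vars_compose2) simp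
    interpret H: Hoeffding_ineq Q A "\<lambda>l w. f (\<theta> l + w (\<iota> l))" "\<lambda>_. - M" "\<lambda>_. M"
      "\<Sum>l\<in>A. Q.expectation (\<lambda>w. f (\<theta> l + w (\<iota> l)))"
    proof unfold_locales
      show "AE w in Q. f (\<theta> l + w (\<iota> l)) \<in> {- M..M}" for l
        using M(2)[of "\<theta> l + w (\<iota> l)" for w] by (auto simp: abs_le_iff minus_le_iff)
    qed (use A indep in auto)
    have E: "Q.expectation (\<lambda>w. f (\<theta> l + w (\<iota> l))) = m l" if "l \<in> A" for l
    proof -
      have "m l = (\<integral>z. f (\<theta> l + z) \<partial>distr Q ?N (\<lambda>w. w (\<iota> l)))"
        unfolding m_def Q_def using that \<iota>A distr_PiM_component[of I "\<lambda>_. ?N" "\<iota> l"] prob_space_std_normal by auto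
      also have "\<dots> = Q.expectation (\<lambda>w. f (\<theta> l + w (\<iota> l)))"
        unfolding Q_def using that \<iota>A
        by (intro integral_distr measurable_component_singleton) auto
      finally show ?thesis ..
    qed
    have "?E \<subseteq> {w \<in> space Q. e \<le> \<bar>(\<Sum>l\<in>A. f (\<theta> l + w (\<iota> l))) - (\<Sum>l\<in>A. m l)\<bar>}"
    proof safe
      fix w assume "r \<le> \<bar>(f x + (\<Sum>l\<in>{1..n} - {k}. f (\<theta> l + w (\<iota> l)))) / real n
      - (\<Sum>l=1..n. \<integral>z. f (\<theta> l + z) \<partial>std_normal_distribution) / real n\<bar>"
      then have "r \<le> \<bar>(f x + (\<Sum>l\<in>A. f (\<theta> l + w (\<iota> l)))) / real n - (\<Sum>l=1..n. m l) / real n\<bar>"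
        unfolding A_def m_def .
      moreover have "(\<Sum>l=1..n. m l) = m k + (\<Sum>l\<in>A. m l)"
        using k unfolding A_def by (intro sum.remove) auto
      ultimately have "r \<le> \<bar>(f x - m k) + ((\<Sum>l\<in>A. f (\<theta> l + w (\<iota> l))) - (\<Sum>l\<in>A. m l))\<bar> / real n"
        using n by (simp add: diff_divide_distrib[symmetric] abs_divide algebra_simps)
      then have "r * real n \<le> \<bar>(f x - m k) + ((\<Sum>l\<in>A. f (\<theta> l + w (\<iota> l))) - (\<Sum>l\<in>A. m l))\<bar>"
        using n by (simp add: pos_le_divide_eq)
      then show "e \<le> \<bar>(\<Sum>l\<in>A. f (\<theta> l + w (\<iota> l))) - (\<Sum>l\<in>A. m l)\<bar>"
        using M(2)[of x] m_le[of k] unfolding e_def by (simp add: mult.commute)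
    qed
    then have "measure Q ?E \<le> measure Q {w \<in> space Q. e \<le> \<bar>(\<Sum>l\<in>A. f (\<theta> l + w (\<iota> l))) - (\<Sum>l\<in>A. m l)\<bar>}"
      by (intro Q.finite_measure_mono) (auto intro!: borel_measurable_le borel_measurable_abs borel_measurable_diff borel_measurable_sum meas)
    also have "\<dots> \<le> 2 * exp (- 2 * e\<^sup>2 / (\<Sum>l\<in>A. (M - - M)\<^sup>2))"
    proof -
      have pos: "0 < (\<Sum>l\<in>A. (M - - M)\<^sup>2)" using M by (intro sum_pos A) auto
      have "(\<Sum>l\<in>A. Q.expectation (\<lambda>w. f (\<theta> l + w (\<iota> l)))) = (\<Sum>l\<in>A. m l)"
        by (intro sum.cong refl E)
      then show ?thesis using H.Hoeffding_ineq_abs_ge[OF _ pos, of e] False by simp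
    qed
    also have "\<dots> \<le> 2 * exp (1 - real n * r\<^sup>2 / (4 * M\<^sup>2))"
    proof -
      have sumA: "(\<Sum>l\<in>A. (M - - M)\<^sup>2) = real (n - 1) * (4 * M\<^sup>2)"
        by (simp add: cardA power2_eq_square)
      \<comment> \<open>Since e = n r - 2 M, this is (n r - 4 M)^2 >= 0. After division by 2 n M^2
        the extra 4 M^2 becomes 2 / n <= 1, the source of the 1 in the exponent.\<close>
      have "(real n * r)\<^sup>2 / 2 \<le> e\<^sup>2 + 4 * M\<^sup>2"
      proof -
        have "0 \<le> (real n * r - 4 * M)\<^sup>2" by simp
        then show ?thesis unfolding e_def by (simp add: power2_eq_square algebra_simps)
      qed
      then have "(real n * r)\<^sup>2 / 2 / (2 * real n * M\<^sup>2) \<le> (e\<^sup>2 + 4 * M\<^sup>2) / (2 * real n * M\<^sup>2)"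
        by (intro divide_right_mono) auto
      also have "\<dots> = e\<^sup>2 / (2 * real n * M\<^sup>2) + 2 / real n"
        using M n by (simp add: field_simps)
      also have "\<dots> \<le> e\<^sup>2 / (2 * real (n - 1) * M\<^sup>2) + 1"
        using M n by (intro add_mono divide_left_mono mult_right_mono mult_left_mono) (auto simp: field_simps)
      also have "(real n * r)\<^sup>2 / 2 / (2 * real n * M\<^sup>2) = real n * r\<^sup>2 / (4 * M\<^sup>2)"
        using M n by (simp add: field_simps power2_eq_square)
      finally show ?thesis unfolding sumA by (simp add: mult_ac)
    qed
    finally show ?thesis .
  qed
qed

section \<open>Gaussian mixtures and Bayes rules\<close>

definition mixture :: "nat \<Rightarrow> (nat \<Rightarrow> real) \<Rightarrow> real \<Rightarrow> real" where
  "mixture n \<theta> x = (\<Sum>k=1..n. gauss (x - \<theta> k)) / real n"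

definition mixture' :: "nat \<Rightarrow> (nat \<Rightarrow> real) \<Rightarrow> real \<Rightarrow> real" where
  "mixture' n \<theta> x = (\<Sum>k=1..n. - ((x - \<theta> k) * gauss (x - \<theta> k))) / real n"

text \<open>For the mixture density \<phi> this is \<phi> + \<phi>''. By Cauchy-Schwarz it dominates
  \<phi>'^2 / \<phi>, the density times the squared Bayes correction.\<close>

definition mixture_sq :: "nat \<Rightarrow> (nat \<Rightarrow> real) \<Rightarrow> real \<Rightarrow> real" where
  "mixture_sq n \<theta> x = (\<Sum>k=1..n. (x - \<theta> k)\<^sup>2 * gauss (x - \<theta> k)) / real n"

text \<open>Tweedie's formula for the posterior mean under the uniform prior on the n means.\<close>

definition bayes_rule :: "nat \<Rightarrow> (nat \<Rightarrow> real) \<Rightarrow> real \<Rightarrow> real" where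
  "bayes_rule n \<theta> x = x + mixture' n \<theta> x / mixture n \<theta> x"

lemma gauss_pos: "gauss x > 0"
  by (rule normal_density_pos) simp

lemma mixture_pos: "n > 0 \<Longrightarrow> mixture n \<theta> x > 0"
  unfolding mixture_def by (intro divide_pos_pos sum_pos) (auto intro: gauss_pos)

lemma borel_measurable_mixture [measurable]:
  "mixture n \<theta> \<in> borel_measurable borel" "mixture' n \<theta> \<in> borel_measurable borel"
  "mixture_sq n \<theta> \<in> borel_measurable borel" "bayes_rule n \<theta> \<in> borel_measurable borel"
proof -
  show "mixture n \<theta> \<in> borel_measurable borel" "mixture' n \<theta> \<in> borel_measurable borel"
    "mixture_sq n \<theta> \<in> borel_measurable borel"
    unfolding mixture_def[abs_def] mixture'_def[abs_def] mixture_sq_def[abs_def] by measurable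
  then show "bayes_rule n \<theta> \<in> borel_measurable borel"
    unfolding bayes_rule_def[abs_def] by measurable
qed

text \<open>The deviations \<open>bayes_rule n \<theta> x - \<theta> k\<close> are orthogonal to
  constants under the weights \<open>gauss (x - \<theta> k)\<close>, so moving from the Bayes value
  to \<open>y\<close> adds a nonnegative square. As it holds for each \<open>x\<close>, the
  inequality can be integrated for any separable rule.\<close>

lemma bayes_rule_optimal:
  assumes "n > 0"
  shows "(\<Sum>k=1..n. (bayes_rule n \<theta> x - \<theta> k)\<^sup>2 * gauss (x - \<theta> k)) \<le> (\<Sum>k=1..n. (y - \<theta> k)\<^sup>2 * gauss (x - \<theta> k))"
proof -
  let ?b = "bayes_rule n \<theta> x"
  have "(\<Sum>k=1..n. (?b - \<theta> k) * gauss (x - \<theta> k)) = (\<Sum>k=1..n. (?b - x) * gauss (x - \<theta> k) + (x - \<theta> k) * gauss (x - \<theta> k))"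
    by (intro sum.cong) (auto simp: algebra_simps)
  also have "\<dots> = (?b - x) * (\<Sum>k=1..n. gauss (x - \<theta> k)) - (\<Sum>k=1..n. - ((x - \<theta> k) * gauss (x - \<theta> k)))"
    by (simp add: sum.distrib sum_distrib_left sum_negf)
  also have "\<dots> = (?b - x) * (real n * mixture n \<theta> x) - real n * mixture' n \<theta> x"
    using assms by (simp add: mixture_def mixture'_def)
  also have "\<dots> = 0"
    using mixture_pos[OF assms, of \<theta> x] by (simp add: bayes_rule_def field_simps)
  finally have orth: "(\<Sum>k=1..n. (?b - \<theta> k) * gauss (x - \<theta> k)) = 0" .
  have "(\<Sum>k=1..n. (y - \<theta> k)\<^sup>2 * gauss (x - \<theta> k)) = (\<Sum>k=1..n. (?b - \<theta> k)\<^sup>2 * gauss (x - \<theta> k)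
      + 2 * (y - ?b) * ((?b - \<theta> k) * gauss (x - \<theta> k)) + (y - ?b)\<^sup>2 * gauss (x - \<theta> k))"
    by (intro sum.cong) (auto simp: algebra_simps power2_eq_square)
  also have "\<dots> = (\<Sum>k=1..n. (?b - \<theta> k)\<^sup>2 * gauss (x - \<theta> k)) + 2 * (y - ?b) * (\<Sum>k=1..n. (?b - \<theta> k) * gauss (x - \<theta> k))
      + (\<Sum>k=1..n. (y - ?b)\<^sup>2 * gauss (x - \<theta> k))"
    by (simp add: sum.distrib sum_distrib_left)
  finally show ?thesis unfolding orth by (simp add: sum_nonneg)
qed

section \<open>Universal threshold and truncated Gaussian moments\<close>

definition univ_thr :: "nat \<Rightarrow> real" where "univ_thr n = sqrt (2 * ln (real n))"

lemma univ_thr_sq: "n \<ge> 1 \<Longrightarrow> (univ_thr n)\<^sup>2 = 2 * ln (real n)"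
  by (simp add: univ_thr_def)

lemma univ_thr_ge_1:
  assumes "n \<ge> 2" shows "univ_thr n \<ge> 1"
proof -
  have "ln 2 \<le> ln (real n)" using assms by simp
  then show ?thesis unfolding univ_thr_def using ln2_ge_two_thirds by (intro real_le_rsqrt) simp
qed

lemma exp_minus_univ_thr_sq:
  assumes "n \<ge> 1"
  shows "exp (- (univ_thr n)\<^sup>2 / 2) = 1 / real n" "exp (- (univ_thr n)\<^sup>2 / 4) = 1 / sqrt (real n)"
proof -
  show exp_minus_half: "exp (- (univ_thr n)\<^sup>2 / 2) = 1 / real n"
    using assms by (simp add: univ_thr_sq exp_minus inverse_eq_divide)
  have "exp (- (univ_thr n)\<^sup>2 / 4) = sqrt (exp (- (univ_thr n)\<^sup>2 / 2))"
    by (rule real_sqrt_unique[symmetric]) (simp_all add: exp_double[symmetric] power2_eq_square exp_add[symmetric])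
  also have "\<dots> = 1 / sqrt (real n)"
    unfolding exp_minus_half using assms by (simp add: real_sqrt_divide)
  finally show "exp (- (univ_thr n)\<^sup>2 / 4) = 1 / sqrt (real n)" .
qed

text \<open>Past the threshold s = \<open>univ_thr n\<close>, the excess y = u^2 - s^2 satisfies y
  exp (- y / 2) <= 2, and the remaining factor exp (- s^2 / 2) is 1 / n. The first moment is reduced
  to the second by \<bar>u\<bar> <= (u^2 + s^2) / (2 s).\<close>

lemma gauss_moment_truncation:
  assumes "n \<ge> 2"
  shows "u\<^sup>2 * gauss u \<le> (univ_thr n)\<^sup>2 * gauss u + 1 / real n"
    and "\<bar>u\<bar> * gauss u \<le> univ_thr n * gauss u + 1 / real n"
proof -
  define s where "s = univ_thr n"
  define y where "y = u\<^sup>2 - s\<^sup>2"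
  have "y * gauss u \<le> 1 / real n"
  proof (cases "y \<le> 0")
    case True
    then have "y * gauss u \<le> 0" by (intro mult_nonpos_nonneg) simp_all
    then show ?thesis using assms by (smt (verit) divide_nonneg_nonneg of_nat_0_le_iff)
  next
    case False
    have "y / 2 * exp (- (y / 2)) \<le> 1"
      using exp_ge_add_one_self[of "y / 2"] by (simp add: exp_minus field_simps)
    moreover have "exp (- u\<^sup>2 / 2) = 1 / real n * exp (- (y / 2))"
      using exp_minus_univ_thr_sq(1)[of n] assms unfolding s_def[symmetric] y_def
      by (simp add: exp_add[symmetric] diff_divide_distrib flip: exp_minus_univ_thr_sq)
    ultimately have "y * exp (- u\<^sup>2 / 2) \<le> 2 / real n"
      using assms by (simp add: field_simps)
    then have "y * exp (- u\<^sup>2 / 2) / sqrt (2 * pi) \<le> 2 / real n / 2"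
      using pi_ge_two assms False by (intro frac_le real_le_rsqrt) (auto intro!: mult_nonneg_nonneg)
    then show ?thesis by (simp add: std_normal_density_def)
  qed
  then show *: "u\<^sup>2 * gauss u \<le> (univ_thr n)\<^sup>2 * gauss u + 1 / real n"
    unfolding y_def s_def by (simp add: algebra_simps)
  have s1: "s \<ge> 1" unfolding s_def by (rule univ_thr_ge_1[OF assms])
  have "\<bar>u\<bar> * gauss u \<le> ((u\<^sup>2 + s\<^sup>2) / (2 * s)) * gauss u"
  proof (intro mult_right_mono)
    have "0 \<le> (\<bar>u\<bar> - s)\<^sup>2" by simp
    then show "\<bar>u\<bar> \<le> (u\<^sup>2 + s\<^sup>2) / (2 * s)" using s1
      by (simp add: pos_le_divide_eq power2_eq_square algebra_simps)
  qed simp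
  also have "\<dots> = (u\<^sup>2 * gauss u + s\<^sup>2 * gauss u) / (2 * s)" by (simp add: algebra_simps)
  also have "\<dots> \<le> (2 * s\<^sup>2 * gauss u + 1 / real n) / (2 * s)"
  proof (intro divide_right_mono)
    show "u\<^sup>2 * gauss u + s\<^sup>2 * gauss u \<le> 2 * s\<^sup>2 * gauss u + 1 / real n"
      using * unfolding s_def[symmetric] by linarith
  qed (use s1 in simp)
  also have "\<dots> = s * gauss u + (1 / real n) / (2 * s)"
    using s1 by (simp add: power2_eq_square add_divide_distrib)
  also have "(1 / real n) / (2 * s) \<le> (1 / real n) / 1"
    using s1 by (intro divide_left_mono) auto
  finally show "\<bar>u\<bar> * gauss u \<le> univ_thr n * gauss u + 1 / real n" unfolding s_def by simp
qed

text \<open>Averages of \<open>gauss_moment_truncation\<close> over the components, and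
  Cauchy-Schwarz. However far apart the means are, differentiating the mixture costs only a factor
  \<open>univ_thr n\<close>, up to 1 / n.\<close>

lemma mixture_bounds:
  assumes "n \<ge> 2"
  shows "mixture_sq n \<theta> x \<le> (univ_thr n)\<^sup>2 * mixture n \<theta> x + 1 / real n"
    and "\<bar>mixture' n \<theta> x\<bar> \<le> univ_thr n * mixture n \<theta> x + 1 / real n"
    and "(mixture' n \<theta> x)\<^sup>2 \<le> mixture n \<theta> x * mixture_sq n \<theta> x"
proof -
  have "(\<Sum>k=1..n. (x - \<theta> k)\<^sup>2 * gauss (x - \<theta> k)) \<le> (\<Sum>k=1..n. (univ_thr n)\<^sup>2 * gauss (x - \<theta> k) + 1 / real n)"
    by (intro sum_mono gauss_moment_truncation(1)[OF assms])
  also have "\<dots> = (univ_thr n)\<^sup>2 * (\<Sum>k=1..n. gauss (x - \<theta> k)) + 1"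
    using assms by (simp add: sum.distrib sum_distrib_left)
  finally have "(\<Sum>k=1..n. (x - \<theta> k)\<^sup>2 * gauss (x - \<theta> k)) \<le> (univ_thr n)\<^sup>2 * (\<Sum>k=1..n. gauss (x - \<theta> k)) + 1" .
  from divide_right_mono[OF this, of "real n"]
  show "mixture_sq n \<theta> x \<le> (univ_thr n)\<^sup>2 * mixture n \<theta> x + 1 / real n"
    unfolding mixture_sq_def mixture_def add_divide_distrib times_divide_eq_right by simp
  have "\<bar>\<Sum>k=1..n. - ((x - \<theta> k) * gauss (x - \<theta> k))\<bar> \<le> (\<Sum>k=1..n. univ_thr n * gauss (x - \<theta> k) + 1 / real n)"
    using gauss_moment_truncation(2)[OF assms]
    by (intro order_trans[OF sum_abs] sum_mono) (simp add: abs_mult)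
  also have "\<dots> = univ_thr n * (\<Sum>k=1..n. gauss (x - \<theta> k)) + 1"
    using assms by (simp add: sum.distrib sum_distrib_left)
  finally have "\<bar>\<Sum>k=1..n. - ((x - \<theta> k) * gauss (x - \<theta> k))\<bar> \<le> univ_thr n * (\<Sum>k=1..n. gauss (x - \<theta> k)) + 1" .
  from divide_right_mono[OF this, of "real n"]
  show "\<bar>mixture' n \<theta> x\<bar> \<le> univ_thr n * mixture n \<theta> x + 1 / real n"
    unfolding mixture'_def mixture_def add_divide_distrib times_divide_eq_right abs_divide by simp
  have "(\<Sum>k=1..n. - ((x - \<theta> k) * gauss (x - \<theta> k)))\<^sup>2
      = (\<Sum>k=1..n. sqrt (gauss (x - \<theta> k)) * ((x - \<theta> k) * sqrt (gauss (x - \<theta> k))))\<^sup>2"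
    by (simp add: sum_negf mult_ac)
  also have "\<dots> \<le> (\<Sum>k=1..n. (sqrt (gauss (x - \<theta> k)))\<^sup>2) * (\<Sum>k=1..n. ((x - \<theta> k) * sqrt (gauss (x - \<theta> k)))\<^sup>2)"
    by (rule Cauchy_Schwarz_ineq_sum)
  also have "\<dots> = (\<Sum>k=1..n. gauss (x - \<theta> k)) * (\<Sum>k=1..n. (x - \<theta> k)\<^sup>2 * gauss (x - \<theta> k))"
    by (simp add: power_mult_distrib)
  finally show "(mixture' n \<theta> x)\<^sup>2 \<le> mixture n \<theta> x * mixture_sq n \<theta> x"
    unfolding mixture'_def mixture_def mixture_sq_def power_divide times_divide_times_eq power2_eq_square[of "real n"]
    by (intro divide_right_mono) auto
qed

text \<open>Truncation from below at \<rho> is 1-Lipschitz, so the two denominators differ by at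
  most \<delta> <= L \<rho> and are comparable within the factor 2 L. The final denominator is the
  one formed with \<open>p\<close>, which for the true density is no longer random and can be
  integrated.\<close>

lemma regularized_ratio_diff:
  fixes p p' q q' \<rho> \<delta> L :: real
  assumes \<rho>: "\<rho> > 0" and L: "L \<ge> 1" and \<delta>: "0 \<le> \<delta>" "\<delta> \<le> L * \<rho>"
    and close: "\<bar>q - p\<bar> \<le> \<delta>" "\<bar>q' - p'\<bar> \<le> \<delta>" and p': "\<bar>p'\<bar> \<le> L * max \<rho> p"
  shows "\<bar>q' / max \<rho> q - p' / max \<rho> p\<bar> \<le> 4 * L\<^sup>2 * \<delta> / max \<rho> p"
proof -
  define D where "D = max \<rho> p" define E where "E = max \<rho> q"
  have pos: "D > 0" "E > 0" using \<rho> by (auto simp: D_def E_def)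
  have DE: "\<bar>D - E\<bar> \<le> \<delta>" using close(1) by (auto simp: D_def E_def max_def)
  have "D \<le> 2 * L * E"
  proof -
    have "L * \<rho> \<le> L * E" using L by (intro mult_left_mono) (auto simp: E_def)
    moreover have "E \<le> L * E" using L pos by simp
    ultimately show ?thesis using DE \<delta> by linarith
  qed
  then have inv: "1 / E \<le> 2 * L / D" using pos L by (simp add: field_simps)
  have "q' / E - p' / D = (q' - p') / E + p' / D * ((D - E) / E)"
    using pos by (simp add: field_simps)
  then have "\<bar>q' / E - p' / D\<bar> \<le> \<bar>q' - p'\<bar> / E + \<bar>p'\<bar> / D * (\<bar>D - E\<bar> / E)"
    using pos abs_triangle_ineq[of "(q' - p') / E" "p' / D * ((D - E) / E)"] by (simp add: abs_mult)
  also have "\<dots> \<le> \<delta> / E + L * (\<delta> / E)"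
    using pos close DE p' L unfolding D_def[symmetric]
    by (intro add_mono divide_right_mono mult_mono) (auto simp: pos_divide_le_eq)
  also have "\<dots> \<le> 2 * L * \<delta> * (1 / E)"
  proof -
    have "\<delta> \<le> L * \<delta>" using L \<delta> by (simp add: mult_le_cancel_right1)
    then have "(\<delta> + L * \<delta>) / E \<le> (2 * L * \<delta>) / E" using pos by (intro divide_right_mono) auto
    then show ?thesis by (simp add: add_divide_distrib)
  qed
  also have "\<dots> \<le> 2 * L * \<delta> * (2 * L / D)"
    using L \<delta> by (intro mult_left_mono inv) auto
  finally show ?thesis unfolding D_def[symmetric] E_def[symmetric] by (simp add: power2_eq_square mult_ac)
qed

text \<open>The first bound is meant for small means and rests on soft thresholding being
  1-Lipschitz; the second is meant for large means, as the rule moves its argument by at most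
  \<open>t\<close>.\<close>

lemma soft_threshold_loss:
  assumes "t \<ge> 0"
  shows "(soft_threshold t (\<theta> + z) - \<theta>)\<^sup>2 \<le> 2 * (soft_threshold t z)\<^sup>2 + 8 * \<theta>\<^sup>2"
    and "(soft_threshold t (\<theta> + z) - \<theta>)\<^sup>2 \<le> 2 * z\<^sup>2 + 2 * t\<^sup>2"
proof -
  have "\<bar>soft_threshold t (\<theta> + z) - soft_threshold t z\<bar> \<le> \<bar>\<theta>\<bar>"
    unfolding soft_threshold_def using assms by (auto simp: sgn_real_def max_def abs_real_def)
  then have "\<bar>soft_threshold t (\<theta> + z) - \<theta>\<bar> \<le> \<bar>soft_threshold t z\<bar> + 2 * \<bar>\<theta>\<bar>" by linarith
  then have "(soft_threshold t (\<theta> + z) - \<theta>)\<^sup>2 \<le> (\<bar>soft_threshold t z\<bar> + 2 * \<bar>\<theta>\<bar>)\<^sup>2"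
    by (metis abs_ge_zero power2_abs power_mono)
  also have "\<dots> \<le> 2 * (soft_threshold t z)\<^sup>2 + 8 * \<theta>\<^sup>2"
    using zero_le_power2[of "\<bar>soft_threshold t z\<bar> - 2 * \<bar>\<theta>\<bar>"] by (simp add: power2_diff power2_sum)
  finally show "(soft_threshold t (\<theta> + z) - \<theta>)\<^sup>2 \<le> 2 * (soft_threshold t z)\<^sup>2 + 8 * \<theta>\<^sup>2" .
  have "\<bar>soft_threshold t (\<theta> + z) - \<theta>\<bar> \<le> \<bar>z\<bar> + t"
    unfolding soft_threshold_def using assms by (auto simp: sgn_real_def max_def abs_real_def)
  then have "(soft_threshold t (\<theta> + z) - \<theta>)\<^sup>2 \<le> (\<bar>z\<bar> + t)\<^sup>2"
    by (metis abs_ge_zero power2_abs power_mono)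
  also have "\<dots> \<le> 2 * z\<^sup>2 + 2 * t\<^sup>2"
    using zero_le_power2[of "\<bar>z\<bar> - t"] by (simp add: power2_diff power2_sum)
  finally show "(soft_threshold t (\<theta> + z) - \<theta>)\<^sup>2 \<le> 2 * z\<^sup>2 + 2 * t\<^sup>2" .
qed

lemma borel_measurable_soft_threshold [measurable]: "soft_threshold t \<in> borel_measurable borel"
  unfolding soft_threshold_def[abs_def] by measurable

text \<open>With u = \<theta>^2 / 4 one has exp (- u) <= 1 / (1 + u), and min 1 (4 u) / 5 <= u / (1
  + u) is sharp at 4 u = 1, whence the 5. Through this bound the sparsity index controls the
  truncated squares of the means.\<close>

lemma min_le_one_minus_exp:
  fixes \<theta> :: real
  shows "min 1 (\<theta>\<^sup>2) / 5 \<le> 1 - exp (- \<theta>\<^sup>2 / 4)"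
proof -
  define u where "u = \<theta>\<^sup>2 / 4"
  have u: "u \<ge> 0" by (simp add: u_def)
  have "exp (- u) \<le> 1 / (1 + u)"
    using exp_ge_add_one_self[of u] u by (simp add: exp_minus field_simps)
  then have "u / (1 + u) \<le> 1 - exp (- u)" using u by (simp add: field_simps)
  moreover have "min 1 (4 * u) / 5 \<le> u / (1 + u)"
  proof -
    have "min 1 (4 * u) * (1 + u) \<le> 5 * u"
    proof (cases "4 * u \<le> 1")
      case True
      then have "u * (4 * u) \<le> u * 1" using u by (intro mult_left_mono)
      then show ?thesis using True by (simp add: min_def algebra_simps)
    qed (simp add: min_def)
    then show ?thesis using u by (simp add: field_simps)
  qed
  ultimately have "min 1 (4 * u) / 5 \<le> 1 - exp (- u)" by linarith
  then show ?thesis unfolding u_def by simp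
qed

text \<open>Small \<bar>x\<bar> uses p <= 2, large \<bar>x\<bar> uses p > 0. In this way a p-th
  moment controls both the sparsity index and the risk of soft thresholding.\<close>

lemma abs_powr_bounds:
  fixes x p :: real
  assumes "0 < p" "p \<le> 2"
  shows "1 - exp (- x\<^sup>2 / 4) \<le> \<bar>x\<bar> powr p" and "min 1 (x\<^sup>2) \<le> \<bar>x\<bar> powr p"
proof -
  show *: "min 1 (x\<^sup>2) \<le> \<bar>x\<bar> powr p"
  proof (cases "\<bar>x\<bar> \<le> 1")
    case True
    show ?thesis
    proof (cases "x = 0")
      case False
      then have "\<bar>x\<bar> powr 2 \<le> \<bar>x\<bar> powr p" using True assms by (intro powr_mono') auto
      then show ?thesis using False by simp
    qed simp
  next
    case False
    then have "\<bar>x\<bar> powr 0 \<le> \<bar>x\<bar> powr p" using assms by (intro powr_mono) auto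
    then show ?thesis using False by (intro order_trans[OF min.cobounded1]) (auto split: if_splits)
  qed
  have "1 - exp (- x\<^sup>2 / 4) \<le> min 1 (x\<^sup>2)"
  proof (rule min.boundedI)
    show "1 - exp (- x\<^sup>2 / 4) \<le> 1" by simp
    have "1 - exp (- x\<^sup>2 / 4) \<le> x\<^sup>2 / 4" using exp_ge_add_one_self[of "- x\<^sup>2 / 4"] by simp
    also have "\<dots> \<le> x\<^sup>2" by simp
    finally show "1 - exp (- x\<^sup>2 / 4) \<le> x\<^sup>2" .
  qed
  with * show "1 - exp (- x\<^sup>2 / 4) \<le> \<bar>x\<bar> powr p" by linarith
qed

section \<open>One resolution level\<close>

definition emp :: "nat \<Rightarrow> (nat \<Rightarrow> real) \<Rightarrow> real \<Rightarrow> real" where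
  "emp n v x = (\<Sum>l=1..n. band_kernel (univ_thr n) (x - v l)) / real n"

definition emp' :: "nat \<Rightarrow> (nat \<Rightarrow> real) \<Rightarrow> real \<Rightarrow> real" where
  "emp' n v x = (\<Sum>l=1..n. band_kernel' (univ_thr n) (x - v l)) / real n"

definition emp_kappa :: "nat \<Rightarrow> (nat \<Rightarrow> real) \<Rightarrow> real" where
  "emp_kappa n v = 1 - (\<Sum>l=1..n. sqrt 2 * exp (- ((v l)\<^sup>2 / 2))) / real n"

text \<open>The expectation of \<open>emp_kappa\<close>, since \<open>sqrt 2 * exp (- X\<^sup>2 / 2)\<close> has mean \<open>exp (- \<theta>\<^sup>2 / 4)\<close> for \<open>X ~ N(\<theta>, 1)\<close>.\<close>

definition pop_kappa :: "nat \<Rightarrow> (nat \<Rightarrow> real) \<Rightarrow> real" where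
  "pop_kappa n \<theta> = 1 - (\<Sum>l=1..n. exp (- (\<theta> l)\<^sup>2 / 4)) / real n"

definition ratio_rule :: "nat \<Rightarrow> real \<Rightarrow> (nat \<Rightarrow> real) \<Rightarrow> real \<Rightarrow> real" where
  "ratio_rule n \<rho> v x = x + emp' n v x / max \<rho> (emp n v x)"

definition geb_rule :: "nat \<Rightarrow> real \<Rightarrow> real \<Rightarrow> (nat \<Rightarrow> real) \<Rightarrow> real \<Rightarrow> real" where
  "geb_rule n \<rho> b v x = (if emp_kappa n v > b then ratio_rule n \<rho> v x else soft_threshold (univ_thr n) x)"

lemma phi_hat_eq_emp:
  "phi_hat \<epsilon> y (int j) = emp (2 ^ j) (\<lambda>k. y (int j, k) / \<epsilon>)"
proof
  fix x
  have "0 \<le> univ_thr (2 ^ j)" by (simp add: univ_thr_def)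
  then show "phi_hat \<epsilon> y (int j) x = emp (2 ^ j) (\<lambda>k. y (int j, k) / \<epsilon>) x"
    unfolding phi_hat_def emp_def Let_def level_size_def nat_int univ_thr_def[symmetric]
    by (simp only: sinc_kernel_eq_band_kernel[symmetric] sum_distrib_left[symmetric] times_divide_eq_left)
qed

lemma deriv_emp: "deriv (emp n v) x = emp' n v x"
proof (rule DERIV_imp_deriv)
  have "((\<lambda>x. band_kernel (univ_thr n) (x - c)) has_real_derivative band_kernel' (univ_thr n) (x - c)) (at x)" for c
    using band_kernel_has_derivative[of "univ_thr n" "x - c"]
      DERIV_shift[of "band_kernel (univ_thr n)" "band_kernel' (univ_thr n) (x - c)" x "- c"] by simp
  then show "(emp n v has_real_derivative emp' n v x) (at x)"
    unfolding emp_def[abs_def] emp'_def by (intro DERIV_cdivide DERIV_sum)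
qed

lemma t_hat_eq_geb_rule:
  "t_hat \<rho>\<^sub>0 b\<^sub>0 \<eta> \<epsilon> y (int j) x
    = geb_rule (2 ^ j) (geb_rho \<rho>\<^sub>0 \<eta> (2 ^ j)) (geb_b b\<^sub>0 (2 ^ j)) (\<lambda>k. y (int j, k) / \<epsilon>) x"
  unfolding t_hat_def geb_rule_def ratio_rule_def phi_hat_eq_emp deriv_emp level_size_def Let_def nat_int
      kappa_hat_def emp_kappa_def univ_thr_def[symmetric]
  by (simp only: sum_distrib_left[symmetric] times_divide_eq_left)

text \<open>Completing the square turns the integrand into exp (- \<theta>^2 / 4) times the normal
  density with mean - \<theta> / 2 and variance 1 / 2.\<close>

lemma integral_exp_std_normal_shift:
  "(\<integral>z. sqrt 2 * exp (- ((\<theta> + z)\<^sup>2 / 2)) \<partial>std_normal_distribution) = exp (- \<theta>\<^sup>2 / 4)"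
proof -
  have "gauss z * (sqrt 2 * exp (- ((\<theta> + z)\<^sup>2 / 2))) = exp (- \<theta>\<^sup>2 / 4) * normal_density (- \<theta> / 2) (1 / sqrt 2) z" for z
  proof -
    have "sqrt (2 * pi) = sqrt 2 * sqrt pi" by (simp add: real_sqrt_mult)
    moreover have "exp (- z\<^sup>2 / 2) * exp (- ((\<theta> + z)\<^sup>2 / 2)) = exp (- \<theta>\<^sup>2 / 4) * exp (- (z + \<theta> / 2)\<^sup>2)"
      unfolding exp_add[symmetric] by (simp add: power2_eq_square algebra_simps)
    ultimately show ?thesis
      by (simp add: std_normal_density_def normal_density_def power_divide)
  qed
  then show ?thesis by (subst integral_density) auto
qed

text \<open>The map \<open>\<iota>\<close> places the \<open>n\<close> coordinates of a level among all noise coordinates \<open>I\<close>.\<close>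

locale level =
  fixes n :: nat and \<theta> :: "nat \<Rightarrow> real" and \<iota> :: "nat \<Rightarrow> 'i" and I :: "'i set" and \<rho> :: real
  assumes n2: "n \<ge> 2" and inj: "inj_on \<iota> {1..n}" and sub: "\<iota> ` {1..n} \<subseteq> I" and \<rho>: "\<rho> > 0"
begin

abbreviation (input) P where "P \<equiv> PiM I (\<lambda>_. std_normal_distribution)"
abbreviation (input) Q where "Q k \<equiv> PiM (I - {\<iota> k}) (\<lambda>_. std_normal_distribution)"
abbreviation (input) s where "s \<equiv> univ_thr n"

text \<open>The data vector of the level given that the k-th observation equals \<open>x\<close>;
  only the other coordinates are read off the noise \<open>w\<close>.\<close>

definition obs_vec :: "nat \<Rightarrow> real \<Rightarrow> ('i \<Rightarrow> real) \<Rightarrow> nat \<Rightarrow> real" where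
  "obs_vec k x w l = (if l = k then x else \<theta> l + w (\<iota> l))"

text \<open>
  The bias of the kernel estimates is at most \<open>4 / sqrt n\<close>; the rest of \<open>dev\<close> makes the Hoeffding
  bound \<open>exp (1 - s ^ 4)\<close>, which is smaller than every power of \<open>1 / n\<close> because \<open>s\<^sup>2 = 2 * ln n\<close>.
\<close>

definition dev :: real where "dev = 6 * s ^ 4 / sqrt (real n)"

lemma s1: "s \<ge> 1" by (rule univ_thr_ge_1[OF n2])

lemma dev_pos: "dev > 0" using s1 n2 unfolding dev_def by simp

lemma sum_vec:
  assumes "k \<in> {1..n}"
  shows "(\<Sum>l=1..n. f (obs_vec k x w l)) = f x + (\<Sum>l\<in>{1..n} - {k}. f (\<theta> l + w (\<iota> l)))"
proof -
  have "(\<Sum>l=1..n. f (obs_vec k x w l)) = f (obs_vec k x w k) + (\<Sum>l\<in>{1..n} - {k}. f (obs_vec k x w l))"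
    using assms by (intro sum.remove) auto
  also have "(\<Sum>l\<in>{1..n} - {k}. f (obs_vec k x w l)) = (\<Sum>l\<in>{1..n} - {k}. f (\<theta> l + w (\<iota> l)))"
    by (intro sum.cong) (auto simp: obs_vec_def)
  finally show ?thesis by (simp add: obs_vec_def)
qed

lemma sub_minus:
  assumes "k \<in> {1..n}" shows "\<iota> ` ({1..n} - {k}) \<subseteq> I - {\<iota> k}"
  using assms sub inj by (force dest: inj_onD)

lemma vec_concentration:
  assumes k: "k \<in> {1..n}" and f: "f \<in> borel_measurable borel"
    and M: "M > 0" "\<And>x. \<bar>f x\<bar> \<le> M" and r: "r \<ge> 0"
  shows "measure (Q k) {w \<in> space (Q k). r \<le> \<bar>(\<Sum>l=1..n. f (obs_vec k x w l)) / real n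
      - (\<Sum>l=1..n. \<integral>z. f (\<theta> l + z) \<partial>std_normal_distribution) / real n\<bar>} \<le> 2 * exp (1 - real n * r\<^sup>2 / (4 * M\<^sup>2))"
  unfolding sum_vec[OF k]
  by (rule leave_one_out_concentration[OF n2 k inj sub_minus[OF k] f M r])

lemma measurable_obs_vec:
  assumes k: "k \<in> {1..n}" and l: "l \<in> {1..n}"
  shows "(\<lambda>w. obs_vec k x w l) \<in> borel_measurable (Q k)"
proof (cases "l = k")
  case False
  then have "(\<lambda>w. w (\<iota> l)) \<in> Q k \<rightarrow>\<^sub>M std_normal_distribution"
    using sub_minus[OF k] l by (intro measurable_component_singleton) blast
  then have "(\<lambda>w. w (\<iota> l)) \<in> borel_measurable (Q k)" by (simp add: measurable_def)
  then show ?thesis using False unfolding obs_vec_def by simp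
qed (simp add: obs_vec_def)

lemma measurable_sum_vec:
  fixes f :: "real \<Rightarrow> real"
  assumes k: "k \<in> {1..n}" and f: "f \<in> borel_measurable borel"
  shows "(\<lambda>w. \<Sum>l=1..n. f (obs_vec k x w l)) \<in> borel_measurable (Q k)"
proof (rule borel_measurable_sum)
  fix l assume "l \<in> {1..n}"
  from measurable_compose[OF measurable_obs_vec[OF k this] f]
  show "(\<lambda>w. f (obs_vec k x w l)) \<in> borel_measurable (Q k)" .
qed

text \<open>Stated for a general \<open>f\<close> so that it covers the kernel with
  \<open>g = gauss\<close> and its derivative with the derivative of \<open>gauss\<close>; since s
  >= 1, the bound \<open>s\<^sup>2\<close> is common to both.\<close>

lemma emp_deviation:
  assumes k: "k \<in> {1..n}" and f [measurable]: "f \<in> borel_measurable borel"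
    and bound: "\<And>x. \<bar>f x\<bar> \<le> s\<^sup>2"
    and bias: "\<And>d. \<bar>(\<integral>z. f (d - z) \<partial>std_normal_distribution) - g d\<bar> \<le> 4 * exp (- s\<^sup>2 / 4)"
  shows "measure (Q k) {w \<in> space (Q k). dev < \<bar>(\<Sum>l=1..n. f (x - obs_vec k x w l)) / real n
      - (\<Sum>l=1..n. g (x - \<theta> l)) / real n\<bar>} \<le> 2 * exp (1 - s ^ 4)" (is "measure _ ?A \<le> _")
proof -
  interpret Q: prob_space "Q k" by (rule prob_space_PiM_std_normal)
  \<comment> \<open>Chosen so that the Hoeffding exponent n r^2 / (4 s^4) is exactly s^4. Together
    with the bias 4 / sqrt n it stays below \<open>dev\<close> because s >= 1.\<close>
  define r where "r = 2 * s ^ 4 / sqrt (real n)"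
  define m where "m = (\<Sum>l=1..n. \<integral>z. f (x - (\<theta> l + z)) \<partial>std_normal_distribution) / real n"
  let ?B = "{w \<in> space (Q k). r \<le> \<bar>(\<Sum>l=1..n. f (x - obs_vec k x w l)) / real n - m\<bar>}"
  have s4: "1 \<le> s ^ 4" using s1 by (rule one_le_power)
  have "\<bar>m - (\<Sum>l=1..n. g (x - \<theta> l)) / real n\<bar>
     = \<bar>\<Sum>l=1..n. (\<integral>z. f ((x - \<theta> l) - z) \<partial>std_normal_distribution) - g (x - \<theta> l)\<bar> / real n"
    unfolding m_def by (simp add: diff_divide_distrib[symmetric] abs_divide sum_subtractf diff_diff_eq)
  also have "\<dots> \<le> (\<Sum>l=1..n. 4 * exp (- s\<^sup>2 / 4)) / real n"
    by (intro divide_right_mono order_trans[OF sum_abs] sum_mono bias) simp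
  also have "\<dots> = 4 / sqrt (real n)"
    using n2 exp_minus_univ_thr_sq(2)[of n] by simp
  finally have b: "\<bar>m - (\<Sum>l=1..n. g (x - \<theta> l)) / real n\<bar> \<le> 4 / sqrt (real n)" .
  have dev: "r + 4 / sqrt (real n) \<le> dev"
    unfolding r_def dev_def add_divide_distrib[symmetric] using s4 by (intro divide_right_mono) auto
  have "?A \<subseteq> ?B"
    using b dev by (auto simp: abs_diff_less_iff) 
  moreover have "?B \<in> sets (Q k)"
  proof -
    have [measurable]: "(\<lambda>w. \<Sum>l=1..n. f (x - obs_vec k x w l)) \<in> borel_measurable (Q k)"
      by (rule measurable_sum_vec[OF k, of "\<lambda>y. f (x - y)"]) simp
    show ?thesis by measurable
  qed
  ultimately have "measure (Q k) ?A \<le> measure (Q k) ?B"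
    by (intro Q.finite_measure_mono)
  also have "\<dots> \<le> 2 * exp (1 - real n * r\<^sup>2 / (4 * (s\<^sup>2)\<^sup>2))"
    unfolding m_def
    by (rule vec_concentration[OF k, of "\<lambda>y. f (x - y)"]) (use s1 s4 bound n2 in \<open>auto simp: r_def\<close>)
  also have "real n * r\<^sup>2 / (4 * (s\<^sup>2)\<^sup>2) = s ^ 4"
    using n2 s1 unfolding r_def by (simp add: power_divide power_mult_distrib field_simps flip: power_mult power_add)
  finally show ?thesis .
qed

lemma emp_mixture_deviation:
  assumes k: "k \<in> {1..n}"
  shows "measure (Q k) {w \<in> space (Q k). dev < \<bar>emp n (obs_vec k x w) x - mixture n \<theta> x\<bar>} \<le> 2 * exp (1 - s ^ 4)"
    and "measure (Q k) {w \<in> space (Q k). dev < \<bar>emp' n (obs_vec k x w) x - mixture' n \<theta> x\<bar>} \<le> 2 * exp (1 - s ^ 4)"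
proof -
  have "s * 1 \<le> s * s" using s1 by (intro mult_left_mono) auto
  then have "\<bar>band_kernel s y\<bar> \<le> s\<^sup>2" for y
    using abs_band_kernel_le[of s y] s1 unfolding power2_eq_square by linarith
  then show "measure (Q k) {w \<in> space (Q k). dev < \<bar>emp n (obs_vec k x w) x - mixture n \<theta> x\<bar>} \<le> 2 * exp (1 - s ^ 4)"
    unfolding emp_def mixture_def
    using s1 by (intro emp_deviation[OF k] band_kernel_bias) auto
  show "measure (Q k) {w \<in> space (Q k). dev < \<bar>emp' n (obs_vec k x w) x - mixture' n \<theta> x\<bar>} \<le> 2 * exp (1 - s ^ 4)"
    unfolding emp'_def mixture'_def
    using s1 by (intro emp_deviation[OF k, where g="\<lambda>d. - (d * gauss d)"] band_kernel'_bias abs_band_kernel'_le) auto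
qed

text \<open>The summands are at most sqrt 2 <= 2, and the deviation b / 2 with the bound M = 2 gives
  the exponent n b^2 / 64. Half of b is what separates an index below b / 2 or above 2 b from the
  decision threshold b.\<close>

lemma kappa_deviation:
  assumes k: "k \<in> {1..n}" and b: "b > 0"
  shows "measure (Q k) {w \<in> space (Q k). b / 2 \<le> \<bar>emp_kappa n (obs_vec k x w) - pop_kappa n \<theta>\<bar>} \<le> 2 * exp (1 - real n * b\<^sup>2 / 64)"
proof -
  define f :: "real \<Rightarrow> real" where "f = (\<lambda>y. sqrt 2 * exp (- (y\<^sup>2 / 2)))"
  have f_meas: "f \<in> borel_measurable borel" unfolding f_def by measurable
  have f2: "\<bar>f y\<bar> \<le> 2" for y
  proof -
    have "sqrt 2 * exp (- (y\<^sup>2 / 2)) \<le> 2 * 1"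
      by (intro mult_mono real_le_lsqrt) auto
    then show ?thesis by (simp add: f_def)
  qed
  have m: "(\<integral>z. f (\<theta> l + z) \<partial>std_normal_distribution) = exp (- (\<theta> l)\<^sup>2 / 4)" for l
    unfolding f_def by (rule integral_exp_std_normal_shift)
  have "\<bar>emp_kappa n (obs_vec k x w) - pop_kappa n \<theta>\<bar> = \<bar>(\<Sum>l=1..n. f (obs_vec k x w l)) / real n
      - (\<Sum>l=1..n. \<integral>z. f (\<theta> l + z) \<partial>std_normal_distribution) / real n\<bar>" for w
    unfolding m unfolding emp_kappa_def pop_kappa_def f_def by linarith
  then show ?thesis
    using vec_concentration[OF k f_meas _ f2, where r="b / 2" and x=x] b by (simp add: power_divide)
qed

end

section \<open>Conditional loss at a fixed observation\<close>

lemma nn_integral_le_bad_sets: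
  assumes M: "prob_space M" and B: "B \<in> sets M" "measure M B \<le> \<pi>" and B': "B' \<in> sets M" "measure M B' \<le> \<pi>'"
    and c: "0 \<le> c" "0 \<le> d" "0 \<le> d'"
    and f: "\<And>w. w \<in> space M \<Longrightarrow> f w \<le> c + d * indicator B w + d' * indicator B' w"
  shows "(\<integral>\<^sup>+ w. ennreal (f w) \<partial>M) \<le> ennreal (c + d * \<pi> + d' * \<pi>')"
proof -
  interpret prob_space M by fact
  have "(\<integral>\<^sup>+ w. ennreal (f w) \<partial>M) \<le> (\<integral>\<^sup>+ w. ennreal c + ennreal d * indicator B w + ennreal d' * indicator B' w \<partial>M)"
  proof (rule nn_integral_mono)
    fix w assume "w \<in> space M"
    from f[OF this] have "ennreal (f w) \<le> ennreal (c + d * indicator B w + d' * indicator B' w)"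
      by (rule ennreal_leI)
    also have "\<dots> = ennreal c + ennreal d * indicator B w + ennreal d' * indicator B' w"
      using c by (simp add: ennreal_plus ennreal_mult split: split_indicator)
    finally show "ennreal (f w) \<le> ennreal c + ennreal d * indicator B w + ennreal d' * indicator B' w" .
  qed
  also have "\<dots> = ennreal c + ennreal d * emeasure M B + ennreal d' * emeasure M B'"
    using B B' by (simp add: nn_integral_add nn_integral_cmult emeasure_space_1)
  also have "\<dots> \<le> ennreal c + ennreal d * ennreal \<pi> + ennreal d' * ennreal \<pi>'"
    using B B' by (intro add_mono mult_left_mono) (auto simp: emeasure_eq_measure intro: ennreal_leI)
  also have "\<dots> = ennreal (c + d * \<pi> + d' * \<pi>')"
    using c order_trans[OF measure_nonneg B(2)] order_trans[OF measure_nonneg B'(2)]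
    by (simp add: ennreal_plus ennreal_mult)
  finally show ?thesis .
qed

lemma square_sum_le_weighted:
  fixes a b \<omega> :: real
  assumes "\<omega> > 0"
  shows "(a + b)\<^sup>2 \<le> (1 + \<omega>) * a\<^sup>2 + (1 + 1 / \<omega>) * b\<^sup>2"
proof -
  have "0 \<le> (sqrt \<omega> * a - b / sqrt \<omega>)\<^sup>2" by simp
  also have "\<dots> = \<omega> * a\<^sup>2 - 2 * a * b + b\<^sup>2 / \<omega>"
    using assms by (simp add: power2_diff power_mult_distrib power_divide)
  finally show ?thesis by (simp add: power2_sum algebra_simps)
qed

lemma geb_rule_cong:
  assumes "\<And>l. l \<in> {1..n} \<Longrightarrow> v l = v' l"
  shows "geb_rule n \<rho> b v x = geb_rule n \<rho> b v' x"
proof -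
  have "emp_kappa n v = emp_kappa n v'" "emp n v x = emp n v' x" "emp' n v x = emp' n v' x"
    unfolding emp_kappa_def emp_def emp'_def using assms by simp_all
  then show ?thesis unfolding geb_rule_def ratio_rule_def by simp
qed

lemma borel_measurable_geb_rule:
  assumes v: "\<And>l. l \<in> {1..n} \<Longrightarrow> (\<lambda>z. v z l) \<in> borel_measurable M" and [measurable]: "g \<in> borel_measurable M"
  shows "(\<lambda>z. geb_rule n \<rho> b (v z) (g z)) \<in> borel_measurable M"
proof -
  have [measurable]: "(\<lambda>z. emp_kappa n (v z)) \<in> borel_measurable M"
    unfolding emp_kappa_def
    by (intro borel_measurable_diff borel_measurable_const borel_measurable_divide borel_measurable_sum
        measurable_compose[OF v, of _ "\<lambda>y. sqrt 2 * exp (- (y\<^sup>2 / 2))"]) auto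
  have [measurable]: "(\<lambda>z. emp n (v z) (g z)) \<in> borel_measurable M"
  proof -
    have "(\<lambda>z. band_kernel (univ_thr n) (g z - v z l)) \<in> borel_measurable M" if "l \<in> {1..n}" for l
      by (rule measurable_compose[OF borel_measurable_diff[OF assms(2) v[OF that]]]) simp
    then show ?thesis unfolding emp_def by (intro borel_measurable_divide borel_measurable_sum) auto
  qed
  have [measurable]: "(\<lambda>z. emp' n (v z) (g z)) \<in> borel_measurable M"
  proof -
    have "(\<lambda>z. band_kernel' (univ_thr n) (g z - v z l)) \<in> borel_measurable M" if "l \<in> {1..n}" for l
      by (rule measurable_compose[OF borel_measurable_diff[OF assms(2) v[OF that]]]) simp
    then show ?thesis unfolding emp'_def by (intro borel_measurable_divide borel_measurable_sum) auto
  qed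
  show ?thesis unfolding geb_rule_def ratio_rule_def by measurable
qed

context level
begin

lemma borel_measurable_emp:
  assumes k: "k \<in> {1..n}"
  shows "(\<lambda>w. emp n (obs_vec k x w) x) \<in> borel_measurable (Q k)"
    and "(\<lambda>w. emp' n (obs_vec k x w) x) \<in> borel_measurable (Q k)"
    and "(\<lambda>w. emp_kappa n (obs_vec k x w)) \<in> borel_measurable (Q k)"
proof -
  have "(\<lambda>w. \<Sum>l=1..n. band_kernel s (x - obs_vec k x w l)) \<in> borel_measurable (Q k)"
    by (rule measurable_sum_vec[OF k, of "\<lambda>y. band_kernel s (x - y)"]) simp
  then show "(\<lambda>w. emp n (obs_vec k x w) x) \<in> borel_measurable (Q k)"
    unfolding emp_def by (intro borel_measurable_divide) auto
  have "(\<lambda>w. \<Sum>l=1..n. band_kernel' s (x - obs_vec k x w l)) \<in> borel_measurable (Q k)"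
    by (rule measurable_sum_vec[OF k, of "\<lambda>y. band_kernel' s (x - y)"]) simp
  then show "(\<lambda>w. emp' n (obs_vec k x w) x) \<in> borel_measurable (Q k)"
    unfolding emp'_def by (intro borel_measurable_divide) auto
  have "(\<lambda>w. \<Sum>l=1..n. sqrt 2 * exp (- ((obs_vec k x w l)\<^sup>2 / 2))) \<in> borel_measurable (Q k)"
    by (rule measurable_sum_vec[OF k, of "\<lambda>y. sqrt 2 * exp (- (y\<^sup>2 / 2))"]) simp
  then show "(\<lambda>w. emp_kappa n (obs_vec k x w)) \<in> borel_measurable (Q k)"
    unfolding emp_kappa_def by (intro borel_measurable_divide borel_measurable_diff) auto
qed

lemma abs_emp'_le: "\<bar>emp' n v x\<bar> \<le> s\<^sup>2"
proof -
  have "\<bar>emp' n v x\<bar> \<le> (\<Sum>l=1..n. s\<^sup>2) / real n"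
    unfolding emp'_def abs_divide abs_of_nat using s1
    by (intro divide_right_mono order_trans[OF sum_abs] sum_mono abs_band_kernel'_le) auto
  then show ?thesis using n2 by simp
qed

text \<open>Deterministic, hence valid on the exceptional events as well. Its square is paid for by
  their small probability.\<close>

lemma ratio_rule_diff_le: "\<bar>ratio_rule n \<rho> v x - x\<bar> \<le> s\<^sup>2 / \<rho>"
proof -
  have "\<bar>emp' n v x\<bar> / max \<rho> (emp n v x) \<le> s\<^sup>2 / \<rho>"
    using abs_emp'_le \<rho> by (intro frac_le) auto
  then show ?thesis using \<rho> by (simp add: ratio_rule_def abs_divide abs_of_pos max.strict_coboundedI1)
qed

definition bad_dens :: "nat \<Rightarrow> real \<Rightarrow> ('i \<Rightarrow> real) set" where
  "bad_dens k x = {w \<in> space (Q k). dev < \<bar>emp n (obs_vec k x w) x - mixture n \<theta> x\<bar>}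
     \<union> {w \<in> space (Q k). dev < \<bar>emp' n (obs_vec k x w) x - mixture' n \<theta> x\<bar>}"

definition bad_kappa :: "real \<Rightarrow> nat \<Rightarrow> real \<Rightarrow> ('i \<Rightarrow> real) set" where
  "bad_kappa b k x = {w \<in> space (Q k). b / 2 \<le> \<bar>emp_kappa n (obs_vec k x w) - pop_kappa n \<theta>\<bar>}"

lemma bad_dens:
  assumes k: "k \<in> {1..n}"
  shows "bad_dens k x \<in> sets (Q k)" "measure (Q k) (bad_dens k x) \<le> 4 * exp (1 - s ^ 4)"
proof -
  interpret Q: prob_space "Q k" by (rule prob_space_PiM_std_normal)
  note [measurable] = borel_measurable_emp[OF k]
  have 1: "{w \<in> space (Q k). dev < \<bar>emp n (obs_vec k x w) x - mixture n \<theta> x\<bar>} \<in> sets (Q k)"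
    "{w \<in> space (Q k). dev < \<bar>emp' n (obs_vec k x w) x - mixture' n \<theta> x\<bar>} \<in> sets (Q k)"
    by measurable
  then show "bad_dens k x \<in> sets (Q k)" unfolding bad_dens_def by (rule sets.Un)
  show "measure (Q k) (bad_dens k x) \<le> 4 * exp (1 - s ^ 4)"
    unfolding bad_dens_def
    using measure_Un_le[OF 1] emp_mixture_deviation[OF k, of x] by linarith
qed

lemma bad_kappa:
  assumes k: "k \<in> {1..n}" and b: "b > 0"
  shows "bad_kappa b k x \<in> sets (Q k)" "measure (Q k) (bad_kappa b k x) \<le> 2 * exp (1 - real n * b\<^sup>2 / 64)"
proof -
  note [measurable] = borel_measurable_emp[OF k]
  show "bad_kappa b k x \<in> sets (Q k)" unfolding bad_kappa_def by measurable
  show "measure (Q k) (bad_kappa b k x) \<le> 2 * exp (1 - real n * b\<^sup>2 / 64)"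
    unfolding bad_kappa_def by (rule kappa_deviation[OF k b])
qed

text \<open>Majorant of the squared bias caused by the lower bound \<rho> on the denominator. The
  bias occurs only where the density is below \<rho>, and there the full Bayes correction is
  charged.\<close>

definition reg :: "real \<Rightarrow> real" where
  "reg x = (if mixture n \<theta> x < \<rho> then (mixture' n \<theta> x / mixture n \<theta> x)\<^sup>2 else 0)"

lemma reg_bound:
  "(mixture' n \<theta> x / max \<rho> (mixture n \<theta> x) - mixture' n \<theta> x / mixture n \<theta> x)\<^sup>2 \<le> reg x"
proof (cases "mixture n \<theta> x < \<rho>")
  case True
  define p p' where "p = mixture n \<theta> x" and "p' = mixture' n \<theta> x"
  have p: "0 < p" "p < \<rho>" using True mixture_pos[of n] n2 by (auto simp: p_def)
  have "\<bar>p' / \<rho> - p' / p\<bar> = \<bar>p'\<bar> * (1 / p - 1 / \<rho>)"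
  proof -
    have "1 / \<rho> \<le> 1 / p" using p by (simp add: frac_le)
    moreover have "p' / \<rho> - p' / p = p' * (1 / \<rho> - 1 / p)" by (simp add: algebra_simps)
    ultimately show ?thesis by (simp add: abs_mult)
  qed
  also have "\<dots> \<le> \<bar>p'\<bar> * (1 / p)" using \<rho> by (intro mult_left_mono) auto
  also have "\<dots> = \<bar>p' / p\<bar>" using p by simp
  finally have "(p' / \<rho> - p' / p)\<^sup>2 \<le> (p' / p)\<^sup>2" by (simp only: abs_le_square_iff)
  then show ?thesis using p unfolding reg_def p_def[symmetric] p'_def[symmetric] by simp
qed (simp add: reg_def)

text \<open>The error passes through the regularized ratio of the true mixture. From the estimate to
  this point \<open>regularized_ratio_diff\<close> applies off \<open>bad_dens\<close>, and a
  deterministic bound on it; from there to the Bayes rule only the bias \<open>reg\<close> is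
  left.\<close>

lemma ratio_rule_pointwise:
  assumes L: "L \<ge> 1" "dev \<le> L * \<rho>" "\<bar>mixture' n \<theta> x\<bar> \<le> L * max \<rho> (mixture n \<theta> x)"
    and w: "w \<in> space (Q k)"
  shows "(ratio_rule n \<rho> (obs_vec k x w) x - bayes_rule n \<theta> x)\<^sup>2
    \<le> (2 * reg x + 2 * (4 * L\<^sup>2 * dev / max \<rho> (mixture n \<theta> x))\<^sup>2) + 2 * (s\<^sup>2 / \<rho> + L)\<^sup>2 * indicator (bad_dens k x) w"
proof -
  define p p' where "p = mixture n \<theta> x" and "p' = mixture' n \<theta> x"
  define q q' where "q = emp n (obs_vec k x w) x" and "q' = emp' n (obs_vec k x w) x"
  have D: "0 < max \<rho> p" "0 < max \<rho> q" using \<rho> by auto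
  have "(q' / max \<rho> q - p' / max \<rho> p)\<^sup>2 \<le> (4 * L\<^sup>2 * dev / max \<rho> p)\<^sup>2 + (s\<^sup>2 / \<rho> + L)\<^sup>2 * indicator (bad_dens k x) w"
  proof (cases "w \<in> bad_dens k x")
    case True
    have "\<bar>q' / max \<rho> q\<bar> \<le> s\<^sup>2 / \<rho>"
      using ratio_rule_diff_le[of "obs_vec k x w" x] by (simp add: ratio_rule_def q_def q'_def)
    moreover have "\<bar>p' / max \<rho> p\<bar> \<le> L"
      using L(3) D unfolding p_def[symmetric] p'_def[symmetric] by (simp add: abs_divide pos_divide_le_eq)
    ultimately have "\<bar>q' / max \<rho> q - p' / max \<rho> p\<bar> \<le> s\<^sup>2 / \<rho> + L" by linarith
    then have "(q' / max \<rho> q - p' / max \<rho> p)\<^sup>2 \<le> (s\<^sup>2 / \<rho> + L)\<^sup>2"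
      by (metis abs_ge_zero power2_abs power_mono)
    then show ?thesis using True by (simp add: add_increasing)
  next
    case False
    then have "\<bar>q - p\<bar> \<le> dev" "\<bar>q' - p'\<bar> \<le> dev"
      using w by (auto simp: bad_dens_def q_def q'_def p_def p'_def)
    from regularized_ratio_diff[OF \<rho> L(1) less_imp_le[OF dev_pos] L(2) this] L(3)
    have "\<bar>q' / max \<rho> q - p' / max \<rho> p\<bar> \<le> 4 * L\<^sup>2 * dev / max \<rho> p"
      by (simp add: p_def p'_def)
    then have "(q' / max \<rho> q - p' / max \<rho> p)\<^sup>2 \<le> (4 * L\<^sup>2 * dev / max \<rho> p)\<^sup>2"
      by (metis abs_ge_zero power2_abs power_mono)
    then show ?thesis using False by simp
  qed
  moreover have "(p' / max \<rho> p - p' / p)\<^sup>2 \<le> reg x"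
    unfolding p_def p'_def by (rule reg_bound)
  moreover have "(ratio_rule n \<rho> (obs_vec k x w) x - bayes_rule n \<theta> x)\<^sup>2
     \<le> 2 * (q' / max \<rho> q - p' / max \<rho> p)\<^sup>2 + 2 * (p' / max \<rho> p - p' / p)\<^sup>2"
    using square_sum_le_weighted[of 1 "q' / max \<rho> q - p' / max \<rho> p" "p' / max \<rho> p - p' / p"]
    by (simp add: ratio_rule_def bayes_rule_def p_def p'_def q_def q'_def)
  ultimately show ?thesis unfolding p_def by linarith
qed

text \<open>The bound of \<open>ratio_rule_pointwise\<close> averaged over the other coordinates,
  with the indicator replaced by the probability bound 4 exp (1 - s^4). It depends neither on
  \<open>w\<close> nor on \<open>k\<close>, so that it can be integrated against the
  mixture.\<close>

definition ratio_loss :: "real \<Rightarrow> real \<Rightarrow> real" where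
  "ratio_loss L x = 2 * reg x + 2 * (4 * L\<^sup>2 * dev / max \<rho> (mixture n \<theta> x))\<^sup>2
     + 2 * (s\<^sup>2 / \<rho> + L)\<^sup>2 * (4 * exp (1 - s ^ 4))"

definition kappa_prob :: "real \<Rightarrow> real" where
  "kappa_prob b = 2 * exp (1 - real n * b\<^sup>2 / 64)"

text \<open>When the true index is at most b / 2, the ratio branch is entered only on
  \<open>bad_kappa\<close>, where the deterministic bound on the shift is charged; off this set the
  rule is soft thresholding.\<close>

lemma geb_rule_inner_small:
  assumes k: "k \<in> {1..n}" and b: "b > 0" and small: "pop_kappa n \<theta> \<le> b / 2"
  shows "(\<integral>\<^sup>+ w. ennreal ((geb_rule n \<rho> b (obs_vec k x w) x - \<theta> k)\<^sup>2) \<partial>Q k)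
    \<le> ennreal ((soft_threshold s x - \<theta> k)\<^sup>2 + (2 * (x - \<theta> k)\<^sup>2 + (2 * s ^ 4 / \<rho>\<^sup>2 + 2 * s\<^sup>2)) * kappa_prob b)"
proof -
  let ?c = "2 * (x - \<theta> k)\<^sup>2 + (2 * s ^ 4 / \<rho>\<^sup>2 + 2 * s\<^sup>2)"
  have "(\<integral>\<^sup>+ w. ennreal ((geb_rule n \<rho> b (obs_vec k x w) x - \<theta> k)\<^sup>2) \<partial>Q k)
    \<le> ennreal ((soft_threshold s x - \<theta> k)\<^sup>2 + ?c * kappa_prob b + 0 * 0)"
  proof (rule nn_integral_le_bad_sets[where B="bad_kappa b k x" and B'="{}"])
    show "prob_space (Q k)" by (rule prob_space_PiM_std_normal)
    fix w assume w: "w \<in> space (Q k)"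
    show "(geb_rule n \<rho> b (obs_vec k x w) x - \<theta> k)\<^sup>2
      \<le> (soft_threshold s x - \<theta> k)\<^sup>2 + ?c * indicator (bad_kappa b k x) w + 0 * indicator {} w"
    proof (cases "emp_kappa n (obs_vec k x w) > b")
      case True
      then have bad: "w \<in> bad_kappa b k x" using w small b by (auto simp: bad_kappa_def)
      let ?r = "ratio_rule n \<rho> (obs_vec k x w) x - x"
      have "?r\<^sup>2 \<le> (s\<^sup>2 / \<rho>)\<^sup>2"
        using ratio_rule_diff_le by (metis abs_ge_zero power2_abs power_mono)
      also have "\<dots> = s ^ 4 / \<rho>\<^sup>2" by (simp add: power_divide)
      finally have "?r\<^sup>2 \<le> s ^ 4 / \<rho>\<^sup>2" .
      moreover have "(geb_rule n \<rho> b (obs_vec k x w) x - \<theta> k)\<^sup>2 \<le> 2 * (x - \<theta> k)\<^sup>2 + 2 * ?r\<^sup>2"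
        using True square_sum_le_weighted[of 1 "x - \<theta> k" ?r] by (simp add: geb_rule_def)
      ultimately have "(geb_rule n \<rho> b (obs_vec k x w) x - \<theta> k)\<^sup>2 \<le> 2 * (x - \<theta> k)\<^sup>2 + 2 * (s ^ 4 / \<rho>\<^sup>2)"
        by linarith
      then have "(geb_rule n \<rho> b (obs_vec k x w) x - \<theta> k)\<^sup>2 \<le> (soft_threshold s x - \<theta> k)\<^sup>2 + ?c * 1"
        using zero_le_power2[of "soft_threshold s x - \<theta> k"] zero_le_power2[of s]
        unfolding times_divide_eq_right mult_1_right by linarith
      then show ?thesis using bad by simp
    qed (use \<rho> in \<open>simp add: geb_rule_def\<close>)
  qed (use bad_kappa[OF k b] \<rho> in \<open>auto simp: kappa_prob_def intro!: add_nonneg_nonneg\<close>)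
  then show ?thesis by simp
qed

text \<open>Valid for every value of the sparsity index. Above 2 b the thresholding branch is
  confined to \<open>bad_kappa\<close>; below 2 b the data may choose either branch, and the
  thresholding loss is simply added to that of the ratio rule.\<close>

lemma geb_rule_inner_large:
  assumes k: "k \<in> {1..n}" and b: "b > 0" and \<omega>: "\<omega> > 0"
    and L: "L \<ge> 1" "dev \<le> L * \<rho>" "\<bar>mixture' n \<theta> x\<bar> \<le> L * max \<rho> (mixture n \<theta> x)"
  shows "(\<integral>\<^sup>+ w. ennreal ((geb_rule n \<rho> b (obs_vec k x w) x - \<theta> k)\<^sup>2) \<partial>Q k)
    \<le> ennreal ((1 + \<omega>) * (bayes_rule n \<theta> x - \<theta> k)\<^sup>2 + (1 + 1 / \<omega>) * ratio_loss L x
      + (if pop_kappa n \<theta> \<le> 2 * b then (soft_threshold s x - \<theta> k)\<^sup>2 else 0)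
      + (2 * (x - \<theta> k)\<^sup>2 + (2 * s ^ 4 / \<rho>\<^sup>2 + 2 * s\<^sup>2)) * kappa_prob b)"
proof -
  define c where "c = 2 * (x - \<theta> k)\<^sup>2 + (2 * s ^ 4 / \<rho>\<^sup>2 + 2 * s\<^sup>2)"
  define S where "S = (if pop_kappa n \<theta> \<le> 2 * b then (soft_threshold s x - \<theta> k)\<^sup>2 else 0)"
  define R where "R = 2 * reg x + 2 * (4 * L\<^sup>2 * dev / max \<rho> (mixture n \<theta> x))\<^sup>2"
  define d where "d = 2 * (s\<^sup>2 / \<rho> + L)\<^sup>2"
  have nonneg: "0 \<le> c" "0 \<le> S" "0 \<le> R" "0 \<le> d" "0 \<le> (1 + \<omega>) * (bayes_rule n \<theta> x - \<theta> k)\<^sup>2"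
    using \<rho> \<omega> by (auto simp: reg_def c_def S_def R_def d_def)
  have "(\<integral>\<^sup>+ w. ennreal ((geb_rule n \<rho> b (obs_vec k x w) x - \<theta> k)\<^sup>2) \<partial>Q k)
    \<le> ennreal (((1 + \<omega>) * (bayes_rule n \<theta> x - \<theta> k)\<^sup>2 + (1 + 1 / \<omega>) * R + S)
         + ((1 + 1 / \<omega>) * d) * (4 * exp (1 - s ^ 4)) + c * kappa_prob b)"
  proof (rule nn_integral_le_bad_sets[where B="bad_dens k x" and B'="bad_kappa b k x"])
    show "prob_space (Q k)" by (rule prob_space_PiM_std_normal)
    fix w assume w: "w \<in> space (Q k)"
    let ?T = "geb_rule n \<rho> b (obs_vec k x w) x" and ?r = "ratio_rule n \<rho> (obs_vec k x w) x"
    have r: "(?r - \<theta> k)\<^sup>2 \<le> (1 + \<omega>) * (bayes_rule n \<theta> x - \<theta> k)\<^sup>2 + (1 + 1 / \<omega>) * R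
         + ((1 + 1 / \<omega>) * d) * indicator (bad_dens k x) w"
    proof -
      have "(?r - \<theta> k)\<^sup>2 \<le> (1 + \<omega>) * (bayes_rule n \<theta> x - \<theta> k)\<^sup>2 + (1 + 1 / \<omega>) * (?r - bayes_rule n \<theta> x)\<^sup>2"
        using square_sum_le_weighted[OF \<omega>, of "bayes_rule n \<theta> x - \<theta> k" "?r - bayes_rule n \<theta> x"] by simp
      also have "\<dots> \<le> (1 + \<omega>) * (bayes_rule n \<theta> x - \<theta> k)\<^sup>2 + (1 + 1 / \<omega>) * (R + d * indicator (bad_dens k x) w)"
        unfolding R_def d_def using \<omega> by (intro add_left_mono mult_left_mono ratio_rule_pointwise[OF L w]) auto
      finally show ?thesis by (simp only: distrib_left mult.assoc add.assoc)
    qed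
    have i: "0 \<le> indicator (bad_dens k x) w * ((1 + 1 / \<omega>) * d)" "0 \<le> (1 + 1 / \<omega>) * R" "0 \<le> c * indicator (bad_kappa b k x) w"
      using nonneg \<omega> by (auto intro!: mult_nonneg_nonneg simp del: mult_nonneg_nonneg)
    show "(?T - \<theta> k)\<^sup>2 \<le> ((1 + \<omega>) * (bayes_rule n \<theta> x - \<theta> k)\<^sup>2 + (1 + 1 / \<omega>) * R + S)
         + ((1 + 1 / \<omega>) * d) * indicator (bad_dens k x) w + c * indicator (bad_kappa b k x) w"
    proof (cases "emp_kappa n (obs_vec k x w) > b")
      case True
      then have "?T = ?r" by (simp add: geb_rule_def)
      then show ?thesis using r i nonneg(2) by (simp only:)
    next
      case False
      then have T: "?T = soft_threshold s x" by (simp add: geb_rule_def)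
      show ?thesis
      proof (cases "pop_kappa n \<theta> \<le> 2 * b")
        case True
        then have "(?T - \<theta> k)\<^sup>2 = S" using T by (simp add: S_def)
        then show ?thesis using i nonneg(5) by (simp only: mult.commute[of _ "indicator (bad_dens k x) w"])
      next
        case kap: False
        then have bad: "w \<in> bad_kappa b k x" using w False b by (auto simp: bad_kappa_def)
        have "(?T - \<theta> k)\<^sup>2 \<le> 2 * (x - \<theta> k)\<^sup>2 + 2 * s\<^sup>2"
          using soft_threshold_loss(2)[of s "\<theta> k" "x - \<theta> k"] s1 T by simp
        also have "\<dots> \<le> c * indicator (bad_kappa b k x) w" using bad \<rho> by (simp add: c_def)
        finally show ?thesis using i nonneg(2,5) by (simp only: mult.commute[of _ "indicator (bad_dens k x) w"])
      qed
    qed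
  qed (use bad_kappa[OF k b] bad_dens[OF k] nonneg \<omega> in \<open>auto simp: kappa_prob_def intro!: add_nonneg_nonneg mult_nonneg_nonneg simp del: mult_nonneg_nonneg\<close>)
  also have "((1 + \<omega>) * (bayes_rule n \<theta> x - \<theta> k)\<^sup>2 + (1 + 1 / \<omega>) * R + S)
         + ((1 + 1 / \<omega>) * d) * (4 * exp (1 - s ^ 4)) + c * kappa_prob b
      = (1 + \<omega>) * (bayes_rule n \<theta> x - \<theta> k)\<^sup>2 + (1 + 1 / \<omega>) * (R + d * (4 * exp (1 - s ^ 4))) + S + c * kappa_prob b"
    by (simp only: distrib_left mult.assoc add_ac)
  finally show ?thesis unfolding ratio_loss_def R_def d_def S_def c_def .
qed

end

section \<open>Risk of separable rules at unit noise\<close>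

definition sep_risk :: "nat \<Rightarrow> (nat \<Rightarrow> real) \<Rightarrow> (real \<Rightarrow> real) \<Rightarrow> ennreal" where
  "sep_risk n \<theta> h = (\<Sum>k=1..n. \<integral>\<^sup>+ t. ennreal ((h (\<theta> k + t) - \<theta> k)\<^sup>2) \<partial>std_normal_distribution)"

lemma nn_integral_std_normal_shift:
  assumes [measurable]: "f \<in> borel_measurable borel"
  shows "(\<integral>\<^sup>+ t. f (c + t) \<partial>std_normal_distribution) = (\<integral>\<^sup>+ x. ennreal (gauss (x - c)) * f x \<partial>lborel)"
proof -
  have "(\<integral>\<^sup>+ t. f (c + t) \<partial>std_normal_distribution) = (\<integral>\<^sup>+ t. ennreal (gauss t) * f (c + t) \<partial>lborel)"
    by (subst nn_integral_density) auto
  also have "\<dots> = (\<integral>\<^sup>+ x. ennreal (gauss (x - c)) * f x \<partial>lborel)"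
    by (subst nn_integral_real_affine[where c=1 and t=c and f="\<lambda>x. ennreal (gauss (x - c)) * f x"]) auto
  finally show ?thesis .
qed

text \<open>Collects the noise integrals of all coordinates into one Lebesgue integral over the
  observation, where the Gaussian weights add up to n times the mixture density.\<close>

lemma sum_nn_integral_std_normal_shift:
  assumes [measurable]: "\<And>k. f k \<in> borel_measurable borel"
  shows "(\<Sum>k=1..n. \<integral>\<^sup>+ t. f k (\<theta> k + t) \<partial>std_normal_distribution)
    = (\<integral>\<^sup>+ x. (\<Sum>k=1..n. ennreal (gauss (x - \<theta> k)) * f k x) \<partial>lborel)"
  by (subst nn_integral_sum) (auto simp: nn_integral_std_normal_shift)

lemma sep_risk_bayes_rule_le:
  assumes n: "n > 0" and [measurable]: "h \<in> borel_measurable borel"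
  shows "sep_risk n \<theta> (bayes_rule n \<theta>) \<le> sep_risk n \<theta> h"
proof -
  have *: "sep_risk n \<theta> g = (\<integral>\<^sup>+ x. ennreal (\<Sum>k=1..n. (g x - \<theta> k)\<^sup>2 * gauss (x - \<theta> k)) \<partial>lborel)"
    if [measurable]: "g \<in> borel_measurable borel" for g
    unfolding sep_risk_def
    by (subst sum_nn_integral_std_normal_shift[where f="\<lambda>k x. ennreal ((g x - \<theta> k)\<^sup>2)"])
       (auto simp: ennreal_mult[symmetric] sum_ennreal mult.commute)
  show ?thesis
    unfolding *[OF borel_measurable_mixture(4)] *[OF assms(2)]
    by (intro nn_integral_mono ennreal_leI bayes_rule_optimal[OF n])
qed

lemma nn_integral_std_normal_sq: "(\<integral>\<^sup>+ t. ennreal (t\<^sup>2) \<partial>std_normal_distribution) = 1"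
proof -
  have "(\<integral>\<^sup>+ t. ennreal (t\<^sup>2) \<partial>std_normal_distribution) = (\<integral>\<^sup>+ t. ennreal (gauss t * t ^ (2 * 1)) \<partial>lborel)"
    by (subst nn_integral_density) (auto simp: ennreal_mult)
  also have "\<dots> = ennreal (fact (2 * 1) / (2 ^ 1 * fact 1))"
    by (subst nn_integral_eq_integral) 
       (use std_normal_moment_even[of 1] in \<open>auto simp: has_bochner_integral_iff\<close>)
  finally show ?thesis by simp
qed

lemma nn_integral_std_normal_sq_affine:
  assumes "0 \<le> c" "0 \<le> d"
  shows "(\<integral>\<^sup>+ t. ennreal (d * t\<^sup>2 + c) \<partial>std_normal_distribution) = ennreal (d + c)"
proof -
  have "(\<integral>\<^sup>+ t. ennreal (d * t\<^sup>2 + c) \<partial>std_normal_distribution)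
      = (\<integral>\<^sup>+ t. ennreal d * ennreal (t\<^sup>2) + ennreal c \<partial>std_normal_distribution)"
    using assms by (simp add: ennreal_plus ennreal_mult)
  also have "\<dots> = ennreal d + ennreal c"
    using std_normal.emeasure_space_1
    by (subst nn_integral_add) (auto simp: nn_integral_cmult nn_integral_std_normal_sq)
  finally show ?thesis using assms by simp
qed

text \<open>With y = \<bar>t\<bar> - s > 0 one has exp (- t^2 / 2) <= exp (- s y) / n, and y^2 exp
  (- s y) is 2 / s^3 times an Erlang density. Over the n coordinates of a level this adds up to 2 /
  s^3, of order m^(-3/2) for n = 2^m: the universal threshold is just large enough for summability
  over the levels.\<close>

lemma soft_threshold_risk_zero:
  assumes n: "n \<ge> 2"
  defines "s \<equiv> univ_thr n"
  shows "(\<integral>\<^sup>+ t. ennreal ((soft_threshold s t)\<^sup>2) \<partial>std_normal_distribution) \<le> ennreal (2 / (real n * s ^ 3))"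
proof -
  have s1: "s \<ge> 1" unfolding s_def by (rule univ_thr_ge_1[OF n])
  define c where "c = 1 / (real n * s ^ 3)"
  have c: "c \<ge> 0" using s1 by (simp add: c_def)
  have pw: "gauss t * (soft_threshold s t)\<^sup>2 \<le> c * erlang_density 2 s (t - s) + c * erlang_density 2 s (- t - s)" for t
  proof -
    have key: "gauss t * (\<bar>t\<bar> - s)\<^sup>2 \<le> c * erlang_density 2 s (\<bar>t\<bar> - s)" if t: "\<bar>t\<bar> > s"
    proof -
      define y where "y = \<bar>t\<bar> - s"
      have y: "y > 0" using t by (simp add: y_def)
      have "t\<^sup>2 = (s + y)\<^sup>2" by (simp add: y_def)
      then have "exp (- t\<^sup>2 / 2) \<le> exp (- s\<^sup>2 / 2) * exp (- s * y)"
        unfolding exp_add[symmetric] by (simp add: power2_sum)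
      also have "exp (- s\<^sup>2 / 2) = 1 / real n"
        unfolding s_def using n by (intro exp_minus_univ_thr_sq) simp
      finally have "exp (- t\<^sup>2 / 2) * y\<^sup>2 \<le> 1 / real n * exp (- s * y) * y\<^sup>2"
        by (intro mult_right_mono) auto
      then have le: "exp (- t\<^sup>2 / 2) * y\<^sup>2 / 2 \<le> 1 / real n * exp (- s * y) * y\<^sup>2 / 2"
        by (rule divide_right_mono) simp
      have "gauss t \<le> exp (- t\<^sup>2 / 2) / 2"
      proof -
        have "2 \<le> sqrt (2 * pi)" using pi_ge_two by (intro real_le_rsqrt) simp
        then have "exp (- t\<^sup>2 / 2) / sqrt (2 * pi) \<le> exp (- t\<^sup>2 / 2) / 2"
          by (intro divide_left_mono) auto
        then show ?thesis by (simp add: std_normal_density_def)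
      qed
      then have "gauss t * y\<^sup>2 \<le> exp (- t\<^sup>2 / 2) / 2 * y\<^sup>2" by (intro mult_right_mono) auto
      also have "exp (- t\<^sup>2 / 2) / 2 * y\<^sup>2 \<le> 1 / real n * exp (- s * y) * y\<^sup>2 / 2"
        using le by simp
      also have "\<dots> = c * erlang_density 2 s y"
        using y s1 n by (simp add: c_def erlang_density_def field_simps power3_eq_cube numeral_3_eq_3 fact_2 power2_eq_square)
      finally show ?thesis by (simp add: y_def)
    qed
    have nonneg: "0 \<le> c * erlang_density 2 s (t - s)" "0 \<le> c * erlang_density 2 s (- t - s)"
      using c s1 by auto
    show ?thesis
    proof (cases "\<bar>t\<bar> > s")
      case True
      then have "(soft_threshold s t)\<^sup>2 = (\<bar>t\<bar> - s)\<^sup>2"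
        using s1 by (auto simp: soft_threshold_def sgn_real_def power2_eq_square algebra_simps)
      then show ?thesis using key[OF True] nonneg by (cases "t \<ge> 0") auto
    next
      case False
      then have "soft_threshold s t = 0" by (simp add: soft_threshold_def)
      then show ?thesis using add_nonneg_nonneg[OF nonneg] by simp
    qed
  qed
  have erl: "(\<integral>\<^sup>+ t. ennreal (erlang_density 2 s (t - s)) \<partial>lborel) = 1"
    "(\<integral>\<^sup>+ t. ennreal (erlang_density 2 s (- t - s)) \<partial>lborel) = 1"
  proof -
    have "(\<integral>\<^sup>+ x. ennreal (erlang_density 2 s x) \<partial>lborel) = 1"
      using nn_integral_erlang_ith_moment[of s 2 0] s1 by simp
    then show "(\<integral>\<^sup>+ t. ennreal (erlang_density 2 s (t - s)) \<partial>lborel) = 1"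
      "(\<integral>\<^sup>+ t. ennreal (erlang_density 2 s (- t - s)) \<partial>lborel) = 1"
      using nn_integral_real_affine[of "\<lambda>x. ennreal (erlang_density 2 s x)" 1 "- s"]
        nn_integral_real_affine[of "\<lambda>x. ennreal (erlang_density 2 s x)" "- 1" "- s"]
      by (simp_all add: algebra_simps)
  qed
  have "(\<integral>\<^sup>+ t. ennreal ((soft_threshold s t)\<^sup>2) \<partial>std_normal_distribution)
    = (\<integral>\<^sup>+ t. ennreal (gauss t * (soft_threshold s t)\<^sup>2) \<partial>lborel)"
    by (subst nn_integral_density) (auto simp: ennreal_mult)
  also have "\<dots> \<le> (\<integral>\<^sup>+ t. ennreal c * ennreal (erlang_density 2 s (t - s)) + ennreal c * ennreal (erlang_density 2 s (- t - s)) \<partial>lborel)"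
  proof (rule nn_integral_mono)
    fix t
    have "ennreal (gauss t * (soft_threshold s t)\<^sup>2) \<le> ennreal (c * erlang_density 2 s (t - s) + c * erlang_density 2 s (- t - s))"
      by (rule ennreal_leI[OF pw])
    also have "\<dots> = ennreal c * ennreal (erlang_density 2 s (t - s)) + ennreal c * ennreal (erlang_density 2 s (- t - s))"
      using c s1 by (simp add: ennreal_plus ennreal_mult)
    finally show "ennreal (gauss t * (soft_threshold s t)\<^sup>2) \<le> \<dots>" .
  qed
  also have "\<dots> = ennreal c + ennreal c"
    using erl by (subst nn_integral_add) (auto simp: nn_integral_cmult)
  also have "\<dots> = ennreal (2 / (real n * s ^ 3))"
    using c by (simp add: c_def flip: ennreal_plus)
  finally show ?thesis .
qed

text \<open>Means of modulus at most 1 use the first bound of \<open>soft_threshold_loss\<close>,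
  the others the second; a large mean thus costs a bounded multiple of 1 + s^2 whatever its
  size.\<close>

lemma sep_risk_soft_threshold_le:
  assumes n: "n \<ge> 2"
  defines "s \<equiv> univ_thr n"
  shows "sep_risk n \<theta> (soft_threshold s) \<le> ennreal (4 / s ^ 3 + 8 * (1 + s\<^sup>2) * (\<Sum>k=1..n. min 1 ((\<theta> k)\<^sup>2)))"
proof -
  let ?N = "std_normal_distribution"
  have s1: "s \<ge> 1" unfolding s_def by (rule univ_thr_ge_1[OF n])
  have each: "(\<integral>\<^sup>+ t. ennreal ((soft_threshold s (\<theta> k + t) - \<theta> k)\<^sup>2) \<partial>?N)
    \<le> ennreal (4 / (real n * s ^ 3) + 8 * (1 + s\<^sup>2) * min 1 ((\<theta> k)\<^sup>2))" for k
  proof (cases "(\<theta> k)\<^sup>2 \<le> 1")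
    case True
    have "(\<integral>\<^sup>+ t. ennreal ((soft_threshold s (\<theta> k + t) - \<theta> k)\<^sup>2) \<partial>?N)
       \<le> (\<integral>\<^sup>+ t. 2 * ennreal ((soft_threshold s t)\<^sup>2) + ennreal (8 * (\<theta> k)\<^sup>2) \<partial>?N)"
    proof (rule nn_integral_mono)
      fix t
      have "ennreal ((soft_threshold s (\<theta> k + t) - \<theta> k)\<^sup>2) \<le> ennreal (2 * (soft_threshold s t)\<^sup>2 + 8 * (\<theta> k)\<^sup>2)"
        using s1 by (intro ennreal_leI soft_threshold_loss(1)) simp
      also have "\<dots> = 2 * ennreal ((soft_threshold s t)\<^sup>2) + ennreal (8 * (\<theta> k)\<^sup>2)"
        by (simp add: ennreal_plus ennreal_mult)
      finally show "ennreal ((soft_threshold s (\<theta> k + t) - \<theta> k)\<^sup>2) \<le> \<dots>" .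
    qed
    also have "\<dots> = 2 * (\<integral>\<^sup>+ t. ennreal ((soft_threshold s t)\<^sup>2) \<partial>?N) + ennreal (8 * (\<theta> k)\<^sup>2)"
      using std_normal.emeasure_space_1 by (subst nn_integral_add) (auto simp: nn_integral_cmult)
    also have "\<dots> \<le> 2 * ennreal (2 / (real n * s ^ 3)) + ennreal (8 * (\<theta> k)\<^sup>2)"
      using soft_threshold_risk_zero[OF n] unfolding s_def by (intro add_mono mult_left_mono) auto
    also have "\<dots> = ennreal (4 / (real n * s ^ 3) + 8 * (\<theta> k)\<^sup>2)"
    proof -
      have "0 \<le> 2 / (real n * s ^ 3)" using s1 by simp
      from ennreal_mult[of 2, OF _ this] have "2 * ennreal (2 / (real n * s ^ 3)) = ennreal (4 / (real n * s ^ 3))"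
        by simp
      then show ?thesis using s1 by (simp only:) (subst ennreal_plus, auto)
    qed
    also have "\<dots> \<le> ennreal (4 / (real n * s ^ 3) + 8 * (1 + s\<^sup>2) * min 1 ((\<theta> k)\<^sup>2))"
      using True by (intro ennreal_leI add_left_mono) (simp add: min_def mult_right_mono)
    finally show ?thesis .
  next
    case False
    have "(\<integral>\<^sup>+ t. ennreal ((soft_threshold s (\<theta> k + t) - \<theta> k)\<^sup>2) \<partial>?N) \<le> (\<integral>\<^sup>+ t. ennreal (2 * t\<^sup>2 + 2 * s\<^sup>2) \<partial>?N)"
      using s1 by (intro nn_integral_mono ennreal_leI soft_threshold_loss(2)) simp
    also have "\<dots> = ennreal (2 + 2 * s\<^sup>2)" by (rule nn_integral_std_normal_sq_affine) simp_all
    also have "\<dots> \<le> ennreal (4 / (real n * s ^ 3) + 8 * (1 + s\<^sup>2) * min 1 ((\<theta> k)\<^sup>2))"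
      using False s1 by (intro ennreal_leI) (simp add: min_def add_increasing)
    finally show ?thesis .
  qed
  have "sep_risk n \<theta> (soft_threshold s) \<le> (\<Sum>k=1..n. ennreal (4 / (real n * s ^ 3) + 8 * (1 + s\<^sup>2) * min 1 ((\<theta> k)\<^sup>2)))"
    unfolding sep_risk_def by (intro sum_mono each)
  also have "\<dots> = ennreal (\<Sum>k=1..n. 4 / (real n * s ^ 3) + 8 * (1 + s\<^sup>2) * min 1 ((\<theta> k)\<^sup>2))"
    using s1 by (intro sum_ennreal) simp
  also have "(\<Sum>k=1..n. 4 / (real n * s ^ 3) + 8 * (1 + s\<^sup>2) * min 1 ((\<theta> k)\<^sup>2))
      = 4 / s ^ 3 + 8 * (1 + s\<^sup>2) * (\<Sum>k=1..n. min 1 ((\<theta> k)\<^sup>2))"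
    using n by (simp add: sum.distrib sum_distrib_left)
  finally show ?thesis .
qed

lemma sep_risk_id: "sep_risk n \<theta> (\<lambda>x. x) = ennreal (real n)"
  by (simp add: sep_risk_def nn_integral_std_normal_sq ennreal_of_nat_eq_real_of_nat)

section \<open>Total loss of the adaptive rule at one level\<close>

context level
begin

definition level_loss :: "real \<Rightarrow> ennreal" where
  "level_loss b = (\<Sum>k=1..n. \<integral>\<^sup>+ z. ennreal ((geb_rule n \<rho> b (\<lambda>l. \<theta> l + z (\<iota> l)) (\<theta> k + z (\<iota> k)) - \<theta> k)\<^sup>2) \<partial>P)"

lemma borel_measurable_geb_obs:
  assumes k: "k \<in> {1..n}"
  shows "(\<lambda>z. geb_rule n \<rho> b (\<lambda>l. \<theta> l + z (\<iota> l)) (\<theta> k + z (\<iota> k))) \<in> borel_measurable P"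
proof -
  have coord: "(\<lambda>z. \<theta> l + z (\<iota> l)) \<in> borel_measurable P" if "l \<in> {1..n}" for l
  proof -
    have "(\<lambda>z. z (\<iota> l)) \<in> P \<rightarrow>\<^sub>M std_normal_distribution"
      using that sub by (intro measurable_component_singleton) auto
    then have "(\<lambda>z. z (\<iota> l)) \<in> borel_measurable P" by (simp add: measurable_def)
    then show ?thesis by simp
  qed
  show ?thesis by (rule borel_measurable_geb_rule[OF coord coord[OF k]])
qed

text \<open>Injectivity of \<iota> guarantees that overwriting coordinate \<open>\<iota> k\<close>
  touches no other observation of the level, so that \<open>obs_vec\<close> agrees with the data on
  the indices 1 to n.\<close>

lemma level_loss_eq:
  "level_loss b = (\<Sum>k=1..n. \<integral>\<^sup>+ t. \<integral>\<^sup>+ w. ennreal ((geb_rule n \<rho> b (obs_vec k (\<theta> k + t) w) (\<theta> k + t) - \<theta> k)\<^sup>2) \<partial>Q k \<partial>std_normal_distribution)"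
  unfolding level_loss_def
proof (rule sum.cong[OF refl])
  fix k assume k: "k \<in> {1..n}"
  let ?F = "\<lambda>z. ennreal ((geb_rule n \<rho> b (\<lambda>l. \<theta> l + z (\<iota> l)) (\<theta> k + z (\<iota> k)) - \<theta> k)\<^sup>2)"
  note [measurable] = borel_measurable_geb_obs[OF k]
  have F: "?F \<in> borel_measurable P" by measurable
  have upd: "?F (w(\<iota> k := t)) = ennreal ((geb_rule n \<rho> b (obs_vec k (\<theta> k + t) w) (\<theta> k + t) - \<theta> k)\<^sup>2)" for w t
  proof -
    have "geb_rule n \<rho> b (\<lambda>l. \<theta> l + (w(\<iota> k := t)) (\<iota> l)) (\<theta> k + t) = geb_rule n \<rho> b (obs_vec k (\<theta> k + t) w) (\<theta> k + t)"
      using inj k by (intro geb_rule_cong) (auto simp: obs_vec_def dest: inj_onD)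
    then show ?thesis by simp
  qed
  have "\<iota> k \<in> I" using k sub by auto
  from nn_integral_PiM_split[OF this F]
  show "(\<integral>\<^sup>+ z. ?F z \<partial>P) = (\<integral>\<^sup>+ t. \<integral>\<^sup>+ w. ennreal ((geb_rule n \<rho> b (obs_vec k (\<theta> k + t) w) (\<theta> k + t) - \<theta> k)\<^sup>2) \<partial>Q k \<partial>std_normal_distribution)"
    unfolding upd .
qed

text \<open>Expected cost, per coordinate, of choosing the wrong branch: \<open>kappa_prob b\<close>
  times the crude loss, in which the squared noise is replaced by its mean 1.\<close>

definition tail_const :: "real \<Rightarrow> real" where
  "tail_const b = (2 + (2 * s ^ 4 / \<rho>\<^sup>2 + 2 * s\<^sup>2)) * kappa_prob b"

lemma nn_integral_tail_const:
  "(\<integral>\<^sup>+ t. ennreal ((2 * t\<^sup>2 + (2 * s ^ 4 / \<rho>\<^sup>2 + 2 * s\<^sup>2)) * kappa_prob b) \<partial>std_normal_distribution) = ennreal (tail_const b)"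
proof -
  have "(\<integral>\<^sup>+ t. ennreal ((2 * t\<^sup>2 + (2 * s ^ 4 / \<rho>\<^sup>2 + 2 * s\<^sup>2)) * kappa_prob b) \<partial>std_normal_distribution)
     = (\<integral>\<^sup>+ t. ennreal ((2 * kappa_prob b) * t\<^sup>2 + (2 * s ^ 4 / \<rho>\<^sup>2 + 2 * s\<^sup>2) * kappa_prob b) \<partial>std_normal_distribution)"
    by (intro nn_integral_cong arg_cong[where f=ennreal]) (simp add: algebra_simps)
  also have "\<dots> = ennreal (2 * kappa_prob b + (2 * s ^ 4 / \<rho>\<^sup>2 + 2 * s\<^sup>2) * kappa_prob b)"
    by (rule nn_integral_std_normal_sq_affine) (auto simp: kappa_prob_def)
  finally show ?thesis by (simp add: tail_const_def algebra_simps)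
qed

lemma kappa_prob_nonneg: "kappa_prob b \<ge> 0" by (simp add: kappa_prob_def)

lemma level_loss_small:
  assumes b: "b > 0" and small: "pop_kappa n \<theta> \<le> b / 2"
  shows "level_loss b \<le> sep_risk n \<theta> (soft_threshold s) + ennreal (real n * tail_const b)"
proof -
  let ?N = "std_normal_distribution"
  have "level_loss b \<le> (\<Sum>k=1..n. \<integral>\<^sup>+ t. ennreal ((soft_threshold s (\<theta> k + t) - \<theta> k)\<^sup>2)
      + ennreal ((2 * t\<^sup>2 + (2 * s ^ 4 / \<rho>\<^sup>2 + 2 * s\<^sup>2)) * kappa_prob b) \<partial>?N)"
    unfolding level_loss_eq
  proof (intro sum_mono nn_integral_mono)
    fix k t assume "k \<in> {1..n}"
    from geb_rule_inner_small[OF this b small, of "\<theta> k + t"]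
    show "(\<integral>\<^sup>+ w. ennreal ((geb_rule n \<rho> b (obs_vec k (\<theta> k + t) w) (\<theta> k + t) - \<theta> k)\<^sup>2) \<partial>Q k)
      \<le> ennreal ((soft_threshold s (\<theta> k + t) - \<theta> k)\<^sup>2) + ennreal ((2 * t\<^sup>2 + (2 * s ^ 4 / \<rho>\<^sup>2 + 2 * s\<^sup>2)) * kappa_prob b)"
      using kappa_prob_nonneg by (subst ennreal_plus[symmetric]) auto
  qed
  also have "\<dots> = (\<Sum>k=1..n. (\<integral>\<^sup>+ t. ennreal ((soft_threshold s (\<theta> k + t) - \<theta> k)\<^sup>2) \<partial>?N) + ennreal (tail_const b))"
    by (subst nn_integral_add) (auto simp: nn_integral_tail_const)
  also have "\<dots> = sep_risk n \<theta> (soft_threshold s) + ennreal (real n * tail_const b)"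
    using kappa_prob_nonneg
    by (simp add: sum.distrib sep_risk_def ennreal_mult'' ennreal_of_nat_eq_real_of_nat tail_const_def)
  finally show ?thesis .
qed

lemma level_loss_large:
  assumes b: "b > 0" and \<omega>: "\<omega> > 0"
    and L: "L \<ge> 1" "dev \<le> L * \<rho>" "\<And>x. \<bar>mixture' n \<theta> x\<bar> \<le> L * max \<rho> (mixture n \<theta> x)"
  shows "level_loss b \<le> ennreal (1 + \<omega>) * sep_risk n \<theta> (bayes_rule n \<theta>)
    + ennreal (1 + 1 / \<omega>) * (\<Sum>k=1..n. \<integral>\<^sup>+ t. ennreal (ratio_loss L (\<theta> k + t)) \<partial>std_normal_distribution)
    + (if pop_kappa n \<theta> \<le> 2 * b then sep_risk n \<theta> (soft_threshold s) else 0) + ennreal (real n * tail_const b)"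
proof -
  let ?N = "std_normal_distribution"
  let ?S = "\<lambda>k t. if pop_kappa n \<theta> \<le> 2 * b then ennreal ((soft_threshold s (\<theta> k + t) - \<theta> k)\<^sup>2) else 0"
  have rl: "0 \<le> ratio_loss L x" for x by (simp add: ratio_loss_def reg_def)
  have [measurable]: "ratio_loss L \<in> borel_measurable borel"
    unfolding ratio_loss_def[abs_def] reg_def[abs_def] by measurable
  have "level_loss b \<le> (\<Sum>k=1..n. \<integral>\<^sup>+ t. ennreal (1 + \<omega>) * ennreal ((bayes_rule n \<theta> (\<theta> k + t) - \<theta> k)\<^sup>2)
      + ennreal (1 + 1 / \<omega>) * ennreal (ratio_loss L (\<theta> k + t)) + ?S k t
      + ennreal ((2 * t\<^sup>2 + (2 * s ^ 4 / \<rho>\<^sup>2 + 2 * s\<^sup>2)) * kappa_prob b) \<partial>?N)"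
    unfolding level_loss_eq
  proof (intro sum_mono nn_integral_mono)
    fix k t assume "k \<in> {1..n}"
    have "(\<integral>\<^sup>+ w. ennreal ((geb_rule n \<rho> b (obs_vec k (\<theta> k + t) w) (\<theta> k + t) - \<theta> k)\<^sup>2) \<partial>Q k)
      \<le> ennreal ((1 + \<omega>) * (bayes_rule n \<theta> (\<theta> k + t) - \<theta> k)\<^sup>2 + (1 + 1 / \<omega>) * ratio_loss L (\<theta> k + t)
      + (if pop_kappa n \<theta> \<le> 2 * b then (soft_threshold s (\<theta> k + t) - \<theta> k)\<^sup>2 else 0)
      + (2 * (\<theta> k + t - \<theta> k)\<^sup>2 + (2 * s ^ 4 / \<rho>\<^sup>2 + 2 * s\<^sup>2)) * kappa_prob b)"
      by (rule geb_rule_inner_large[OF \<open>k \<in> {1..n}\<close> b \<omega> L])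
    also have "\<dots> = ennreal (1 + \<omega>) * ennreal ((bayes_rule n \<theta> (\<theta> k + t) - \<theta> k)\<^sup>2)
      + ennreal (1 + 1 / \<omega>) * ennreal (ratio_loss L (\<theta> k + t)) + ?S k t
      + ennreal ((2 * t\<^sup>2 + (2 * s ^ 4 / \<rho>\<^sup>2 + 2 * s\<^sup>2)) * kappa_prob b)"
    proof -
      have pos: "0 \<le> 1 + \<omega>" "0 \<le> 1 + 1 / \<omega>" using \<omega> by auto
      have n1: "0 \<le> (1 + \<omega>) * (bayes_rule n \<theta> (\<theta> k + t) - \<theta> k)\<^sup>2" "0 \<le> (1 + 1 / \<omega>) * ratio_loss L (\<theta> k + t)"
        "0 \<le> (if pop_kappa n \<theta> \<le> 2 * b then (soft_threshold s (\<theta> k + t) - \<theta> k)\<^sup>2 else 0)"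
        "0 \<le> (2 * t\<^sup>2 + (2 * s ^ 4 / \<rho>\<^sup>2 + 2 * s\<^sup>2)) * kappa_prob b"
        using pos rl kappa_prob_nonneg by (intro mult_nonneg_nonneg, auto)
      have plus: "ennreal (a + b + c + d) = ennreal a + ennreal b + ennreal c + ennreal d"
        if "0 \<le> a" "0 \<le> b" "0 \<le> c" "0 \<le> d" for a b c d :: real
        using that by simp
      have if_ennreal: "ennreal (if c then x else 0) = (if c then ennreal x else 0)" for c x
        by simp
      show ?thesis
        unfolding add_diff_cancel_left' plus[OF n1] ennreal_mult[OF pos(1) zero_le_power2]
          ennreal_mult[OF pos(2) rl] if_ennreal ..
    qed
    finally show "(\<integral>\<^sup>+ w. ennreal ((geb_rule n \<rho> b (obs_vec k (\<theta> k + t) w) (\<theta> k + t) - \<theta> k)\<^sup>2) \<partial>Q k) \<le> \<dots>" .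
  qed
  also have "\<dots> = (\<Sum>k=1..n. ennreal (1 + \<omega>) * (\<integral>\<^sup>+ t. ennreal ((bayes_rule n \<theta> (\<theta> k + t) - \<theta> k)\<^sup>2) \<partial>?N)
      + ennreal (1 + 1 / \<omega>) * (\<integral>\<^sup>+ t. ennreal (ratio_loss L (\<theta> k + t)) \<partial>?N) + (\<integral>\<^sup>+ t. ?S k t \<partial>?N) + ennreal (tail_const b))"
  proof (rule sum.cong[OF refl])
    fix k
    have [measurable]: "?S k \<in> borel_measurable std_normal_distribution" by measurable
    have plus: "(\<integral>\<^sup>+ t. f1 t + f2 t + f3 t + f4 t \<partial>?N)
        = (\<integral>\<^sup>+ t. f1 t \<partial>?N) + (\<integral>\<^sup>+ t. f2 t \<partial>?N) + (\<integral>\<^sup>+ t. f3 t \<partial>?N) + (\<integral>\<^sup>+ t. f4 t \<partial>?N)"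
      if [measurable]: "f1 \<in> borel_measurable ?N" "f2 \<in> borel_measurable ?N" "f3 \<in> borel_measurable ?N" "f4 \<in> borel_measurable ?N"
      for f1 f2 f3 f4
      by ((subst nn_integral_add, measurable)+)
    show "(\<integral>\<^sup>+ t. ennreal (1 + \<omega>) * ennreal ((bayes_rule n \<theta> (\<theta> k + t) - \<theta> k)\<^sup>2)
      + ennreal (1 + 1 / \<omega>) * ennreal (ratio_loss L (\<theta> k + t)) + ?S k t
      + ennreal ((2 * t\<^sup>2 + (2 * s ^ 4 / \<rho>\<^sup>2 + 2 * s\<^sup>2)) * kappa_prob b) \<partial>?N)
      = ennreal (1 + \<omega>) * (\<integral>\<^sup>+ t. ennreal ((bayes_rule n \<theta> (\<theta> k + t) - \<theta> k)\<^sup>2) \<partial>?N)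
      + ennreal (1 + 1 / \<omega>) * (\<integral>\<^sup>+ t. ennreal (ratio_loss L (\<theta> k + t)) \<partial>?N) + (\<integral>\<^sup>+ t. ?S k t \<partial>?N) + ennreal (tail_const b)"
      unfolding nn_integral_tail_const[symmetric]
      by (subst plus) (measurable, simp add: nn_integral_cmult)
  qed
  also have "\<dots> = ennreal (1 + \<omega>) * sep_risk n \<theta> (bayes_rule n \<theta>)
    + ennreal (1 + 1 / \<omega>) * (\<Sum>k=1..n. \<integral>\<^sup>+ t. ennreal (ratio_loss L (\<theta> k + t)) \<partial>?N)
    + (\<Sum>k=1..n. \<integral>\<^sup>+ t. ?S k t \<partial>?N) + ennreal (real n * tail_const b)"
  proof -
    have "(\<Sum>k=1..n. ennreal (tail_const b)) = ennreal (real n * tail_const b)"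
      using kappa_prob_nonneg[of b] by (simp add: ennreal_mult'' ennreal_of_nat_eq_real_of_nat tail_const_def)
    then show ?thesis
      unfolding sum.distrib sep_risk_def sum_distrib_left by (simp only:)
  qed
  also have "(\<Sum>k=1..n. \<integral>\<^sup>+ t. ?S k t \<partial>?N) = (if pop_kappa n \<theta> \<le> 2 * b then sep_risk n \<theta> (soft_threshold s) else 0)"
    by (simp add: sep_risk_def)
  finally show ?thesis .
qed


text \<open>The first bound is integrable over the line and serves far out; the second is uniform
  and small and serves on a bounded interval. The latter holds because \<open>reg\<close> vanishes
  unless the density is below \<rho>.\<close>

lemma mixture_mult_reg:
  "mixture n \<theta> x * reg x \<le> mixture_sq n \<theta> x" "mixture n \<theta> x * reg x \<le> s\<^sup>2 * \<rho> + 1 / real n"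
proof -
  define p where "p = mixture n \<theta> x"
  have p: "p > 0" unfolding p_def using n2 by (intro mixture_pos) simp
  have V: "mixture_sq n \<theta> x \<ge> 0" unfolding mixture_sq_def by (intro divide_nonneg_nonneg sum_nonneg) auto
  have eq: "p * (mixture' n \<theta> x / p)\<^sup>2 = (mixture' n \<theta> x)\<^sup>2 / p"
    using p by (simp add: power2_eq_square)
  have le: "(mixture' n \<theta> x)\<^sup>2 / p \<le> mixture_sq n \<theta> x"
    using mixture_bounds(3)[OF n2, of \<theta> x] p by (simp add: pos_divide_le_eq mult.commute p_def)
  show "mixture n \<theta> x * reg x \<le> mixture_sq n \<theta> x"
    using le V eq by (simp add: reg_def p_def)
  show "mixture n \<theta> x * reg x \<le> s\<^sup>2 * \<rho> + 1 / real n"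
  proof (cases "p < \<rho>")
    case True
    have "mixture n \<theta> x * reg x \<le> mixture_sq n \<theta> x"
      using le V eq by (simp add: reg_def p_def)
    also have "\<dots> \<le> s\<^sup>2 * p + 1 / real n" unfolding p_def by (rule mixture_bounds(1)[OF n2])
    also have "\<dots> \<le> s\<^sup>2 * \<rho> + 1 / real n" using True by (intro add_right_mono mult_left_mono) auto
    finally show ?thesis .
  next
    case False
    then show ?thesis using \<rho> by (simp add: reg_def p_def)
  qed
qed

text \<open>On the central interval density times loss is at most the small constant
  \<open>K\<close>, so integration costs only the length of the interval. Outside,
  \<open>dev \<le> L * \<rho>\<close> bounds the estimation error by 32 L^6, and the Gaussian
  weights are kept for a count of large means. The last term carries the exceptional
  probability.\<close>

lemma mixture_mult_ratio_loss:
  assumes L: "L \<ge> 1" "dev \<le> L * \<rho>"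
  defines "K \<equiv> 2 * (s\<^sup>2 * \<rho> + 1 / real n) + 32 * L ^ 4 * dev\<^sup>2 / \<rho>"
    and "R \<equiv> 2 * (s\<^sup>2 / \<rho> + L)\<^sup>2 * (4 * exp (1 - s ^ 4))"
  shows "real n * mixture n \<theta> x * ratio_loss L x
    \<le> real n * K * indicator {-c..c} x + (\<Sum>k=1..n. (2 * (x - \<theta> k)\<^sup>2 + 32 * L ^ 6) * gauss (x - \<theta> k)) * indicator (- {-c..c}) x
      + R * (real n * mixture n \<theta> x)"
proof -
  define p V D where "p = mixture n \<theta> x" and "V = mixture_sq n \<theta> x" and "D = max \<rho> (mixture n \<theta> x)"
  have p: "p > 0" unfolding p_def using n2 by (intro mixture_pos) simp
  have D: "D > 0" "\<rho> \<le> D" "p \<le> D" using \<rho> by (auto simp: D_def p_def)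
  have sq: "2 * (4 * L\<^sup>2 * dev / D)\<^sup>2 = 32 * L ^ 4 * (dev / D)\<^sup>2"
    by (simp add: power_mult_distrib power_divide)
  have sum: "(\<Sum>k=1..n. (2 * (x - \<theta> k)\<^sup>2 + 32 * L ^ 6) * gauss (x - \<theta> k)) = real n * (2 * V + 32 * L ^ 6 * p)"
  proof -
    have "real n * V = (\<Sum>k=1..n. (x - \<theta> k)\<^sup>2 * gauss (x - \<theta> k))" "real n * p = (\<Sum>k=1..n. gauss (x - \<theta> k))"
      using n2 by (simp_all add: V_def p_def mixture_sq_def mixture_def)
    then have "real n * (2 * V + 32 * L ^ 6 * p) = 2 * (\<Sum>k=1..n. (x - \<theta> k)\<^sup>2 * gauss (x - \<theta> k)) + 32 * L ^ 6 * (\<Sum>k=1..n. gauss (x - \<theta> k))"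
      by (simp only: distrib_left mult.left_commute[of "real n"])
    then show ?thesis by (simp only: distrib_right sum.distrib sum_distrib_left mult.assoc)
  qed
  have eq: "p * ratio_loss L x = 2 * (p * reg x) + 32 * L ^ 4 * (p * (dev / D)\<^sup>2) + R * p"
    unfolding ratio_loss_def R_def D_def[symmetric] sq by (simp add: algebra_simps)
  have "p * ratio_loss L x \<le> K * indicator {-c..c} x + (2 * V + 32 * L ^ 6 * p) * indicator (- {-c..c}) x + R * p"
  proof (cases "x \<in> {-c..c}")
    case True
    have "p * (dev / D)\<^sup>2 \<le> dev\<^sup>2 / \<rho>"
    proof -
      have "p * (dev / D)\<^sup>2 = dev\<^sup>2 * (p / D) / D" using D by (simp add: power2_eq_square)
      also have "\<dots> \<le> dev\<^sup>2 * 1 / D"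
        using D p by (intro divide_right_mono mult_left_mono) auto
      also have "\<dots> \<le> dev\<^sup>2 / \<rho>" using D \<rho> by (simp add: divide_left_mono)
      finally show ?thesis .
    qed
    then have "32 * L ^ 4 * (p * (dev / D)\<^sup>2) \<le> 32 * L ^ 4 * (dev\<^sup>2 / \<rho>)"
      by (intro mult_left_mono) auto
    then show ?thesis using True mixture_mult_reg(2)[of x] eq unfolding K_def p_def by simp
  next
    case False
    have "dev / D \<le> L"
    proof -
      have "L * \<rho> \<le> L * D" using D L by (intro mult_left_mono) auto
      then have "dev \<le> L * D" using L(2) by linarith
      then show ?thesis using D by (simp add: pos_divide_le_eq)
    qed
    then have "(dev / D)\<^sup>2 \<le> L\<^sup>2" using D dev_pos by (intro power_mono) auto
    then have "32 * L ^ 4 * (p * (dev / D)\<^sup>2) \<le> 32 * L ^ 4 * (p * L\<^sup>2)"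
      using p by (intro mult_left_mono) auto
    also have "\<dots> = 32 * L ^ 6 * p" by (simp add: mult_ac flip: power_add)
    finally show ?thesis using False mixture_mult_reg(1)[of x] eq unfolding V_def p_def by simp
  qed
  then have "real n * (p * ratio_loss L x) \<le> real n * (K * indicator {-c..c} x + (2 * V + 32 * L ^ 6 * p) * indicator (- {-c..c}) x + R * p)"
    by (intro mult_left_mono) auto
  then show ?thesis unfolding sum p_def[symmetric] by (simp only: distrib_left mult_ac)
qed

text \<open>An observation beyond 2 a has its mean or its noise beyond a. In the first case the
  whole second moment is paid, in the second only a Gaussian tail moment; there \<bar>t\<bar> > a >=
  1 allows d <= d t^2.\<close>

lemma nn_integral_tail_split:
  assumes a: "a \<ge> 1" and d: "d \<ge> 0" and tau: "(\<integral>\<^sup>+ t. ennreal (t\<^sup>2) * indicator {t. \<bar>t\<bar> > a} t \<partial>std_normal_distribution) \<le> ennreal \<tau>" "\<tau> \<ge> 0"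
  shows "(\<integral>\<^sup>+ t. ennreal (2 * t\<^sup>2 + d) * indicator (- {-(2 * a)..2 * a}) (c + t) \<partial>std_normal_distribution)
    \<le> ennreal ((2 + d) * (indicator {c. \<bar>c\<bar> > a} c + \<tau>))"
proof (cases "\<bar>c\<bar> > a")
  case True
  have "(\<integral>\<^sup>+ t. ennreal (2 * t\<^sup>2 + d) * indicator (- {-(2 * a)..2 * a}) (c + t) \<partial>std_normal_distribution)
     \<le> (\<integral>\<^sup>+ t. ennreal (2 * t\<^sup>2 + d) \<partial>std_normal_distribution)"
    by (intro nn_integral_mono) (auto split: split_indicator)
  also have "\<dots> = ennreal (2 + d)" using d by (rule nn_integral_std_normal_sq_affine) simp
  also have "\<dots> \<le> ennreal ((2 + d) * (indicator {c. \<bar>c\<bar> > a} c + \<tau>))"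
    using True tau d by (intro ennreal_leI) (simp add: algebra_simps)
  finally show ?thesis .
next
  case False
  have "(\<integral>\<^sup>+ t. ennreal (2 * t\<^sup>2 + d) * indicator (- {-(2 * a)..2 * a}) (c + t) \<partial>std_normal_distribution)
     \<le> (\<integral>\<^sup>+ t. ennreal (2 + d) * (ennreal (t\<^sup>2) * indicator {t. \<bar>t\<bar> > a} t) \<partial>std_normal_distribution)"
  proof (rule nn_integral_mono)
    fix t
    show "ennreal (2 * t\<^sup>2 + d) * indicator (- {-(2 * a)..2 * a}) (c + t) \<le> ennreal (2 + d) * (ennreal (t\<^sup>2) * indicator {t. \<bar>t\<bar> > a} t)"
    proof (cases "c + t \<in> {-(2 * a)..2 * a}")
      case outside: False
      then have t: "\<bar>t\<bar> > a" using False by auto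
      then have "1\<^sup>2 \<le> \<bar>t\<bar>\<^sup>2" using a by (intro power_mono) auto
      then have "d * 1 \<le> d * t\<^sup>2" using d by (intro mult_left_mono) auto
      then have "ennreal (2 * t\<^sup>2 + d) \<le> ennreal ((2 + d) * t\<^sup>2)" by (intro ennreal_leI) (simp add: algebra_simps)
      then show ?thesis using outside t d by (simp add: ennreal_mult)
    qed simp
  qed
  also have "\<dots> = ennreal (2 + d) * (\<integral>\<^sup>+ t. ennreal (t\<^sup>2) * indicator {t. \<bar>t\<bar> > a} t \<partial>std_normal_distribution)"
    by (rule nn_integral_cmult) measurable
  also have "\<dots> \<le> ennreal (2 + d) * ennreal \<tau>" by (intro mult_left_mono tau) simp
  also have "\<dots> = ennreal ((2 + d) * (indicator {c. \<bar>c\<bar> > a} c + \<tau>))"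
    using False d tau by (simp add: ennreal_mult)
  finally show ?thesis .
qed

text \<open>Integrates \<open>mixture_mult_ratio_loss\<close> with \<open>c = 2 * a\<close>: an
  interval of length 4 a, the tail split for each mean, and total mass n of the Gaussian
  weights.\<close>

lemma sum_ratio_loss_le:
  assumes L: "L \<ge> 1" "dev \<le> L * \<rho>"
    and a: "a \<ge> 1" and tau: "(\<integral>\<^sup>+ t. ennreal (t\<^sup>2) * indicator {t. \<bar>t\<bar> > a} t \<partial>std_normal_distribution) \<le> ennreal \<tau>" "\<tau> \<ge> 0"
  defines "K \<equiv> 2 * (s\<^sup>2 * \<rho> + 1 / real n) + 32 * L ^ 4 * dev\<^sup>2 / \<rho>"
    and "R \<equiv> 2 * (s\<^sup>2 / \<rho> + L)\<^sup>2 * (4 * exp (1 - s ^ 4))"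
  shows "(\<Sum>k=1..n. \<integral>\<^sup>+ t. ennreal (ratio_loss L (\<theta> k + t)) \<partial>std_normal_distribution)
    \<le> ennreal (4 * a * real n * K + (2 + 32 * L ^ 6) * (real (card {k\<in>{1..n}. \<bar>\<theta> k\<bar> > a}) + real n * \<tau>) + real n * R)"
proof -
  let ?N = "std_normal_distribution"
  define d where "d = 32 * L ^ 6"
  have d: "d \<ge> 0" using L by (simp add: d_def)
  have K: "K \<ge> 0" using \<rho> unfolding K_def by simp
  have R: "R \<ge> 0" unfolding R_def by simp
  have rl: "0 \<le> ratio_loss L x" for x by (simp add: ratio_loss_def reg_def)
  have [measurable]: "ratio_loss L \<in> borel_measurable borel"
    unfolding ratio_loss_def[abs_def] reg_def[abs_def] by measurable
  let ?I = "{-(2 * a)..2 * a}"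
  let ?G = "\<lambda>x. \<Sum>k=1..n. ennreal (gauss (x - \<theta> k)) * (ennreal (2 * (x - \<theta> k)\<^sup>2 + d) * indicator (- ?I) x)"
  let ?H = "\<lambda>x. \<Sum>k=1..n. ennreal (gauss (x - \<theta> k)) * 1"
  have "(\<integral>\<^sup>+ x. ?G x \<partial>lborel) = (\<Sum>k=1..n. \<integral>\<^sup>+ t. ennreal (2 * (\<theta> k + t - \<theta> k)\<^sup>2 + d) * indicator (- ?I) (\<theta> k + t) \<partial>?N)"
    by (rule sum_nn_integral_std_normal_shift[where f="\<lambda>k x. ennreal (2 * (x - \<theta> k)\<^sup>2 + d) * indicator (- ?I) x", symmetric]) simp
  also have "\<dots> \<le> (\<Sum>k=1..n. ennreal ((2 + d) * (indicator {c. \<bar>c\<bar> > a} (\<theta> k) + \<tau>)))"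
    unfolding add_diff_cancel_left' by (intro sum_mono nn_integral_tail_split a d tau)
  also have "\<dots> = ennreal (\<Sum>k=1..n. (2 + d) * (indicator {c. \<bar>c\<bar> > a} (\<theta> k) + \<tau>))"
    using d tau by (intro sum_ennreal) auto
  also have "(\<Sum>k=1..n. (2 + d) * (indicator {c. \<bar>c\<bar> > a} (\<theta> k) + \<tau>)) = (2 + d) * (real (card {k\<in>{1..n}. \<bar>\<theta> k\<bar> > a}) + real n * \<tau>)"
  proof -
    have "(\<Sum>k=1..n. indicator {c. \<bar>c\<bar> > a} (\<theta> k) :: real) = real (card {k\<in>{1..n}. \<bar>\<theta> k\<bar> > a})"
      by (auto simp: indicator_def Int_def intro!: arg_cong[where f=card])
    then show ?thesis by (simp add: sum_distrib_left[symmetric] sum.distrib)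
  qed
  finally have G_le: "(\<integral>\<^sup>+ x. ?G x \<partial>lborel) \<le> ennreal ((2 + d) * (real (card {k\<in>{1..n}. \<bar>\<theta> k\<bar> > a}) + real n * \<tau>))" .
  have "(\<Sum>k=1..n. \<integral>\<^sup>+ t. ennreal (ratio_loss L (\<theta> k + t)) \<partial>?N)
    = (\<integral>\<^sup>+ x. (\<Sum>k=1..n. ennreal (gauss (x - \<theta> k)) * ennreal (ratio_loss L x)) \<partial>lborel)"
    by (rule sum_nn_integral_std_normal_shift[where f="\<lambda>k x. ennreal (ratio_loss L x)"]) simp
  also have "\<dots> \<le> (\<integral>\<^sup>+ x. ennreal (real n * K) * indicator ?I x + ?G x + ennreal R * ?H x \<partial>lborel)"
  proof (rule nn_integral_mono)
    fix x
    have nm: "real n * mixture n \<theta> x = (\<Sum>k=1..n. gauss (x - \<theta> k))" using n2 by (simp add: mixture_def)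
    have H: "?H x = ennreal (real n * mixture n \<theta> x)" unfolding nm by (simp add: sum_ennreal)
    have G: "?G x = ennreal ((\<Sum>k=1..n. (2 * (x - \<theta> k)\<^sup>2 + d) * gauss (x - \<theta> k)) * indicator (- ?I) x)"
    proof (cases "x \<in> ?I")
      case False
      have "?G x = (\<Sum>k=1..n. ennreal ((2 * (x - \<theta> k)\<^sup>2 + d) * gauss (x - \<theta> k)))"
        using False d by (intro sum.cong) (auto simp: ennreal_mult mult.commute)
      also have "\<dots> = ennreal (\<Sum>k=1..n. (2 * (x - \<theta> k)\<^sup>2 + d) * gauss (x - \<theta> k))"
        using d by (intro sum_ennreal) auto
      finally show ?thesis using False by simp
    qed simp
    have "(\<Sum>k=1..n. ennreal (gauss (x - \<theta> k)) * ennreal (ratio_loss L x)) = ennreal (real n * mixture n \<theta> x * ratio_loss L x)"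
      unfolding nm using rl by (simp add: sum_ennreal ennreal_mult' sum_nonneg flip: sum_distrib_right)
    also have "\<dots> \<le> ennreal (real n * K * indicator ?I x + (\<Sum>k=1..n. (2 * (x - \<theta> k)\<^sup>2 + d) * gauss (x - \<theta> k)) * indicator (- ?I) x
      + R * (real n * mixture n \<theta> x))"
      unfolding K_def R_def d_def by (intro ennreal_leI mixture_mult_ratio_loss L)
    also have "\<dots> = ennreal (real n * K * indicator ?I x) + ennreal ((\<Sum>k=1..n. (2 * (x - \<theta> k)\<^sup>2 + d) * gauss (x - \<theta> k)) * indicator (- ?I) x)
      + ennreal (R * (real n * mixture n \<theta> x))"
    proof -
      have 1: "0 \<le> real n * K * indicator ?I x" using K by simp
      have 2: "0 \<le> (\<Sum>k=1..n. (2 * (x - \<theta> k)\<^sup>2 + d) * gauss (x - \<theta> k)) * indicator (- ?I) x"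
        using d by (intro mult_nonneg_nonneg sum_nonneg) auto
      have 3: "0 \<le> R * (real n * mixture n \<theta> x)"
        using R mixture_pos[of n \<theta> x] n2 by simp
      show ?thesis using 1 2 3 by (simp only: ennreal_plus add_nonneg_nonneg)
    qed
    also have "ennreal (real n * K * indicator ?I x) = ennreal (real n * K) * indicator ?I x"
      by (simp split: split_indicator)
    also have "ennreal (R * (real n * mixture n \<theta> x)) = ennreal R * ?H x"
      unfolding H by (rule ennreal_mult') (rule R)
    finally show "(\<Sum>k=1..n. ennreal (gauss (x - \<theta> k)) * ennreal (ratio_loss L x)) \<le> ennreal (real n * K) * indicator ?I x + ?G x + ennreal R * ?H x"
      unfolding G .
  qed
  also have "\<dots> = ennreal (real n * K) * emeasure lborel ?I + (\<integral>\<^sup>+ x. ?G x \<partial>lborel) + ennreal R * (\<integral>\<^sup>+ x. ?H x \<partial>lborel)"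
    by (simp add: nn_integral_add nn_integral_cmult)
  also have "(\<integral>\<^sup>+ x. ?H x \<partial>lborel) = (\<Sum>k=1..n. \<integral>\<^sup>+ t. 1 \<partial>?N)"
    by (rule sum_nn_integral_std_normal_shift[where f="\<lambda>k x. 1", symmetric]) simp
  also have "\<dots> = ennreal (real n)"
    using std_normal.emeasure_space_1 by (simp add: ennreal_of_nat_eq_real_of_nat)
  also have "ennreal (real n * K) * emeasure lborel ?I + (\<integral>\<^sup>+ x. ?G x \<partial>lborel) + ennreal R * ennreal (real n)
    \<le> ennreal (real n * K) * emeasure lborel ?I + ennreal ((2 + d) * (real (card {k\<in>{1..n}. \<bar>\<theta> k\<bar> > a}) + real n * \<tau>)) + ennreal R * ennreal (real n)"
    by (intro add_mono order_refl G_le)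
  also have "ennreal (real n * K) * emeasure lborel ?I + ennreal ((2 + d) * (real (card {k\<in>{1..n}. \<bar>\<theta> k\<bar> > a}) + real n * \<tau>)) + ennreal R * ennreal (real n)
    = ennreal (4 * a * real n * K + (2 + d) * (real (card {k\<in>{1..n}. \<bar>\<theta> k\<bar> > a}) + real n * \<tau>) + real n * R)"
  proof -
    have I: "emeasure lborel ?I = ennreal (4 * a)" using a by (simp add: emeasure_lborel_Icc_eq)
    have 1: "0 \<le> real n * K" "0 \<le> 4 * a" using K a by auto
    have 2: "0 \<le> (2 + d) * (real (card {k\<in>{1..n}. \<bar>\<theta> k\<bar> > a}) + real n * \<tau>)" using d tau by simp
    have 3: "0 \<le> R * real n" using R by simp
    have "ennreal (real n * K) * ennreal (4 * a) = ennreal (4 * a * real n * K)"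
      unfolding ennreal_mult[OF 1, symmetric] by (simp add: mult_ac)
    moreover have "ennreal R * ennreal (real n) = ennreal (real n * R)"
      using R by (simp add: ennreal_mult mult.commute)
    ultimately show ?thesis unfolding I using 1 2 3 K a R by (simp add: ennreal_plus)
  qed
  finally show ?thesis unfolding d_def .
qed

end

section \<open>Ideal adaptivity at one level\<close>

lemma univ_thr_power_le:
  assumes "\<zeta> > 0"
  shows "\<exists>A>0. \<forall>n\<ge>2. univ_thr n ^ m \<le> A * real n powr \<zeta>"
proof -
  \<comment> \<open>Dividing by m + 1 rather than m covers m = 0 and still gives e m <=
    \<zeta>.\<close>
  define e where "e = \<zeta> / (real m + 1)"
  define A where "A = (1 + 2 / e) ^ m"
  have e: "e > 0" using assms by (simp add: e_def)
  have "univ_thr n ^ m \<le> A * real n powr \<zeta>" if n: "n \<ge> 2" for n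
  proof -
    have s1: "univ_thr n \<ge> 1" by (rule univ_thr_ge_1[OF n])
    have "univ_thr n \<le> univ_thr n ^ 2" using s1 by (simp add: power2_eq_square)
    also have "\<dots> = 2 * ln (real n)" using n by (simp add: univ_thr_sq)
    also have "\<dots> \<le> 2 * (real n powr e / e)" using ln_powr_bound[of "real n" e] n e by simp
    also have "\<dots> \<le> (1 + 2 / e) * real n powr e" using e by (simp add: algebra_simps)
    finally have "univ_thr n ^ m \<le> ((1 + 2 / e) * real n powr e) ^ m"
      using s1 by (intro power_mono) auto
    also have "\<dots> = A * real n powr (e * real m)"
      using n by (simp add: A_def power_mult_distrib powr_powr[symmetric] powr_realpow)
    also have "\<dots> \<le> A * real n powr \<zeta>"
      using n e assms by (intro mult_left_mono powr_mono) (auto simp: e_def A_def field_simps)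
    finally show ?thesis .
  qed
  moreover have "A > 0" using e by (simp add: A_def add_pos_pos)
  ultimately show ?thesis by blast
qed

text \<open>The exponent is quadratic in ln n, because \<open>univ_thr n ^ 4\<close> is 4 (ln n)^2;
  completing the square yields the constant.\<close>

lemma exp_univ_thr_le:
  assumes "c > 0"
  shows "\<exists>A>0. \<forall>n\<ge>2. exp (1 - c * univ_thr n ^ 4) \<le> A * real n powr (- k)"
proof -
  have "exp (1 - c * univ_thr n ^ 4) \<le> exp (1 + k\<^sup>2 / (16 * c)) * real n powr (- k)" if n: "n \<ge> 2" for n
  proof -
    define l where "l = ln (real n)"
    have "univ_thr n ^ 4 = ((univ_thr n)\<^sup>2)\<^sup>2" by simp
    then have s4: "univ_thr n ^ 4 = 4 * l\<^sup>2" using n by (simp add: univ_thr_sq l_def power_mult_distrib)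
    have "0 \<le> (2 * sqrt c * l - k / (4 * sqrt c))\<^sup>2" by simp
    also have "\<dots> = 4 * c * l\<^sup>2 - k * l + k\<^sup>2 / (16 * c)"
      using assms by (simp add: power2_diff power_mult_distrib power_divide)
    finally have "1 - c * univ_thr n ^ 4 \<le> (1 + k\<^sup>2 / (16 * c)) + (- k) * l" unfolding s4 by simp
    then have "exp (1 - c * univ_thr n ^ 4) \<le> exp (1 + k\<^sup>2 / (16 * c)) * exp ((- k) * l)"
      unfolding exp_add[symmetric] by simp
    then show ?thesis using n by (simp add: powr_def l_def)
  qed
  then show ?thesis by (intro exI[of _ "exp (1 + k\<^sup>2 / (16 * c))"]) auto
qed

text \<open>Markov's inequality with the moment of order 2 (m + 1): the choice m >= 1 / \<delta>
  makes n^(2 \<delta> m) at least n^2.\<close>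

lemma std_normal_tail_moment:
  assumes "\<delta> > 0"
  shows "\<exists>A\<ge>0. \<forall>n\<ge>2. (\<integral>\<^sup>+ t. ennreal (t\<^sup>2) * indicator {t. \<bar>t\<bar> > real n powr \<delta>} t \<partial>std_normal_distribution)
     \<le> ennreal (A * real n powr (- 2))"
proof -
  define m where "m = nat \<lceil>1 / \<delta>\<rceil>"
  have "1 / \<delta> \<le> real m" unfolding m_def by linarith
  then have m: "1 \<le> real m * \<delta>" using assms by (simp add: field_simps)
  define A :: real where "A = fact (2 * (m + 1)) / (2 ^ (m + 1) * fact (m + 1))"
  have A: "A \<ge> 0" by (simp add: A_def)
  have mom: "(\<integral>\<^sup>+ t. ennreal (t ^ (2 * (m + 1))) \<partial>std_normal_distribution) = ennreal A"
  proof -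
    have "(\<integral>\<^sup>+ t. ennreal (t ^ (2 * (m + 1))) \<partial>std_normal_distribution) = (\<integral>\<^sup>+ t. ennreal (gauss t * t ^ (2 * (m + 1))) \<partial>lborel)"
      by (subst nn_integral_density) (auto simp: ennreal_mult')
    also have "\<dots> = ennreal A"
    proof -
      have "0 \<le> gauss t * t ^ (2 * (m + 1))" for t
        unfolding power_mult using zero_le_power[OF zero_le_power2, of t "m + 1"]
        by (rule mult_nonneg_nonneg[OF normal_density_nonneg])
      then show ?thesis
        using std_normal_moment_even[of "m + 1"] unfolding A_def has_bochner_integral_iff
        by (subst nn_integral_eq_integral) (auto simp del: power_Suc mult_Suc_right)
    qed
    finally show ?thesis .
  qed
  have "(\<integral>\<^sup>+ t. ennreal (t\<^sup>2) * indicator {t. \<bar>t\<bar> > real n powr \<delta>} t \<partial>std_normal_distribution)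
     \<le> ennreal (A * real n powr (- 2))" if n: "n \<ge> 2" for n
  proof -
    define a where "a = real n powr \<delta>"
    have a: "a > 0" using n by (simp add: a_def)
    have a2m: "1 / a ^ (2 * m) \<le> real n powr (- 2)"
    proof -
      have "a ^ (2 * m) = real n powr (\<delta> * real (2 * m))"
        unfolding powr_powr[symmetric] a_def using n by (intro powr_realpow[symmetric]) simp
      also have "\<dots> \<ge> real n powr 2" using m n by (intro powr_mono) (auto simp: mult_ac)
      finally have "real n powr 2 \<le> a ^ (2 * m)" .
      then show ?thesis using n a by (simp only: powr_minus inverse_eq_divide) (intro divide_left_mono, auto)
    qed
    have "(\<integral>\<^sup>+ t. ennreal (t\<^sup>2) * indicator {t. \<bar>t\<bar> > a} t \<partial>std_normal_distribution)
       \<le> (\<integral>\<^sup>+ t. ennreal (real n powr (- 2)) * ennreal (t ^ (2 * (m + 1))) \<partial>std_normal_distribution)"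
    proof (rule nn_integral_mono)
      fix t :: real
      have "t\<^sup>2 \<le> real n powr (- 2) * t ^ (2 * (m + 1))" if t: "\<bar>t\<bar> > a"
      proof -
        have "a ^ (2 * m) \<le> \<bar>t\<bar> ^ (2 * m)" using t a by (intro power_mono) auto
        also have "\<bar>t\<bar> ^ (2 * m) = t ^ (2 * m)" by (simp add: power_mult)
        finally have "t\<^sup>2 * (1 / a ^ (2 * m)) * a ^ (2 * m) \<le> t\<^sup>2 * (1 / a ^ (2 * m)) * t ^ (2 * m)"
          using a by (intro mult_left_mono) auto
        then have "t\<^sup>2 \<le> (1 / a ^ (2 * m)) * (t\<^sup>2 * t ^ (2 * m))" using a by simp
        also have "\<dots> \<le> real n powr (- 2) * (t\<^sup>2 * t ^ (2 * m))"
          by (intro mult_right_mono a2m) (simp add: power_mult)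
        also have "t\<^sup>2 * t ^ (2 * m) = t ^ (2 * (m + 1))" by (simp add: power_add power2_eq_square)
        finally show ?thesis .
      qed
      then show "ennreal (t\<^sup>2) * indicator {t. \<bar>t\<bar> > a} t \<le> ennreal (real n powr (- 2)) * ennreal (t ^ (2 * (m + 1)))"
        by (auto simp: ennreal_mult'[symmetric] intro!: ennreal_leI split: split_indicator)
    qed
    also have "\<dots> = ennreal (real n powr (- 2)) * ennreal A"
      by (subst nn_integral_cmult) (measurable, simp only: mom)
    also have "\<dots> = ennreal (A * real n powr (- 2))" using A by (simp add: ennreal_mult mult.commute)
    finally show ?thesis unfolding a_def .
  qed
  with A show ?thesis by blast
qed

text \<open>Convergence controls \<open>1 + \<eta> n\<close> only for large n; the finitely many
  other n >= 2 are covered by a minimum that \<open>pos\<close> makes positive. The bounds are thus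
  available at every level.\<close>

lemma geb_rho_bounds:
  assumes \<rho>\<^sub>0: "\<rho>\<^sub>0 > 0" and \<eta>: "\<eta> \<longlonglongrightarrow> 0" and pos: "\<And>n. n \<ge> 2 \<Longrightarrow> geb_rho \<rho>\<^sub>0 \<eta> n > 0"
  shows "\<exists>c>0. \<exists>C>0. \<forall>n\<ge>2. c / sqrt (real n) \<le> geb_rho \<rho>\<^sub>0 \<eta> n \<and> geb_rho \<rho>\<^sub>0 \<eta> n \<le> C * univ_thr n / sqrt (real n)"
proof -
  have eq: "geb_rho \<rho>\<^sub>0 \<eta> n = (1 + \<eta> n) * \<rho>\<^sub>0 * (univ_thr n / sqrt (real n))" for n
    by (simp add: geb_rho_def univ_thr_def real_sqrt_divide)
  have s: "univ_thr n / sqrt (real n) > 0" if "n \<ge> 2" for n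
    using univ_thr_ge_1[OF that] that by auto
  have \<eta>pos: "1 + \<eta> n > 0" if "n \<ge> 2" for n
  proof -
    have "0 < \<rho>\<^sub>0 * (univ_thr n / sqrt (real n))" using s[OF that] \<rho>\<^sub>0 by (rule mult_pos_pos[rotated])
    with pos[OF that] show ?thesis unfolding eq mult.assoc by (rule zero_less_mult_pos2)
  qed
  have "(\<lambda>n. 1 + \<eta> n) \<longlonglongrightarrow> 1 + 0" by (intro tendsto_intros \<eta>)
  then have "eventually (\<lambda>n. 1 + \<eta> n > 1 / 2) sequentially" by (rule order_tendstoD(1)) simp
  then obtain N where N: "\<And>n. n \<ge> N \<Longrightarrow> 1 + \<eta> n > 1 / 2" by (auto simp: eventually_sequentially)
  define m where "m = Min (insert (1 / 2) ((\<lambda>n. 1 + \<eta> n) ` {2..N}))"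
  have m: "m > 0" unfolding m_def using \<eta>pos by (subst Min_gr_iff) auto
  have m_le: "m \<le> 1 + \<eta> n" if "n \<ge> 2" for n
  proof (cases "n \<le> N")
    case True
    then show ?thesis unfolding m_def using that by (intro Min_le) auto
  next
    case False
    have "m \<le> 1 / 2" unfolding m_def by (intro Min_le) auto
    then show ?thesis using N[of n] False by simp
  qed
  have "Bseq \<eta>" using \<eta> by (intro convergent_imp_Bseq) (auto simp: convergent_def)
  then obtain M where M: "M > 0" "\<And>n. \<bar>\<eta> n\<bar> \<le> M" by (auto simp: Bseq_def)
  have "m * \<rho>\<^sub>0 / sqrt (real n) \<le> geb_rho \<rho>\<^sub>0 \<eta> n \<and> geb_rho \<rho>\<^sub>0 \<eta> n \<le> ((1 + M) * \<rho>\<^sub>0) * univ_thr n / sqrt (real n)"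
    if n: "n \<ge> 2" for n
  proof
    have "m * \<rho>\<^sub>0 / sqrt (real n) \<le> m * \<rho>\<^sub>0 * (univ_thr n / sqrt (real n))"
      using univ_thr_ge_1[OF n] m \<rho>\<^sub>0 by (simp add: divide_right_mono)
    also have "\<dots> \<le> geb_rho \<rho>\<^sub>0 \<eta> n"
      unfolding eq using m_le[OF n] \<rho>\<^sub>0 s[OF n] by (intro mult_right_mono) auto
    finally show "m * \<rho>\<^sub>0 / sqrt (real n) \<le> geb_rho \<rho>\<^sub>0 \<eta> n" .
    have "1 + \<eta> n \<le> 1 + M" using M(2)[of n] by (simp add: abs_le_iff)
    then have "geb_rho \<rho>\<^sub>0 \<eta> n \<le> (1 + M) * \<rho>\<^sub>0 * (univ_thr n / sqrt (real n))"
      unfolding eq using \<rho>\<^sub>0 s[OF n] by (intro mult_right_mono) auto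
    then show "geb_rho \<rho>\<^sub>0 \<eta> n \<le> ((1 + M) * \<rho>\<^sub>0) * univ_thr n / sqrt (real n)" by simp
  qed
  moreover have "m * \<rho>\<^sub>0 > 0" "(1 + M) * \<rho>\<^sub>0 > 0" using m M \<rho>\<^sub>0 by auto
  ultimately show ?thesis by blast
qed

text \<open>With \<rho> of order 1 / sqrt n up to logarithms, a central interval of length 4
  n^\<delta> contributes n^(1/2 + \<delta>), and the outer part one unit per mean beyond n^\<delta>.
  All powers of \<open>univ_thr n\<close> are hidden in n^\<zeta>. The factor \<open>L\<close> is
  quantified inside because it grows with n, while \<open>A\<close> does not.\<close>

lemma ratio_loss_total_le:
  fixes \<delta> \<zeta> c C :: real
  assumes \<delta>: "\<delta> > 0" and \<zeta>: "\<zeta> > 0" and c: "c > 0" and C: "C > 0"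
  shows "\<exists>A>0. \<forall>n \<theta> \<rho>. \<forall>\<iota> :: nat \<Rightarrow> 'i. \<forall>I. level n \<iota> I \<rho> \<longrightarrow> c / sqrt (real n) \<le> \<rho> \<longrightarrow> \<rho> \<le> C * univ_thr n / sqrt (real n)
    \<longrightarrow> (\<exists>L\<ge>1. level.dev n \<le> L * \<rho> \<and> (\<forall>x. \<bar>mixture' n \<theta> x\<bar> \<le> L * max \<rho> (mixture n \<theta> x))
       \<and> (\<Sum>k=1..n. \<integral>\<^sup>+ t. ennreal (level.ratio_loss n \<theta> \<rho> L (\<theta> k + t)) \<partial>std_normal_distribution)
         \<le> ennreal (A * real n powr \<zeta> * (real n powr (1 / 2 + \<delta>) + real (card {k\<in>{1..n}. \<bar>\<theta> k\<bar> > real n powr \<delta>}))))"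
proof -
  obtain A\<^sub>\<tau> where A\<tau>: "A\<^sub>\<tau> \<ge> 0" "\<And>n. n \<ge> 2 \<Longrightarrow> (\<integral>\<^sup>+ t. ennreal (t\<^sup>2) * indicator {t. \<bar>t\<bar> > real n powr \<delta>} t \<partial>std_normal_distribution)
     \<le> ennreal (A\<^sub>\<tau> * real n powr (- 2))"
    using std_normal_tail_moment[OF \<delta>] by blast
  obtain A\<^sub>e where Ae: "A\<^sub>e > 0" "\<And>n. n \<ge> 2 \<Longrightarrow> exp (1 - 1 * univ_thr n ^ 4) \<le> A\<^sub>e * real n powr (- 2)"
    using exp_univ_thr_le[of 1 2] by auto
  obtain A\<^sub>s where As: "A\<^sub>s > 0" "\<And>n. n \<ge> 2 \<Longrightarrow> univ_thr n ^ 24 \<le> A\<^sub>s * real n powr \<zeta>"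
    using univ_thr_power_le[OF \<zeta>] by blast
  define D where "D = 6 / c + 1 + 1 / c"
  have D: "D \<ge> 1" using c by (simp add: D_def)
  define K\<^sub>0 where "K\<^sub>0 = 2 * C + 2 + 192 * D ^ 5"
  define A where "A = 4 * K\<^sub>0 + (2 + 32 * D ^ 6) * (1 + A\<^sub>\<tau>) + 8 * (1 / c + D)\<^sup>2 * A\<^sub>e"
  have K0: "K\<^sub>0 > 0" using C D by (simp add: K\<^sub>0_def add_pos_pos)
  have A0: "A > 0" unfolding A_def using K0 D A\<tau> Ae c by (intro add_pos_nonneg mult_nonneg_nonneg mult_pos_pos) auto
  show ?thesis
  proof (rule exI[of _ "A * A\<^sub>s"], intro conjI allI impI)
    show "A * A\<^sub>s > 0" using A0 As by simp
    fix n \<theta> \<rho> and \<iota> :: "nat \<Rightarrow> 'i" and I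
    assume lev: "level n \<iota> I \<rho>" and \<rho>l: "c / sqrt (real n) \<le> \<rho>" and \<rho>u: "\<rho> \<le> C * univ_thr n / sqrt (real n)"
    interpret level n \<theta> \<iota> I \<rho> by (rule lev)
    define r where "r = sqrt (real n)"
    have r: "r \<ge> 1" "r * r = real n" "r > 0" using n2 by (auto simp: r_def)
    \<comment> \<open>The power 4 comes from dev / \<rho> <= 6 s^4 / c. Then L^6 and L^5
      \<open>dev\<close> both carry s^24, the largest power of s that occurs.\<close>
    define L where "L = D * s ^ 4"
    have s4: "1 \<le> s ^ 4" "s \<le> s ^ 4" using s1 by (auto simp: self_le_power)
    have L1: "L \<ge> 1" unfolding L_def using mult_mono[OF D s4(1)] D by simp
    have cr: "c \<le> \<rho> * r" using \<rho>l r by (simp add: r_def[symmetric] pos_divide_le_eq)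
    have devL: "dev \<le> L * \<rho>"
    proof -
      have "6 \<le> D * c" using c by (simp add: D_def field_simps)
      then have "6 * s ^ 4 \<le> (D * c) * s ^ 4" using s4 by (intro mult_right_mono) auto
      also have "\<dots> = D * s ^ 4 * c" by simp
      also have "\<dots> \<le> D * s ^ 4 * (\<rho> * r)" using cr D s4 by (intro mult_left_mono) auto
      finally show ?thesis using r unfolding dev_def L_def r_def[symmetric] by (simp add: pos_divide_le_eq mult_ac)
    qed
    have mix: "\<bar>mixture' n \<theta> x\<bar> \<le> L * max \<rho> (mixture n \<theta> x)" for x
    proof -
      let ?M = "max \<rho> (mixture n \<theta> x)"
      have "1 / real n \<le> 1 / c * \<rho>"
      proof -
        have "c * 1 \<le> \<rho> * r * r" using cr r \<rho> c by (intro mult_mono) auto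
        then have "c \<le> \<rho> * real n" using r by (simp add: mult.assoc)
        then show ?thesis using c n2 by (simp add: field_simps)
      qed
      also have "\<dots> \<le> 1 / c * ?M" using c by (intro mult_left_mono) auto
      finally have "1 / real n \<le> 1 / c * ?M" .
      moreover have "s * mixture n \<theta> x \<le> s * ?M" using s1 by (intro mult_left_mono) auto
      ultimately have "\<bar>mixture' n \<theta> x\<bar> \<le> (s + 1 / c) * ?M"
        using mixture_bounds(2)[OF n2, of \<theta> x] by (simp add: algebra_simps)
      also have "\<dots> \<le> L * ?M"
      proof (intro mult_right_mono)
        have "s + 1 / c \<le> s ^ 4 + 1 / c * s ^ 4" using s4 c by (intro add_mono) (auto simp: divide_right_mono)
        also have "\<dots> = (1 + 1 / c) * s ^ 4" by (simp add: algebra_simps)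
        also have "\<dots> \<le> D * s ^ 4"
        proof (intro mult_right_mono)
          have "0 \<le> 6 / c" using c by simp
          then show "1 + 1 / c \<le> D" unfolding D_def by linarith
        qed (use s4 in simp)
        finally show "s + 1 / c \<le> L" unfolding L_def .
      qed (use \<rho> in auto)
      finally show ?thesis .
    qed
    define a where "a = real n powr \<delta>"
    have a: "a \<ge> 1" unfolding a_def using n2 \<delta> by (intro ge_one_powr_ge_zero) auto
    define \<tau> where "\<tau> = A\<^sub>\<tau> * real n powr (- 2)"
    define N where "N = real (card {k\<in>{1..n}. \<bar>\<theta> k\<bar> > a})"
    define K where "K = 2 * (s\<^sup>2 * \<rho> + 1 / real n) + 32 * L ^ 4 * dev\<^sup>2 / \<rho>"
    define R where "R = 2 * (s\<^sup>2 / \<rho> + L)\<^sup>2 * (4 * exp (1 - s ^ 4))"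
    have "(\<Sum>k=1..n. \<integral>\<^sup>+ t. ennreal (ratio_loss L (\<theta> k + t)) \<partial>std_normal_distribution)
      \<le> ennreal (4 * a * real n * K + (2 + 32 * L ^ 6) * (N + real n * \<tau>) + real n * R)"
      unfolding K_def R_def N_def
      by (rule sum_ratio_loss_le[OF L1 devL a]) (use A\<tau> n2 in \<open>auto simp: a_def \<tau>_def\<close>)
    also have "\<dots> \<le> ennreal (A * A\<^sub>s * real n powr \<zeta> * (real n powr (1 / 2 + \<delta>) + N))"
    proof (rule ennreal_leI)
      have s24: "s ^ m \<le> s ^ 24" if "m \<le> 24" for m using s1 that by (rule power_increasing[rotated])
      have s24_1: "1 \<le> s ^ 24" using s1 by (rule one_le_power)
      have nn2: "real n powr (- 2) = 1 / (real n * real n)" using n2 by (simp add: powr_minus powr_numeral power2_eq_square field_simps)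
      have ra: "real n powr (1 / 2 + \<delta>) = r * a"
        using n2 by (simp add: powr_add r_def a_def powr_half_sqrt)
      have ra1: "1 \<le> r * a" using mult_mono[OF r(1) a] r by simp
      have inv: "1 / real n \<le> 1 / r"
      proof -
        have "r * 1 \<le> r * r" using r by (intro mult_left_mono) auto
        then have "r \<le> real n" using r(2) by simp
        then show ?thesis using r(3) by (intro divide_left_mono) auto
      qed
      have K_le: "K \<le> K\<^sub>0 * s ^ 24 / r"
      proof -
        have "s\<^sup>2 * \<rho> \<le> s\<^sup>2 * (C * s / r)" using \<rho>u by (intro mult_left_mono) (auto simp: r_def)
        also have "\<dots> = C * s ^ 3 / r" by (simp add: power2_eq_square power3_eq_cube)
        also have "\<dots> \<le> C * s ^ 24 / r" using s24[of 3] C r by (intro divide_right_mono mult_left_mono) auto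
        finally have 1: "s\<^sup>2 * \<rho> \<le> C * s ^ 24 / r" .
        have 2: "1 / real n \<le> s ^ 24 / r" using inv s24_1 r by (meson divide_right_mono less_imp_le order_trans)
        have "32 * L ^ 4 * dev\<^sup>2 / \<rho> = 32 * L ^ 4 * dev * (dev / \<rho>)" by (simp add: power2_eq_square)
        also have "\<dots> \<le> 32 * L ^ 4 * dev * L"
          using devL \<rho> L1 dev_pos by (intro mult_left_mono) (auto simp: pos_divide_le_eq)
        also have "\<dots> = 32 * L ^ 5 * dev" by (simp add: eval_nat_numeral)
        also have "\<dots> = 192 * D ^ 5 * s ^ 24 / r"
          unfolding L_def dev_def r_def by (simp add: power_mult_distrib mult_ac flip: power_mult power_add)
        finally have 3: "32 * L ^ 4 * dev\<^sup>2 / \<rho> \<le> 192 * D ^ 5 * s ^ 24 / r" .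
        have "K \<le> 2 * (C * s ^ 24 / r + s ^ 24 / r) + 192 * D ^ 5 * s ^ 24 / r"
          unfolding K_def using 1 2 3 by (intro add_mono mult_left_mono) auto
        also have "\<dots> = K\<^sub>0 * s ^ 24 / r" unfolding K\<^sub>0_def using r by (simp add: field_simps)
        finally show ?thesis .
      qed
      have T1: "4 * a * real n * K \<le> 4 * K\<^sub>0 * (s ^ 24 * (r * a + N))"
      proof -
        have "4 * a * real n * K \<le> 4 * a * real n * (K\<^sub>0 * s ^ 24 / r)"
          using a by (intro mult_left_mono K_le) auto
        also have "\<dots> = 4 * K\<^sub>0 * (s ^ 24 * (r * a))" unfolding r(2)[symmetric] using r(3) by simp
        also have "\<dots> \<le> 4 * K\<^sub>0 * (s ^ 24 * (r * a + N))"
          using K0 s24_1 by (intro mult_left_mono) (auto simp: N_def)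
        finally show ?thesis .
      qed
      have T2: "(2 + 32 * L ^ 6) * (N + real n * \<tau>) \<le> (2 + 32 * D ^ 6) * (1 + A\<^sub>\<tau>) * (s ^ 24 * (r * a + N))"
      proof -
        have "32 * L ^ 6 = 32 * D ^ 6 * s ^ 24" by (simp add: L_def power_mult_distrib flip: power_mult)
        then have L6: "2 + 32 * L ^ 6 \<le> (2 + 32 * D ^ 6) * s ^ 24" using s24_1 by (simp add: algebra_simps)
        have "real n * \<tau> = A\<^sub>\<tau> * (1 / real n)" using n2 by (simp add: \<tau>_def nn2)
        also have "\<dots> \<le> A\<^sub>\<tau> * (r * a)"
          using A\<tau> ra1 n2 by (intro mult_left_mono order_trans[OF _ ra1]) auto
        finally have "real n * \<tau> \<le> A\<^sub>\<tau> * (r * a)" .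
        then have "N + real n * \<tau> \<le> (1 + A\<^sub>\<tau>) * (r * a + N)"
        proof -
          have "0 \<le> A\<^sub>\<tau> * N" using A\<tau>(1) by (simp add: N_def)
          moreover have "(1 + A\<^sub>\<tau>) * (r * a + N) = r * a + N + A\<^sub>\<tau> * (r * a) + A\<^sub>\<tau> * N"
            by (simp only: distrib_left distrib_right mult_1 add.assoc)
          ultimately show ?thesis using \<open>real n * \<tau> \<le> A\<^sub>\<tau> * (r * a)\<close> ra1 by linarith
        qed
        then have "(2 + 32 * L ^ 6) * (N + real n * \<tau>) \<le> ((2 + 32 * D ^ 6) * s ^ 24) * ((1 + A\<^sub>\<tau>) * (r * a + N))"
          using L6 D s24_1 A\<tau> by (intro mult_mono) (auto simp: N_def \<tau>_def)
        then show ?thesis by (simp add: mult_ac)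
      qed
      have T3: "real n * R \<le> 8 * (1 / c + D)\<^sup>2 * A\<^sub>e * (s ^ 24 * (r * a + N))"
      proof -
        have "s\<^sup>2 / \<rho> \<le> s ^ 4 * r / c"
        proof -
          have "s\<^sup>2 * c \<le> s ^ 4 * (\<rho> * r)"
            using s1 cr c power_increasing[of 2 4 s] by (intro mult_mono) auto
          then show ?thesis using \<rho> c by (simp add: field_simps)
        qed
        moreover have "L \<le> D * s ^ 4 * r" unfolding L_def using r D s4 mult_left_mono[of 1 r "D * s ^ 4"] by simp
        ultimately have "s\<^sup>2 / \<rho> + L \<le> (1 / c + D) * (s ^ 4 * r)" by (simp add: algebra_simps)
        then have "(s\<^sup>2 / \<rho> + L)\<^sup>2 \<le> ((1 / c + D) * (s ^ 4 * r))\<^sup>2"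
          using \<rho> L1 by (intro power_mono) auto
        also have "\<dots> = (1 / c + D)\<^sup>2 * (s ^ 8 * real n)"
          by (simp add: power_mult_distrib r_def flip: power_mult)
        finally have sq: "(s\<^sup>2 / \<rho> + L)\<^sup>2 \<le> (1 / c + D)\<^sup>2 * (s ^ 8 * real n)" .
        have "real n * R \<le> real n * (2 * ((1 / c + D)\<^sup>2 * (s ^ 8 * real n)) * (4 * (A\<^sub>e * real n powr (- 2))))"
          unfolding R_def using Ae(2)[OF n2] sq by (intro mult_left_mono mult_mono) auto
        also have "\<dots> = 8 * (1 / c + D)\<^sup>2 * A\<^sub>e * (s ^ 8 * 1)" unfolding nn2 using n2 by simp
        also have "\<dots> \<le> 8 * (1 / c + D)\<^sup>2 * A\<^sub>e * (s ^ 24 * (r * a + N))"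
          using s24[of 8] ra1 Ae s24_1 s1 by (intro mult_left_mono mult_mono) (auto simp: N_def)
        finally show ?thesis .
      qed
      have "4 * a * real n * K + (2 + 32 * L ^ 6) * (N + real n * \<tau>) + real n * R \<le> A * (s ^ 24 * (r * a + N))"
        using T1 T2 T3 unfolding A_def by (simp only: distrib_right)
      also have "\<dots> \<le> A * (A\<^sub>s * real n powr \<zeta> * (r * a + N))"
        using A0 As(2)[OF n2] ra1 by (intro mult_left_mono mult_right_mono) (auto simp: N_def)
      finally show "4 * a * real n * K + (2 + 32 * L ^ 6) * (N + real n * \<tau>) + real n * R \<le> A * A\<^sub>s * real n powr \<zeta> * (real n powr (1 / 2 + \<delta>) + N)"
        unfolding ra by (simp only: mult_ac)
    qed
    finally show "\<exists>L\<ge>1. level.dev n \<le> L * \<rho> \<and> (\<forall>x. \<bar>mixture' n \<theta> x\<bar> \<le> L * max \<rho> (mixture n \<theta> x))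
       \<and> (\<Sum>k=1..n. \<integral>\<^sup>+ t. ennreal (level.ratio_loss n \<theta> \<rho> L (\<theta> k + t)) \<partial>std_normal_distribution)
         \<le> ennreal (A * A\<^sub>s * real n powr \<zeta> * (real n powr (1 / 2 + \<delta>) + real (card {k\<in>{1..n}. \<bar>\<theta> k\<bar> > real n powr \<delta>})))"
      using L1 devL mix unfolding N_def a_def by blast
  qed
qed

lemma geb_b_eq: "n \<ge> 1 \<Longrightarrow> geb_b b\<^sub>0 n = b\<^sub>0 * (univ_thr n)\<^sup>2 / (2 * sqrt (real n))"
  by (simp add: geb_b_def univ_thr_sq)

lemma sum_min_le_powr:
  fixes n :: nat and \<theta> :: "nat \<Rightarrow> real"
  assumes "0 < p" "p \<le> 2"
  shows "(\<Sum>k=1..n. min 1 ((\<theta> k)\<^sup>2)) \<le> (\<Sum>k=1..n. \<bar>\<theta> k\<bar> powr p)"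
  by (intro sum_mono abs_powr_bounds(2) assms)

text \<open>Termwise, 1 - exp (- \<theta>^2 / 4) lies between min 1 (\<theta>^2) / 5 and
  \<bar>\<theta>\<bar>^p. The moment thus bounds the index, and the index bounds the quantity that
  governs soft thresholding.\<close>

lemma pop_kappa_bounds:
  assumes n: "n > 0" and p: "0 < p" "p \<le> 2"
  shows "real n * pop_kappa n \<theta> \<le> (\<Sum>k=1..n. \<bar>\<theta> k\<bar> powr p)"
    and "(\<Sum>k=1..n. min 1 ((\<theta> k)\<^sup>2)) \<le> 5 * (real n * pop_kappa n \<theta>)"
proof -
  have eq: "real n * pop_kappa n \<theta> = (\<Sum>k=1..n. 1 - exp (- (\<theta> k)\<^sup>2 / 4))"
    using n by (simp add: pop_kappa_def sum_subtractf right_diff_distrib)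
  show "real n * pop_kappa n \<theta> \<le> (\<Sum>k=1..n. \<bar>\<theta> k\<bar> powr p)"
    unfolding eq by (intro sum_mono abs_powr_bounds(1) p)
  have "(\<Sum>k=1..n. min 1 ((\<theta> k)\<^sup>2) / 5) \<le> (\<Sum>k=1..n. 1 - exp (- (\<theta> k)\<^sup>2 / 4))"
    by (intro sum_mono min_le_one_minus_exp)
  then show "(\<Sum>k=1..n. min 1 ((\<theta> k)\<^sup>2)) \<le> 5 * (real n * pop_kappa n \<theta>)"
    unfolding eq by (simp add: sum_divide_distrib[symmetric])
qed

lemma card_large_le:
  fixes n :: nat and \<theta> :: "nat \<Rightarrow> real"
  assumes p: "0 < p" and a: "a > 0"
  shows "real (card {k\<in>{1..n}. \<bar>\<theta> k\<bar> > a}) * a powr p \<le> (\<Sum>k=1..n. \<bar>\<theta> k\<bar> powr p)"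
proof -
  have "real (card {k\<in>{1..n}. \<bar>\<theta> k\<bar> > a}) * a powr p = (\<Sum>k\<in>{k\<in>{1..n}. \<bar>\<theta> k\<bar> > a}. a powr p)" by simp
  also have "\<dots> \<le> (\<Sum>k\<in>{k\<in>{1..n}. \<bar>\<theta> k\<bar> > a}. \<bar>\<theta> k\<bar> powr p)"
    using p a by (intro sum_mono powr_mono2) auto
  also have "\<dots> \<le> (\<Sum>k=1..n. \<bar>\<theta> k\<bar> powr p)" by (intro sum_mono2) auto
  finally show ?thesis .
qed

text \<open>Since b(n) is b0 s^2 / (2 sqrt n), the exponent n b^2 / 64 equals b0^2 s^4 / 256, and
  the probability beats n^(-4), while n coordinates lose at most of order s^4 n^2. The result is put
  as a multiple of 1 / s^3 in order to join the remainder of soft thresholding.\<close>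

lemma level_tail_const_le:
  assumes b\<^sub>0: "b\<^sub>0 > 0" and c: "c > 0"
  shows "\<exists>A>0. \<forall>n \<rho>. n \<ge> 2 \<longrightarrow> c / sqrt (real n) \<le> \<rho> \<longrightarrow> real n * level.tail_const n \<rho> (geb_b b\<^sub>0 n) \<le> A / univ_thr n ^ 3"
proof -
  obtain A\<^sub>k where Ak: "A\<^sub>k > 0" "\<And>n. n \<ge> 2 \<Longrightarrow> exp (1 - b\<^sub>0\<^sup>2 / 256 * univ_thr n ^ 4) \<le> A\<^sub>k * real n powr (- 4)"
    using exp_univ_thr_le[of "b\<^sub>0\<^sup>2 / 256" 4] b\<^sub>0 by auto
  obtain A\<^sub>7 where A7: "A\<^sub>7 > 0" "\<And>n. n \<ge> 2 \<Longrightarrow> univ_thr n ^ 7 \<le> A\<^sub>7 * real n powr 1"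
    using univ_thr_power_le[of 1 7] by auto
  let ?A = "(4 + 2 / c\<^sup>2) * (2 * A\<^sub>k) * A\<^sub>7"
  have "real n * level.tail_const n \<rho> (geb_b b\<^sub>0 n) \<le> ?A / univ_thr n ^ 3" if n: "n \<ge> 2" and \<rho>c: "c / sqrt (real n) \<le> \<rho>" for n \<rho>
  proof -
    have "c / sqrt (real n) > 0" using c n by simp
    then have \<rho>0: "\<rho> > 0" using \<rho>c by linarith
    \<comment> \<open>\<open>tail_const\<close> depends on n and \<rho> only, so zero means and the
      identity indexing serve.\<close>
    interpret level n "\<lambda>_. 0" "\<lambda>k. k" "{1..n}" \<rho>
      by unfold_locales (use n \<rho>0 in auto)
    have kap: "kappa_prob (geb_b b\<^sub>0 n) \<le> 2 * (A\<^sub>k * real n powr (- 4))"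
    proof -
      have "real n * (geb_b b\<^sub>0 n)\<^sup>2 / 64 = b\<^sub>0\<^sup>2 / 256 * s ^ 4"
        using n by (simp add: geb_b_eq power_divide power_mult_distrib flip: power_mult)
      then show ?thesis using Ak(2)[OF n] unfolding kappa_prob_def by (simp only:)
    qed
    have s4: "s ^ 4 \<ge> 1" "s\<^sup>2 \<le> s ^ 4" using s1 power_increasing[of 2 4 s] by auto
    have n4: "1 \<le> s ^ 4 * real n" using mult_mono[of 1 "s ^ 4" 1 "real n"] s4 n by simp
    have inv: "1 / \<rho>\<^sup>2 \<le> real n / c\<^sup>2"
    proof -
      have "(c / sqrt (real n))\<^sup>2 \<le> \<rho>\<^sup>2" using \<rho>c c by (intro power_mono) auto
      then have "c\<^sup>2 / real n \<le> \<rho>\<^sup>2" by (simp add: power_divide)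
      then show ?thesis using c n \<rho>0 by (simp add: field_simps)
    qed
    have "2 + (2 * s ^ 4 / \<rho>\<^sup>2 + 2 * s\<^sup>2) \<le> (4 + 2 / c\<^sup>2) * (s ^ 4 * real n)"
    proof -
      have "2 * s ^ 4 * (1 / \<rho>\<^sup>2) \<le> 2 * s ^ 4 * (real n / c\<^sup>2)" by (intro mult_left_mono inv) auto
      moreover have "s ^ 4 * 1 \<le> s ^ 4 * real n" using n by (intro mult_left_mono) auto
      then have "s\<^sup>2 \<le> s ^ 4 * real n" using s4 by simp
      ultimately show ?thesis using n4 by (simp add: distrib_right)
    qed
    then have "tail_const (geb_b b\<^sub>0 n) \<le> ((4 + 2 / c\<^sup>2) * (s ^ 4 * real n)) * (2 * (A\<^sub>k * real n powr (- 4)))"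
      unfolding tail_const_def using kap kappa_prob_nonneg n4 by (intro mult_mono) auto
    then have "real n * tail_const (geb_b b\<^sub>0 n) \<le> real n * (((4 + 2 / c\<^sup>2) * (s ^ 4 * real n)) * (2 * (A\<^sub>k * real n powr (- 4))))"
      by (intro mult_left_mono) auto
    also have "real n powr (- 4) = 1 / real n ^ 4"
      using n by (simp add: powr_minus powr_numeral inverse_eq_divide)
    also have "real n * (((4 + 2 / c\<^sup>2) * (s ^ 4 * real n)) * (2 * (A\<^sub>k * (1 / real n ^ 4))))
        = (4 + 2 / c\<^sup>2) * (2 * A\<^sub>k) * (s ^ 4 / real n ^ 2)"
      using n by (simp add: eval_nat_numeral)
    also have "\<dots> \<le> (4 + 2 / c\<^sup>2) * (2 * A\<^sub>k) * (A\<^sub>7 / s ^ 3)"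
    proof (intro mult_left_mono)
      have "s ^ 4 * s ^ 3 \<le> A\<^sub>7 * real n" using A7(2)[OF n] by (simp flip: power_add)
      also have "\<dots> \<le> A\<^sub>7 * real n ^ 2" using A7(1) n by (intro mult_left_mono) (auto simp: power2_eq_square)
      finally show "s ^ 4 / real n ^ 2 \<le> A\<^sub>7 / s ^ 3" using s1 n by (simp add: field_simps)
    qed (use Ak in auto)
    finally show ?thesis by simp
  qed
  moreover have "?A > 0" using Ak A7 c by (intro mult_pos_pos add_pos_nonneg) auto
  ultimately show ?thesis by blast
qed

text \<open>
  The weight \<open>\<omega>\<close> splitting the loss into Bayes risk and estimation error is \<open>n powr (- \<delta> * p / 2)\<close> as
  long as this times \<open>T\<close> is below 1, and 1 otherwise.
\<close>

lemma level_ideal_inequality: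
  assumes \<rho>\<^sub>0: "\<rho>\<^sub>0 > 0" and b\<^sub>0: "b\<^sub>0 > 0" and \<eta>: "\<eta> \<longlonglongrightarrow> 0" and pos: "\<forall>n\<ge>2. geb_rho \<rho>\<^sub>0 \<eta> n > 0"
    and p: "0 < p" "p \<le> 2" and \<delta>: "\<delta> > 0" and \<zeta>: "\<zeta> > 0"
  shows "\<exists>A>0. \<forall>n \<theta>. \<forall>\<iota> :: nat \<Rightarrow> 'i. \<forall>I T h. n \<ge> 2 \<longrightarrow> inj_on \<iota> {1..n} \<longrightarrow> \<iota> ` {1..n} \<subseteq> I \<longrightarrow> h \<in> borel_measurable borel
     \<longrightarrow> (\<Sum>k=1..n. \<bar>\<theta> k\<bar> powr p) \<le> real n * T \<longrightarrow>
     level.level_loss n \<theta> \<iota> I (geb_rho \<rho>\<^sub>0 \<eta> n) (geb_b b\<^sub>0 n) \<le> sep_risk n \<theta> h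
       + ennreal (A * (real n powr (1 + \<zeta>) * (real n powr (2 * \<delta>) * min (real n powr (- (1 / 2))) T)
            + real n powr (1 + \<zeta>) * min 1 (T * real n powr (- (\<delta> * p / 2))) + 1 / univ_thr n ^ 3))"
proof -
  obtain c C where cC: "c > 0" "C > 0"
    "\<And>n. n \<ge> 2 \<Longrightarrow> c / sqrt (real n) \<le> geb_rho \<rho>\<^sub>0 \<eta> n \<and> geb_rho \<rho>\<^sub>0 \<eta> n \<le> C * univ_thr n / sqrt (real n)"
    using geb_rho_bounds[OF \<rho>\<^sub>0 \<eta>] pos by blast
  obtain A\<^sub>w where Aw: "A\<^sub>w > 0" and Aw_all: "\<forall>n \<theta> \<rho>. \<forall>\<iota> :: nat \<Rightarrow> 'i. \<forall>I. level n \<iota> I \<rho> \<longrightarrow> c / sqrt (real n) \<le> \<rho> \<longrightarrow> \<rho> \<le> C * univ_thr n / sqrt (real n)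
    \<longrightarrow> (\<exists>L\<ge>1. level.dev n \<le> L * \<rho> \<and> (\<forall>x. \<bar>mixture' n \<theta> x\<bar> \<le> L * max \<rho> (mixture n \<theta> x))
       \<and> (\<Sum>k=1..n. \<integral>\<^sup>+ t. ennreal (level.ratio_loss n \<theta> \<rho> L (\<theta> k + t)) \<partial>std_normal_distribution)
         \<le> ennreal (A\<^sub>w * real n powr \<zeta> * (real n powr (1 / 2 + \<delta>) + real (card {k\<in>{1..n}. \<bar>\<theta> k\<bar> > real n powr \<delta>}))))"
    using ratio_loss_total_le[OF \<delta> \<zeta> cC(1,2), where 'i='i] by (elim exE conjE) (rule that)
  note Aw_le = Aw_all[rule_format]
  obtain A\<^sub>4 where A4: "A\<^sub>4 > 0" "\<And>n. n \<ge> 2 \<Longrightarrow> univ_thr n ^ 4 \<le> A\<^sub>4 * real n powr \<zeta>"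
    using univ_thr_power_le[OF \<zeta>] by blast
  obtain A\<^sub>t where At: "A\<^sub>t > 0" "\<And>n \<rho>. n \<ge> 2 \<Longrightarrow> c / sqrt (real n) \<le> \<rho> \<Longrightarrow> real n * level.tail_const n \<rho> (geb_b b\<^sub>0 n) \<le> A\<^sub>t / univ_thr n ^ 3"
    using level_tail_const_le[OF b\<^sub>0 cC(1)] by blast
  define A\<^sub>S where "A\<^sub>S = 16 * (1 + 5 * b\<^sub>0) * A\<^sub>4"
  define A\<^sub>1 where "A\<^sub>1 = 2 * A\<^sub>w * (1 + 4 / b\<^sub>0)"
  define A\<^sub>2 where "A\<^sub>2 = 1 + 16 * A\<^sub>4 + 2 * A\<^sub>w"
  define A where "A = A\<^sub>S + A\<^sub>1 + A\<^sub>2 + A\<^sub>t + 8"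
  have Apos: "A\<^sub>S > 0" "A\<^sub>1 > 0" "A\<^sub>2 > 0" 
    using A4 Aw b\<^sub>0 by (auto simp: A\<^sub>S_def A\<^sub>1_def A\<^sub>2_def intro!: mult_pos_pos add_pos_pos)
  have "level.level_loss n \<theta> \<iota> I (geb_rho \<rho>\<^sub>0 \<eta> n) (geb_b b\<^sub>0 n) \<le> sep_risk n \<theta> h
       + ennreal (A * (real n powr (1 + \<zeta>) * (real n powr (2 * \<delta>) * min (real n powr (- (1 / 2))) T)
            + real n powr (1 + \<zeta>) * min 1 (T * real n powr (- (\<delta> * p / 2))) + 1 / univ_thr n ^ 3))"
    if n: "n \<ge> 2" and inj: "inj_on \<iota> {1..n}" and sub: "\<iota> ` {1..n} \<subseteq> I" and h: "h \<in> borel_measurable borel"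
      and T: "(\<Sum>k=1..n. \<bar>\<theta> k\<bar> powr p) \<le> real n * T"
    for n \<theta> and \<iota> :: "nat \<Rightarrow> 'i" and I T h
  proof -
    define \<rho> b where "\<rho> = geb_rho \<rho>\<^sub>0 \<eta> n" and "b = geb_b b\<^sub>0 n"
    have \<rho>b: "c / sqrt (real n) \<le> \<rho>" "\<rho> \<le> C * univ_thr n / sqrt (real n)" "\<rho> > 0"
      using cC(3)[OF n] pos[rule_format, OF n] by (auto simp: \<rho>_def)
    have lev: "level n \<iota> I \<rho>" by (rule level.intro) (use n inj sub \<rho>b in auto)
    interpret level n \<theta> \<iota> I \<rho> by (rule lev)
    define N where "N = real n"
    have N: "N \<ge> 2" "N > 0" using n by (auto simp: N_def)
    define M\<^sub>1 M\<^sub>2 where "M\<^sub>1 = min (N powr (- (1 / 2))) T" and "M\<^sub>2 = min 1 (T * N powr (- (\<delta> * p / 2)))"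
    define X Y Z where "X = N powr (1 + \<zeta>) * (N powr (2 * \<delta>) * M\<^sub>1)" and "Y = N powr (1 + \<zeta>) * M\<^sub>2" and "Z = 1 / s ^ 3"
    have "0 \<le> real n * T" by (rule order_trans[OF _ T]) (intro sum_nonneg, auto)
    then have T0: "T \<ge> 0" using n by (simp add: zero_le_mult_iff)
    have nonneg: "0 \<le> M\<^sub>1" "0 \<le> M\<^sub>2" "0 \<le> X" "0 \<le> Y" "0 \<le> Z"
      using T0 s1 by (auto simp: M\<^sub>1_def M\<^sub>2_def X_def Y_def Z_def)
    have b: "b > 0" "b = b\<^sub>0 * s\<^sup>2 * N powr (- (1 / 2)) / 2"
      using b\<^sub>0 s1 n unfolding b_def
      by (auto simp: geb_b_eq N_def powr_minus powr_half_sqrt field_simps)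
    have s24: "1 \<le> s\<^sup>2" "s\<^sup>2 \<le> s ^ 4" using s1 power_increasing[of 2 4 s] by auto
    have s4: "s ^ 4 \<le> A\<^sub>4 * N powr \<zeta>" using A4(2)[OF n] by (simp add: N_def)
    have N1\<zeta>: "N powr (1 + \<zeta>) = N * N powr \<zeta>" using N by (simp add: powr_add)
    have N\<delta>: "1 \<le> N powr (2 * \<delta>)" "1 \<le> N powr \<zeta>" using N \<delta> \<zeta> by (auto intro!: ge_one_powr_ge_zero)
    define m where "m = (\<Sum>k=1..n. min 1 ((\<theta> k)\<^sup>2))"
    have m0: "m \<ge> 0" unfolding m_def by (intro sum_nonneg) auto
    have mT: "m \<le> N * T" using sum_min_le_powr[OF p, of \<theta> n] T by (simp add: m_def N_def)
    have soft: "sep_risk n \<theta> (soft_threshold s) \<le> ennreal (4 * Z + 16 * s\<^sup>2 * m)"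
    proof -
      have "8 * (1 + s\<^sup>2) * m \<le> 16 * s\<^sup>2 * m" using s24 m0 by (intro mult_right_mono) auto
      then show ?thesis
        using sep_risk_soft_threshold_le[OF n2, of \<theta>] unfolding Z_def m_def
        by (elim order_trans) (intro ennreal_leI, simp)
    qed
    have soft_small: "sep_risk n \<theta> (soft_threshold s) \<le> ennreal (4 * Z + A\<^sub>S * X)" if kap: "pop_kappa n \<theta> \<le> 2 * b"
    proof -
      \<comment> \<open>Either value of the minimum \<open>M\<^sub>1\<close> is available: T by the
        moment bound, N^(-1/2) because the index is at most 2 b and b is of order s^2 / sqrt
        N.\<close>
      have "m \<le> (1 + 5 * b\<^sub>0) * s\<^sup>2 * (N * M\<^sub>1)"
      proof (cases "M\<^sub>1 = T")
        case True
        have "1 * 1 \<le> (1 + 5 * b\<^sub>0) * s\<^sup>2" using b\<^sub>0 s24 by (intro mult_mono) auto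
        then have "1 * (N * T) \<le> (1 + 5 * b\<^sub>0) * s\<^sup>2 * (N * T)" using N T0 by (intro mult_right_mono) auto
        then show ?thesis using mT True by simp
      next
        case False
        then have M1: "M\<^sub>1 = N powr (- (1 / 2))" by (auto simp: M\<^sub>1_def min_def split: if_splits)
        have "m \<le> 5 * (N * pop_kappa n \<theta>)"
          using pop_kappa_bounds(2)[OF _ p, of n \<theta>] n by (simp add: m_def N_def)
        also have "\<dots> \<le> 5 * (N * (2 * b))" using kap N by (intro mult_left_mono) auto
        also have "\<dots> = 5 * b\<^sub>0 * s\<^sup>2 * (N * M\<^sub>1)" unfolding b(2) M1 by simp
        also have "\<dots> \<le> (1 + 5 * b\<^sub>0) * s\<^sup>2 * (N * M\<^sub>1)"
          using N nonneg by (intro mult_right_mono) auto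
        finally show ?thesis .
      qed
      then have "16 * s\<^sup>2 * m \<le> 16 * s\<^sup>2 * ((1 + 5 * b\<^sub>0) * s\<^sup>2 * (N * M\<^sub>1))" by (intro mult_left_mono) auto
      also have "\<dots> = 16 * (1 + 5 * b\<^sub>0) * (N * M\<^sub>1) * s ^ 4" by (simp add: eval_nat_numeral)
      also have "\<dots> \<le> 16 * (1 + 5 * b\<^sub>0) * (N * M\<^sub>1) * (A\<^sub>4 * N powr \<zeta>)"
        using b\<^sub>0 N nonneg by (intro mult_left_mono s4) auto
      also have "\<dots> = A\<^sub>S * (N powr (1 + \<zeta>) * (1 * M\<^sub>1))" by (simp add: A\<^sub>S_def N1\<zeta>)
      also have "\<dots> \<le> A\<^sub>S * X"
        unfolding X_def using Apos N\<delta> nonneg by (intro mult_left_mono mult_right_mono) auto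
      finally show ?thesis using soft by (elim order_trans) (intro ennreal_leI, simp)
    qed
    have tail: "real n * tail_const b \<le> A\<^sub>t * Z" "0 \<le> real n * tail_const b"
      using At(2)[OF n \<rho>b(1)] kappa_prob_nonneg by (auto simp: b_def Z_def tail_const_def)
    have concl: "level_loss b \<le> sep_risk n \<theta> h + ennreal (A * (X + Y + Z))"
    proof (cases "pop_kappa n \<theta> \<le> b / 2")
      case True
      have "level_loss b \<le> sep_risk n \<theta> (soft_threshold s) + ennreal (real n * tail_const b)"
        by (rule level_loss_small[OF b(1) True])
      also have "\<dots> \<le> ennreal (4 * Z + A\<^sub>S * X) + ennreal (A\<^sub>t * Z)"
        using True b by (intro add_mono soft_small ennreal_leI tail) auto
      also have "\<dots> = ennreal ((4 * Z + A\<^sub>S * X) + A\<^sub>t * Z)"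
        using nonneg Apos At by (intro ennreal_plus[symmetric]) auto
      also have "\<dots> \<le> ennreal (A * (X + Y + Z))"
      proof (rule ennreal_leI)
        have "0 \<le> A\<^sub>1 * (X + Y + Z)" "0 \<le> A\<^sub>2 * (X + Y + Z)" "0 \<le> A\<^sub>S * Y" "0 \<le> A\<^sub>S * Z" "0 \<le> A\<^sub>t * X" "0 \<le> A\<^sub>t * Y"
          using Apos At nonneg by auto
        then show "(4 * Z + A\<^sub>S * X) + A\<^sub>t * Z \<le> A * (X + Y + Z)"
          unfolding A_def distrib_left distrib_right using nonneg by linarith
      qed
      also have "\<dots> \<le> sep_risk n \<theta> h + ennreal (A * (X + Y + Z))" by simp
      finally show ?thesis .
    next
      case False
      define W where "W = A\<^sub>w * real n powr \<zeta> * (real n powr (1 / 2 + \<delta>) + real (card {k\<in>{1..n}. \<bar>\<theta> k\<bar> > real n powr \<delta>}))"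
      obtain L where L: "L \<ge> 1" "dev \<le> L * \<rho>" "\<And>x. \<bar>mixture' n \<theta> x\<bar> \<le> L * max \<rho> (mixture n \<theta> x)"
        and rl: "(\<Sum>k=1..n. \<integral>\<^sup>+ t. ennreal (ratio_loss L (\<theta> k + t)) \<partial>std_normal_distribution) \<le> ennreal W"
        using Aw_le[OF lev \<rho>b(1,2), of \<theta>] unfolding W_def by blast
      define c\<^sub>N where "c\<^sub>N = real (card {k\<in>{1..n}. \<bar>\<theta> k\<bar> > N powr \<delta>})"
      have W: "W = A\<^sub>w * N powr \<zeta> * (N powr (1 / 2 + \<delta>) + c\<^sub>N)" by (simp add: W_def c\<^sub>N_def N_def)
      have cN: "0 \<le> c\<^sub>N" by (simp add: c\<^sub>N_def)
      have W0: "W \<ge> 0" using Aw cN unfolding W by simp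
      have cN1: "c\<^sub>N \<le> N"
      proof -
        have "card {k\<in>{1..n}. \<bar>\<theta> k\<bar> > N powr \<delta>} \<le> card {1..n}" by (intro card_mono) auto
        then show ?thesis by (simp add: c\<^sub>N_def N_def)
      qed
      have cN2: "c\<^sub>N \<le> N * T * N powr (- (\<delta> * p))"
      proof -
        have "c\<^sub>N * (N powr \<delta>) powr p \<le> N * T"
          using card_large_le[OF p(1), where a="N powr \<delta>" and \<theta>=\<theta> and n=n] T N by (simp add: c\<^sub>N_def N_def)
        then have "c\<^sub>N * N powr (\<delta> * p) * N powr (- (\<delta> * p)) \<le> N * T * N powr (- (\<delta> * p))"
          by (intro mult_right_mono) (simp_all add: powr_powr)
        then show ?thesis using N by (simp add: mult.assoc flip: powr_add)
      qed
      \<comment> \<open>The index exceeds b / 2, hence so does T. As b is at least of order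
        N^(-1/2), the minimum \<open>M\<^sub>1\<close> is comparable to N^(-1/2), and the full
        estimation error may be charged to it.\<close>
      have M1: "N powr (- (1 / 2)) \<le> (1 + 4 / b\<^sub>0) * M\<^sub>1"
      proof -
        have "N * pop_kappa n \<theta> \<le> N * T"
          using order_trans[OF pop_kappa_bounds(1)[OF _ p] T] n unfolding N_def by simp
        then have "b / 2 \<le> T" using False N by simp
        moreover have "b\<^sub>0 * 1 * N powr (- (1 / 2)) / 2 \<le> b" unfolding b(2)
          using b\<^sub>0 s24 by (intro divide_right_mono mult_right_mono mult_left_mono) auto
        ultimately have "b\<^sub>0 * N powr (- (1 / 2)) \<le> 4 * T" by simp
        then have le: "N powr (- (1 / 2)) \<le> 4 / b\<^sub>0 * T" using b\<^sub>0 by (simp add: field_simps)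
        have "0 \<le> 4 / b\<^sub>0" using b\<^sub>0 by simp
        then show ?thesis using le T0 unfolding M\<^sub>1_def min_def by (simp add: distrib_right)
      qed
      have half: "N powr (1 / 2 + e) = N * N powr e * N powr (- (1 / 2))" for e
      proof -
        have "N * N powr e * N powr (- (1 / 2)) = N powr (1 + e + - (1 / 2))" using N by (simp only: powr_add powr_one)
        then show ?thesis by (simp add: add.commute)
      qed
      have main: "A\<^sub>w * N powr \<zeta> * (N * N powr (2 * \<delta>) * N powr (- (1 / 2))) * 2 \<le> A\<^sub>1 * X"
      proof -
        have "A\<^sub>w * N powr \<zeta> * (N * N powr (2 * \<delta>) * N powr (- (1 / 2))) * 2
            \<le> A\<^sub>w * N powr \<zeta> * (N * N powr (2 * \<delta>) * ((1 + 4 / b\<^sub>0) * M\<^sub>1)) * 2"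
          using Aw N by (intro mult_right_mono mult_left_mono M1) auto
        also have "\<dots> = A\<^sub>1 * X" by (simp add: A\<^sub>1_def X_def N1\<zeta>)
        finally show ?thesis .
      qed
      have core: "\<exists>\<omega>>0. ennreal (1 + \<omega>) * sep_risk n \<theta> (bayes_rule n \<theta>) + ennreal (1 + 1 / \<omega>) * ennreal W
         \<le> sep_risk n \<theta> h + ennreal (A\<^sub>1 * X + A\<^sub>2 * Y + 4 * Z)"
      proof -
        let ?RB = "sep_risk n \<theta> (bayes_rule n \<theta>)"
        have n0: "n > 0" using n by simp
        have RB: "?RB \<le> sep_risk n \<theta> h" by (rule sep_risk_bayes_rule_le[OF n0 h])
        have step: "ennreal (1 + \<omega>) * ?RB + ennreal (1 + 1 / \<omega>) * ennreal W \<le> sep_risk n \<theta> h + ennreal (A\<^sub>1 * X + A\<^sub>2 * Y + 4 * Z)"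
          if \<omega>: "\<omega> > 0" and r: "?RB \<le> ennreal r" "r \<ge> 0" and le: "\<omega> * r + (1 + 1 / \<omega>) * W \<le> A\<^sub>1 * X + A\<^sub>2 * Y + 4 * Z" for \<omega> r
        proof -
          have "ennreal (1 + \<omega>) * ?RB = ?RB + ennreal \<omega> * ?RB"
            using \<omega> by (simp add: ennreal_plus distrib_right del: ennreal_plus[symmetric])
          also have "\<dots> \<le> sep_risk n \<theta> h + ennreal \<omega> * ennreal r" by (intro add_mono RB mult_left_mono r) simp
          also have "ennreal \<omega> * ennreal r = ennreal (\<omega> * r)" using \<omega> r by (simp add: ennreal_mult)
          finally have "ennreal (1 + \<omega>) * ?RB \<le> sep_risk n \<theta> h + ennreal (\<omega> * r)" .
          moreover have "ennreal (1 + 1 / \<omega>) * ennreal W = ennreal ((1 + 1 / \<omega>) * W)"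
            using \<omega> W0 by (intro ennreal_mult[symmetric]) auto
          ultimately have "ennreal (1 + \<omega>) * ?RB + ennreal (1 + 1 / \<omega>) * ennreal W \<le> sep_risk n \<theta> h + (ennreal (\<omega> * r) + ennreal ((1 + 1 / \<omega>) * W))"
            by (simp only: add.assoc[symmetric]) (rule add_right_mono)
          also have "ennreal (\<omega> * r) + ennreal ((1 + 1 / \<omega>) * W) = ennreal (\<omega> * r + (1 + 1 / \<omega>) * W)"
            using \<omega> r W0 by (intro ennreal_plus[symmetric]) auto
          also have "\<dots> \<le> ennreal (A\<^sub>1 * X + A\<^sub>2 * Y + 4 * Z)" by (rule ennreal_leI[OF le])
          finally show ?thesis by (simp add: add_left_mono)
        qed
        show ?thesis
        proof (cases "T * N powr (- (\<delta> * p / 2)) \<ge> 1")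
          \<comment> \<open>T is large: comparison with the identity rule bounds the Bayes risk by
            N, which \<open>Y\<close> covers, so doubling the risk with \<omega> = 1 is
            affordable.\<close>
          case True
          then have M2: "M\<^sub>2 = 1" by (simp add: M\<^sub>2_def)
          have "1 * N + (1 + 1 / 1) * W \<le> A\<^sub>1 * X + A\<^sub>2 * Y + 4 * Z"
          proof -
            have "N powr (1 / 2 + \<delta>) \<le> N powr (1 / 2 + 2 * \<delta>)" using N \<delta> by (intro powr_mono) auto
            then have "W \<le> A\<^sub>w * N powr \<zeta> * (N powr (1 / 2 + 2 * \<delta>) + N)"
              unfolding W using Aw cN1 by (intro mult_left_mono add_mono) auto
            then have "2 * W \<le> A\<^sub>1 * X + 2 * A\<^sub>w * Y"
              using main unfolding half[of "2 * \<delta>"] Y_def M2 N1\<zeta> by (simp only: distrib_left mult_1_right mult_ac)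
            moreover have "N \<le> Y" unfolding Y_def M2 N1\<zeta> using N N\<delta> by simp
            moreover have "0 \<le> 16 * A\<^sub>4 * Y" using A4 nonneg by simp
            ultimately show ?thesis using nonneg unfolding A\<^sub>2_def distrib_right by linarith
          qed
          moreover have "?RB \<le> ennreal N"
            using sep_risk_bayes_rule_le[OF n0, of "\<lambda>x. x" \<theta>] by (simp add: sep_risk_id N_def)
          ultimately show ?thesis using N by (intro exI[of _ 1] conjI step[where r=N]) auto
        next
          case False
          \<comment> \<open>The exponent balances two errors, up to powers of s and the term 4 Z:
            \<omega> times the Bayes risk, of order \<omega> N T, and c / \<omega> where the count c
            of large means is at most N T N^(- \<delta> p). As p <= 2, the factor 1 / \<omega> is at
            most N^\<delta>, which accounts for the exponent 2 \<delta> in \<open>X\<close>.\<close>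
          define \<omega> where "\<omega> = N powr (- (\<delta> * p / 2))"
          have M2: "M\<^sub>2 = T * \<omega>" using False by (simp add: M\<^sub>2_def \<omega>_def)
          have \<omega>: "\<omega> > 0" using N by (simp add: \<omega>_def)
          have dp: "0 \<le> \<delta> * p / 2" "\<delta> * p / 2 \<le> \<delta>" using \<delta> p by auto
          have \<omega>1: "\<omega> \<le> 1" unfolding \<omega>_def using N dp powr_mono[of "- (\<delta> * p / 2)" 0 N] by simp
          have inv: "1 / \<omega> = N powr (\<delta> * p / 2)" using N by (simp add: \<omega>_def powr_minus inverse_eq_divide)
          have "\<omega> * (4 * Z + 16 * s\<^sup>2 * m) + (1 + 1 / \<omega>) * W \<le> A\<^sub>1 * X + A\<^sub>2 * Y + 4 * Z"
          proof -
            have "\<omega> * (4 * Z) \<le> 1 * (4 * Z)" using \<omega>1 nonneg by (intro mult_right_mono) auto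
            moreover have "\<omega> * (16 * s\<^sup>2 * m) \<le> 16 * A\<^sub>4 * Y"
            proof -
              have "\<omega> * (16 * s\<^sup>2 * m) \<le> \<omega> * (16 * (A\<^sub>4 * N powr \<zeta>) * (N * T))"
                using s24 s4 mT m0 \<omega> A4 by (intro mult_left_mono mult_mono) auto
              also have "\<dots> = 16 * A\<^sub>4 * Y" by (simp add: Y_def M2 N1\<zeta>)
              finally show ?thesis .
            qed
            moreover have "(1 + 1 / \<omega>) * W \<le> A\<^sub>1 * X + 2 * A\<^sub>w * Y"
            proof -
              have "1 \<le> 1 / \<omega>" using \<omega> \<omega>1 by simp
              then have "(1 + 1 / \<omega>) * W \<le> (2 * (1 / \<omega>)) * W" using W0 by (intro mult_right_mono) auto
              also have "\<dots> = A\<^sub>w * N powr \<zeta> * (N powr (1 / 2 + \<delta>) * N powr (\<delta> * p / 2) + c\<^sub>N * (1 / \<omega>)) * 2"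
                unfolding W inv by (simp add: algebra_simps)
              also have "\<dots> \<le> A\<^sub>w * N powr \<zeta> * (N * N powr (2 * \<delta>) * N powr (- (1 / 2)) + N * (T * \<omega>)) * 2"
              proof (intro mult_right_mono mult_left_mono add_mono)
                have "N powr (1 / 2 + \<delta>) * N powr (\<delta> * p / 2) \<le> N powr (1 / 2 + 2 * \<delta>)"
                  unfolding powr_add[symmetric] using N dp by (intro powr_mono) auto
                then show "N powr (1 / 2 + \<delta>) * N powr (\<delta> * p / 2) \<le> N * N powr (2 * \<delta>) * N powr (- (1 / 2))"
                  unfolding half .
                have "c\<^sub>N * (1 / \<omega>) \<le> N * T * N powr (- (\<delta> * p)) * (1 / \<omega>)" using \<omega> by (intro mult_right_mono cN2) auto
                also have "\<dots> = N * T * (N powr (- (\<delta> * p) + \<delta> * p / 2))"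
                  unfolding inv powr_add by simp
                also have "- (\<delta> * p) + \<delta> * p / 2 = - (\<delta> * p / 2)" by simp
                finally show "c\<^sub>N * (1 / \<omega>) \<le> N * (T * \<omega>)" by (simp add: \<omega>_def)
              qed (use Aw in auto)
              also have "\<dots> = A\<^sub>w * N powr \<zeta> * (N * N powr (2 * \<delta>) * N powr (- (1 / 2))) * 2 + 2 * A\<^sub>w * Y"
                by (simp add: Y_def M2 N1\<zeta> algebra_simps)
              also have "\<dots> \<le> A\<^sub>1 * X + 2 * A\<^sub>w * Y" using main by simp
              finally show ?thesis .
            qed
            ultimately show ?thesis using nonneg unfolding A\<^sub>2_def distrib_right distrib_left by linarith
          qed
          moreover have "?RB \<le> ennreal (4 * Z + 16 * s\<^sup>2 * m)"
            using sep_risk_bayes_rule_le[OF n0 borel_measurable_soft_threshold] soft by (rule order_trans)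
          ultimately show ?thesis using \<omega> nonneg m0 by (intro exI[of _ \<omega>] conjI step) auto
        qed
      qed
      then obtain \<omega> where \<omega>: "\<omega> > 0" and \<omega>le: "ennreal (1 + \<omega>) * sep_risk n \<theta> (bayes_rule n \<theta>) + ennreal (1 + 1 / \<omega>) * ennreal W
         \<le> sep_risk n \<theta> h + ennreal (A\<^sub>1 * X + A\<^sub>2 * Y + 4 * Z)" by blast
      have "level_loss b \<le> ennreal (1 + \<omega>) * sep_risk n \<theta> (bayes_rule n \<theta>)
          + ennreal (1 + 1 / \<omega>) * (\<Sum>k=1..n. \<integral>\<^sup>+ t. ennreal (ratio_loss L (\<theta> k + t)) \<partial>std_normal_distribution)
          + (if pop_kappa n \<theta> \<le> 2 * b then sep_risk n \<theta> (soft_threshold s) else 0) + ennreal (real n * tail_const b)"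
        by (rule level_loss_large[OF b(1) \<omega> L])
      also have "\<dots> \<le> ennreal (1 + \<omega>) * sep_risk n \<theta> (bayes_rule n \<theta>) + ennreal (1 + 1 / \<omega>) * ennreal W
          + ennreal (4 * Z + A\<^sub>S * X) + ennreal (A\<^sub>t * Z)"
        using soft_small by (intro add_mono mult_left_mono rl ennreal_leI tail order_refl) auto
      also have "\<dots> \<le> sep_risk n \<theta> h + ennreal (A\<^sub>1 * X + A\<^sub>2 * Y + 4 * Z) + ennreal (4 * Z + A\<^sub>S * X) + ennreal (A\<^sub>t * Z)"
        by (intro add_mono \<omega>le order_refl)
      also have "\<dots> = sep_risk n \<theta> h + ennreal ((A\<^sub>1 * X + A\<^sub>2 * Y + 4 * Z) + (4 * Z + A\<^sub>S * X) + A\<^sub>t * Z)"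
        using nonneg Apos At by (simp add: add.assoc ennreal_plus[symmetric] del: ennreal_plus)
      also have "\<dots> \<le> sep_risk n \<theta> h + ennreal (A * (X + Y + Z))"
      proof (intro add_left_mono ennreal_leI)
        have "0 \<le> A\<^sub>1 * Y" "0 \<le> A\<^sub>1 * Z" "0 \<le> A\<^sub>2 * X" "0 \<le> A\<^sub>2 * Z" "0 \<le> A\<^sub>S * Y" "0 \<le> A\<^sub>S * Z" "0 \<le> A\<^sub>t * X" "0 \<le> A\<^sub>t * Y"
          using Apos At nonneg by auto
        then show "(A\<^sub>1 * X + A\<^sub>2 * Y + 4 * Z) + (4 * Z + A\<^sub>S * X) + A\<^sub>t * Z \<le> A * (X + Y + Z)"
          unfolding A_def distrib_left distrib_right using nonneg by linarith
      qed
      finally show ?thesis .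
    qed
    then show ?thesis unfolding X_def Y_def Z_def M\<^sub>1_def M\<^sub>2_def N_def \<rho>_def b_def .
  qed
  moreover have "A > 0" unfolding A_def using Apos At by simp
  ultimately show ?thesis by blast
qed

section \<open>Besov balls and summation over levels\<close>

definition level_risk :: "real \<Rightarrow> (coeffs \<Rightarrow> coeffs) \<Rightarrow> coeffs \<Rightarrow> int \<Rightarrow> ennreal" where
  "level_risk \<epsilon> \<delta> \<beta> j = (\<Sum>k=1..level_size j. \<integral>\<^sup>+ z. ennreal ((\<delta> (obs \<epsilon> \<beta> z) (j, k) - \<beta> (j, k))\<^sup>2) \<partial>noise)"

lemma risk_eq: "risk \<epsilon> \<delta> \<beta> = infsum (level_risk \<epsilon> \<delta> \<beta>) {-1..}"
  unfolding risk_def level_risk_def[abs_def] ..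

lemma obs_in_idx: "k \<in> {1..level_size j} \<Longrightarrow> j \<ge> -1 \<Longrightarrow> obs \<epsilon> \<beta> z (j, k) = \<beta> (j, k) + \<epsilon> * z (j, k)"
  by (simp add: obs_def idx_def)

lemma nn_integral_noise_component:
  assumes i: "i \<in> idx" and [measurable]: "f \<in> borel_measurable borel"
  shows "(\<integral>\<^sup>+ z. f (z i) \<partial>noise) = (\<integral>\<^sup>+ t. f t \<partial>std_normal_distribution)"
proof -
  have "(\<integral>\<^sup>+ t. f t \<partial>std_normal_distribution) = (\<integral>\<^sup>+ t. f t \<partial>distr noise std_normal_distribution (\<lambda>z. z i))"
    unfolding noise_def using distr_PiM_component[of idx "\<lambda>_. std_normal_distribution" i] i prob_space_std_normal by simp
  also have "\<dots> = (\<integral>\<^sup>+ z. f (z i) \<partial>noise)"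
    unfolding noise_def using i by (intro nn_integral_distr measurable_component_singleton) auto
  finally show ?thesis ..
qed

lemma level_risk_separable:
  assumes \<epsilon>: "\<epsilon> > 0" and j: "j \<ge> -1" and [measurable]: "h j \<in> borel_measurable borel"
  shows "level_risk \<epsilon> (\<lambda>y (j, k). h j (y (j, k))) \<beta> j
    = ennreal (\<epsilon>\<^sup>2) * sep_risk (level_size j) (\<lambda>k. \<beta> (j, k) / \<epsilon>) (\<lambda>x. h j (\<epsilon> * x) / \<epsilon>)"
  unfolding level_risk_def sep_risk_def sum_distrib_left
proof (rule sum.cong[OF refl])
  fix k assume k: "k \<in> {1..level_size j}"
  have i: "(j, k) \<in> idx" using j k by (simp add: idx_def)
  have "(\<integral>\<^sup>+ z. ennreal (((case (j, k) of (j, k) \<Rightarrow> h j (obs \<epsilon> \<beta> z (j, k))) - \<beta> (j, k))\<^sup>2) \<partial>noise)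
    = (\<integral>\<^sup>+ z. ennreal ((h j (\<beta> (j, k) + \<epsilon> * z (j, k)) - \<beta> (j, k))\<^sup>2) \<partial>noise)"
    by (simp add: obs_in_idx[OF k j])
  also have "\<dots> = (\<integral>\<^sup>+ t. ennreal ((h j (\<beta> (j, k) + \<epsilon> * t) - \<beta> (j, k))\<^sup>2) \<partial>std_normal_distribution)"
    by (rule nn_integral_noise_component[OF i]) measurable
  also have "\<dots> = (\<integral>\<^sup>+ t. ennreal (\<epsilon>\<^sup>2) * ennreal ((h j (\<epsilon> * (\<beta> (j, k) / \<epsilon> + t)) / \<epsilon> - \<beta> (j, k) / \<epsilon>)\<^sup>2) \<partial>std_normal_distribution)"
    using \<epsilon> by (simp add: ennreal_mult[symmetric] distrib_left diff_divide_distrib[symmetric] power_divide)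
  also have "\<dots> = ennreal (\<epsilon>\<^sup>2) * (\<integral>\<^sup>+ t. ennreal ((h j (\<epsilon> * (\<beta> (j, k) / \<epsilon> + t)) / \<epsilon> - \<beta> (j, k) / \<epsilon>)\<^sup>2) \<partial>std_normal_distribution)"
    by (rule nn_integral_cmult) measurable
  finally show "(\<integral>\<^sup>+ z. ennreal (((case (j, k) of (j, k) \<Rightarrow> h j (obs \<epsilon> \<beta> z (j, k))) - \<beta> (j, k))\<^sup>2) \<partial>noise)
    = ennreal (\<epsilon>\<^sup>2) * (\<integral>\<^sup>+ t. ennreal ((h j (\<epsilon> * (\<beta> (j, k) / \<epsilon> + t)) / \<epsilon> - \<beta> (j, k) / \<epsilon>)\<^sup>2) \<partial>std_normal_distribution)" .
qed

lemma level_risk_geb_low: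
  assumes \<epsilon>: "\<epsilon> > 0" and j: "j \<ge> -1" "j < j_star nstar"
  shows "level_risk \<epsilon> (geb nstar \<rho>\<^sub>0 b\<^sub>0 \<eta> \<epsilon>) \<beta> j = ennreal (\<epsilon>\<^sup>2 * real (level_size j))"
proof -
  have "level_risk \<epsilon> (geb nstar \<rho>\<^sub>0 b\<^sub>0 \<eta> \<epsilon>) \<beta> j = (\<Sum>k=1..level_size j. ennreal (\<epsilon>\<^sup>2))"
    unfolding level_risk_def
  proof (rule sum.cong[OF refl])
    fix k assume k: "k \<in> {1..level_size j}"
    have i: "(j, k) \<in> idx" using j k by (simp add: idx_def)
    have "(\<integral>\<^sup>+ z. ennreal ((geb nstar \<rho>\<^sub>0 b\<^sub>0 \<eta> \<epsilon> (obs \<epsilon> \<beta> z) (j, k) - \<beta> (j, k))\<^sup>2) \<partial>noise)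
       = (\<integral>\<^sup>+ z. ennreal ((\<epsilon> * z (j, k))\<^sup>2) \<partial>noise)"
      using j by (simp add: geb_def obs_in_idx[OF k])
    also have "\<dots> = (\<integral>\<^sup>+ t. ennreal (\<epsilon>\<^sup>2 * t\<^sup>2 + 0) \<partial>std_normal_distribution)"
      by (subst nn_integral_noise_component[OF i, of "\<lambda>t. ennreal ((\<epsilon> * t)\<^sup>2)"]) (simp_all add: power_mult_distrib)
    also have "\<dots> = ennreal (\<epsilon>\<^sup>2 + 0)" by (rule nn_integral_std_normal_sq_affine) auto
    finally show "(\<integral>\<^sup>+ z. ennreal ((geb nstar \<rho>\<^sub>0 b\<^sub>0 \<eta> \<epsilon> (obs \<epsilon> \<beta> z) (j, k) - \<beta> (j, k))\<^sup>2) \<partial>noise) = ennreal (\<epsilon>\<^sup>2)" by simp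
  qed
  then show ?thesis by (simp add: ennreal_of_nat_eq_real_of_nat ennreal_mult mult.commute)
qed

lemma level_risk_geb_high:
  assumes \<epsilon>: "\<epsilon> > 0" and m: "int m \<ge> j_star nstar" "m \<ge> 1"
    and pos: "geb_rho \<rho>\<^sub>0 \<eta> (2 ^ m) > 0"
  shows "level_risk \<epsilon> (geb nstar \<rho>\<^sub>0 b\<^sub>0 \<eta> \<epsilon>) \<beta> (int m)
    = ennreal (\<epsilon>\<^sup>2) * level.level_loss (2 ^ m) (\<lambda>k. \<beta> (int m, k) / \<epsilon>) (\<lambda>k. (int m, k)) idx (geb_rho \<rho>\<^sub>0 \<eta> (2 ^ m)) (geb_b b\<^sub>0 (2 ^ m))"
proof -
  define n \<theta> where "n = (2::nat) ^ m" and "\<theta> = (\<lambda>k. \<beta> (int m, k) / \<epsilon>)"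
  have "(2::nat) ^ 1 \<le> 2 ^ m" using m by (intro power_increasing) auto
  then have n2: "n \<ge> 2" by (simp add: n_def)
  have size: "level_size (int m) = n" by (simp add: level_size_def n_def)
  interpret level n \<theta> "\<lambda>k. (int m, k)" idx "geb_rho \<rho>\<^sub>0 \<eta> n"
    by unfold_locales (use n2 pos in \<open>auto simp: inj_on_def idx_def level_size_def n_def\<close>)
  have "level_risk \<epsilon> (geb nstar \<rho>\<^sub>0 b\<^sub>0 \<eta> \<epsilon>) \<beta> (int m) = ennreal (\<epsilon>\<^sup>2) * level_loss (geb_b b\<^sub>0 n)"
    unfolding level_risk_def level_loss_def size sum_distrib_left
  proof (rule sum.cong[OF refl])
    fix k assume k: "k \<in> {1..n}"
    let ?T = "\<lambda>z. geb_rule n (geb_rho \<rho>\<^sub>0 \<eta> n) (geb_b b\<^sub>0 n) (\<lambda>l. \<theta> l + z (int m, l)) (\<theta> k + z (int m, k))"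
    have o: "obs \<epsilon> \<beta> z (int m, l) / \<epsilon> = \<theta> l + z (int m, l)" if "l \<in> {1..n}" for l z
      using that \<epsilon> obs_in_idx[of l "int m"] by (simp add: size \<theta>_def add_divide_distrib)
    have "geb nstar \<rho>\<^sub>0 b\<^sub>0 \<eta> \<epsilon> (obs \<epsilon> \<beta> z) (int m, k) - \<beta> (int m, k) = \<epsilon> * (?T z - \<theta> k)" for z
    proof -
      have "geb nstar \<rho>\<^sub>0 b\<^sub>0 \<eta> \<epsilon> (obs \<epsilon> \<beta> z) (int m, k)
        = \<epsilon> * geb_rule n (geb_rho \<rho>\<^sub>0 \<eta> n) (geb_b b\<^sub>0 n) (\<lambda>l. obs \<epsilon> \<beta> z (int m, l) / \<epsilon>) (\<theta> k + z (int m, k))"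
        using m by (simp add: geb_def t_hat_eq_geb_rule n_def[symmetric] o[OF k])
      also have "geb_rule n (geb_rho \<rho>\<^sub>0 \<eta> n) (geb_b b\<^sub>0 n) (\<lambda>l. obs \<epsilon> \<beta> z (int m, l) / \<epsilon>) (\<theta> k + z (int m, k)) = ?T z"
        by (rule geb_rule_cong) (rule o)
      finally show ?thesis using \<epsilon> by (simp add: \<theta>_def right_diff_distrib)
    qed
    then have "(\<integral>\<^sup>+ z. ennreal ((geb nstar \<rho>\<^sub>0 b\<^sub>0 \<eta> \<epsilon> (obs \<epsilon> \<beta> z) (int m, k) - \<beta> (int m, k))\<^sup>2) \<partial>noise)
       = (\<integral>\<^sup>+ z. ennreal (\<epsilon>\<^sup>2) * ennreal ((?T z - \<theta> k)\<^sup>2) \<partial>noise)"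
      by (simp add: power_mult_distrib ennreal_mult)
    also have "\<dots> = ennreal (\<epsilon>\<^sup>2) * (\<integral>\<^sup>+ z. ennreal ((?T z - \<theta> k)\<^sup>2) \<partial>noise)"
    proof (rule nn_integral_cmult)
      have [measurable]: "?T \<in> borel_measurable noise"
        unfolding noise_def by (rule borel_measurable_geb_obs[OF k])
      show "(\<lambda>z. ennreal ((?T z - \<theta> k)\<^sup>2)) \<in> borel_measurable noise" by measurable
    qed
    finally show "(\<integral>\<^sup>+ z. ennreal ((geb nstar \<rho>\<^sub>0 b\<^sub>0 \<eta> \<epsilon> (obs \<epsilon> \<beta> z) (int m, k) - \<beta> (int m, k))\<^sup>2) \<partial>noise)
       = ennreal (\<epsilon>\<^sup>2) * (\<integral>\<^sup>+ z. ennreal ((?T z - \<theta> k)\<^sup>2) \<partial>PiM idx (\<lambda>_. std_normal_distribution))"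
      unfolding noise_def .
  qed
  then show ?thesis unfolding n_def \<theta>_def .
qed

text \<open>The greatest element exists because the predicate says that j is at most the floor of
  log 2 nstar. Level sizes from \<open>j_star\<close> on are therefore at least 2, and
  \<open>univ_thr\<close> is at least 1 there.\<close>

lemma j_star_ge_1:
  assumes "nstar > 2"
  shows "j_star nstar \<ge> 1"
proof -
  have iff: "2 powr real_of_int j \<le> nstar \<longleftrightarrow> j \<le> \<lfloor>log 2 nstar\<rfloor>" for j
    using assms by (simp add: le_floor_iff le_log_iff)
  have "j_star nstar = \<lfloor>log 2 nstar\<rfloor>"
    unfolding j_star_def iff by (rule Greatest_equality) auto
  moreover have "1 \<le> \<lfloor>log 2 nstar\<rfloor>" using iff[of 1] assms by simp
  ultimately show ?thesis by simp
qed

text \<open>Shifting by one turns the levels from -1 on into a sequence, so that a real summable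
  majorant over the naturals bounds the extended sum over integers.\<close>

lemma infsum_int_le_add_suminf:
  fixes f g :: "int \<Rightarrow> ennreal" and e :: "nat \<Rightarrow> real"
  assumes le: "\<And>j. j \<ge> -1 \<Longrightarrow> f j \<le> g j + ennreal (e (nat (j + 1)))"
    and e: "\<And>i. e i \<ge> 0" "summable e"
  shows "infsum f {-1..} \<le> infsum g {-1..} + ennreal (suminf e)"
proof -
  have sm: "F summable_on A" for F :: "int \<Rightarrow> ennreal" and A by (rule nonneg_summable_on_complete) simp
  have "infsum f {-1..} \<le> infsum (\<lambda>j. g j + ennreal (e (nat (j + 1)))) {-1..}"
    by (intro infsum_mono sm le) simp
  also have "\<dots> = infsum g {-1..} + infsum (\<lambda>j. ennreal (e (nat (j + 1)))) {-1..}"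
    by (intro infsum_add sm)
  also have "infsum (\<lambda>j. ennreal (e (nat (j + 1)))) {-1..} \<le> ennreal (suminf e)"
  proof (subst nonneg_infsum_complete)
    show "(SUP F\<in>{F. finite F \<and> F \<subseteq> {-1..}}. \<Sum>j\<in>F. ennreal (e (nat (j + 1)))) \<le> ennreal (suminf e)"
    proof (rule SUP_least)
      fix F :: "int set" assume F: "F \<in> {F. finite F \<and> F \<subseteq> {-1..}}"
      have inj: "inj_on (\<lambda>j. nat (j + 1)) F"
      proof (rule inj_onI)
        fix x y assume "x \<in> F" "y \<in> F" "nat (x + 1) = nat (y + 1)"
        moreover have "x \<ge> -1" "y \<ge> -1" using F \<open>x \<in> F\<close> \<open>y \<in> F\<close> by auto
        ultimately show "x = y" by linarith
      qed
      have "(\<Sum>j\<in>F. ennreal (e (nat (j + 1)))) = ennreal (\<Sum>i\<in>(\<lambda>j. nat (j + 1)) ` F. e i)"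
        using e by (simp add: sum.reindex[OF inj] sum_ennreal)
      also have "\<dots> \<le> ennreal (suminf e)"
        using F e by (intro ennreal_leI sum_le_suminf) auto
      finally show "(\<Sum>j\<in>F. ennreal (e (nat (j + 1)))) \<le> ennreal (suminf e)" .
    qed
  qed simp
  finally show ?thesis by (simp add: add_left_mono)
qed

text \<open>An l^q norm dominates each of its terms. The rate does not depend on q, and this bound,
  uniform in the level, is all that is taken from the ball.\<close>

lemma besov_ball_level_norm_le:
  assumes \<beta>: "\<beta> \<in> besov_ball \<alpha> p q C" and q: "q > 0" and C: "C > 0"
  shows "weighted_level_norm \<alpha> p j \<beta> \<le> C"
proof -
  let ?w = "\<lambda>j. weighted_level_norm \<alpha> p j \<beta>"
  have w0: "?w j \<ge> 0"
  proof -
    have "\<bar>\<beta> (int j, 1)\<bar> \<le> Max ((\<lambda>k. \<bar>\<beta> (int j, k)\<bar>) ` {1..2 ^ j})" by (intro Max_ge) auto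
    then have "0 \<le> Max ((\<lambda>k. \<bar>\<beta> (int j, k)\<bar>) ` {1..2 ^ j})" using abs_ge_zero order_trans by blast
    then have "0 \<le> level_norm p j \<beta>"
      by (cases "p = \<infinity>") (simp_all only: level_norm_def if_True if_False powr_ge_zero simp_thms)
    then show ?thesis unfolding weighted_level_norm_def by simp
  qed
  have norm: "besov_norm \<alpha> p q \<beta> \<le> ennreal C" using \<beta> by (simp add: besov_ball_def)
  show ?thesis
  proof (cases "q = \<infinity>")
    case True
    have "ennreal (?w j) \<le> (SUP j. ennreal (?w j))" by (rule SUP_upper) simp
    also have "\<dots> \<le> ennreal C" using norm True by (simp add: besov_norm_def)
    finally show ?thesis using C by (simp add: ennreal_le_iff)
  next
    case False
    define r where "r = enn2real q"
    have r: "r > 0" unfolding r_def using q False by (simp add: enn2real_positive_iff top.not_eq_extremum)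
    define X where "X = ennreal (\<bar>\<beta> (-1, 1)\<bar> powr r) + (\<Sum>j. ennreal (?w j powr r))"
    have X: "ennpowr X (1 / r) \<le> ennreal C" using norm False by (simp add: besov_norm_def X_def r_def)
    then have Xfin: "X \<noteq> \<infinity>" by (auto simp: ennpowr_def top_unique)
    have "ennreal (?w j powr r) \<le> (\<Sum>j. ennreal (?w j powr r))"
    proof -
      have "(\<Sum>j\<in>{j}. ennreal (?w j powr r)) \<le> (\<Sum>j. ennreal (?w j powr r))"
        by (rule sum_le_suminf[OF summableI]) auto
      then show ?thesis by simp
    qed
    also have "\<dots> \<le> X" unfolding X_def by simp
    finally have "?w j powr r \<le> enn2real X"
      using Xfin by (cases X) (auto simp: ennreal_le_iff)
    then have "(?w j powr r) powr (1 / r) \<le> enn2real X powr (1 / r)" using r by (intro powr_mono2) auto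
    also have "\<dots> \<le> C" using X Xfin C by (simp add: ennpowr_def ennreal_le_iff)
    finally show ?thesis using w0 r by (simp add: powr_powr)
  qed
qed

text \<open>Young's inequality with weights 2 / r and 1 - 2 / r. Summed over normalized coefficients
  it plays the part of the power mean inequality.\<close>

lemma powr_le_weighted_powr:
  fixes y r :: real
  assumes "y \<ge> 0" "r \<ge> 2"
  shows "y powr 2 \<le> 2 / r * y powr r + (1 - 2 / r)"
proof (cases "y = 0")
  case False
  have "(y powr r) powr (2 / r) * 1 powr (1 - 2 / r) \<le> 2 / r * y powr r + (1 - 2 / r) * 1"
    by (rule Youngs_inequality_0) (use assms False in auto)
  then show ?thesis using assms False by (simp add: powr_powr)
qed (use assms in simp)

text \<open>Exponents above 2 are lowered to 2, the range in which \<open>abs_powr_bounds\<close>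
  applies. After division by \<open>D\<close> the P-th powers average to at most 1, and the two
  weights of \<open>powr_le_weighted_powr\<close> add up to 1, so that no constant is lost.\<close>

lemma besov_ball_level_moment:
  assumes \<beta>: "\<beta> \<in> besov_ball \<alpha> p q C" and q: "q > 0" and C: "C > 0" and p: "p > 0"
  defines "r \<equiv> (if p = \<infinity> then 2 else min 2 (enn2real p))"
  shows "(\<Sum>k=1..2 ^ m. \<bar>\<beta> (int m, k)\<bar> powr r) \<le> 2 ^ m * (C * 2 powr (- (real m * (\<alpha> + 1 / 2)))) powr r"
proof -
  define D where "D = C * 2 powr (- (real m * (\<alpha> + 1 / 2)))"
  have D: "D > 0" using C by (simp add: D_def)
  have le: "2 powr (real m * (\<alpha> + 1 / 2 - enn2real (1 / p))) * level_norm p m \<beta> \<le> C"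
    using besov_ball_level_norm_le[OF \<beta> q C, of m] by (simp add: weighted_level_norm_def)
  have norm: "level_norm p m \<beta> \<le> D * 2 powr (real m * enn2real (1 / p))"
  proof -
    have "2 powr (real m * (\<alpha> + 1 / 2 - enn2real (1 / p))) > 0" by simp
    then have "level_norm p m \<beta> \<le> C / 2 powr (real m * (\<alpha> + 1 / 2 - enn2real (1 / p)))"
      using le by (simp add: pos_le_divide_eq mult.commute)
    also have "\<dots> = C * 2 powr (- (real m * (\<alpha> + 1 / 2 - enn2real (1 / p))))"
      by (simp only: powr_minus_divide times_divide_eq_right mult_1_right)
    also have "- (real m * (\<alpha> + 1 / 2 - enn2real (1 / p))) = - (real m * (\<alpha> + 1 / 2)) + real m * enn2real (1 / p)"
      by (simp add: algebra_simps)
    finally show ?thesis unfolding D_def mult.assoc powr_add[symmetric] .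
  qed
  show ?thesis
  proof (cases "p = \<infinity>")
    case True
    have "\<bar>\<beta> (int m, k)\<bar> \<le> D" if "k \<in> {1..2 ^ m}" for k
    proof -
      have "\<bar>\<beta> (int m, k)\<bar> \<le> level_norm p m \<beta>"
        unfolding level_norm_def using True that by (auto intro!: Max_ge)
      then show ?thesis using norm True by simp
    qed
    then have "(\<Sum>k=1..2 ^ m. \<bar>\<beta> (int m, k)\<bar> powr r) \<le> (\<Sum>k=1..(2 :: nat) ^ m. D powr r)"
      by (intro sum_mono powr_mono2) (auto simp: r_def True)
    then show ?thesis by (simp add: D_def)
  next
    case False
    define P where "P = enn2real p"
    have P: "P > 0" unfolding P_def using p False by (simp add: enn2real_positive_iff top.not_eq_extremum)
    have inv: "enn2real (1 / p) = 1 / P"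
    proof -
      have "p = ennreal P" unfolding P_def using False by (simp add: ennreal_enn2real_if)
      then have "1 / p = ennreal (1 / P)" using P divide_ennreal[of 1 P] by simp
      then show ?thesis using P by simp
    qed
    define S where "S = (\<Sum>k=1..2 ^ m. \<bar>\<beta> (int m, k)\<bar> powr P)"
    have S0: "S \<ge> 0" unfolding S_def by (intro sum_nonneg) auto
    have "S powr (1 / P) \<le> D * 2 powr (real m / P)"
      using norm False unfolding inv by (simp add: level_norm_def S_def P_def)
    then have "(S powr (1 / P)) powr P \<le> (D * 2 powr (real m / P)) powr P"
      using P by (intro powr_mono2) auto
    then have S: "S \<le> 2 ^ m * D powr P"
    proof -
      have "(S powr (1 / P)) powr P = S" using S0 P by (simp add: powr_powr)
      moreover have "(D * 2 powr (real m / P)) powr P = D powr P * 2 powr (real m)"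
        using P by (simp add: powr_mult powr_powr)
      moreover have "2 powr (real m) = (2 :: real) ^ m" by (rule powr_realpow) simp
      ultimately show ?thesis using \<open>(S powr (1 / P)) powr P \<le> _\<close> by (simp only: mult.commute[of "2 ^ m"])
    qed
    show ?thesis
    proof (cases "P \<le> 2")
      case True
      then have "r = P" using False by (simp add: r_def P_def min_def)
      then show ?thesis using S by (simp add: S_def D_def)
    next
      case P2: False
      then have r: "r = 2" using False by (simp add: r_def P_def min_def)
      have "(\<Sum>k=1..2 ^ m. \<bar>\<beta> (int m, k)\<bar> powr r) = (\<Sum>k=1..2 ^ m. D powr 2 * (\<bar>\<beta> (int m, k)\<bar> / D) powr 2)"
      proof (intro sum.cong refl)
        fix k
        have "(\<bar>\<beta> (int m, k)\<bar> / D) powr 2 = \<bar>\<beta> (int m, k)\<bar> powr 2 / D powr 2"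
          by (rule powr_divide)
        then show "\<bar>\<beta> (int m, k)\<bar> powr r = D powr 2 * (\<bar>\<beta> (int m, k)\<bar> / D) powr 2"
          using D unfolding r by simp
      qed
      also have "\<dots> \<le> (\<Sum>k=1..2 ^ m. D powr 2 * (2 / P * (\<bar>\<beta> (int m, k)\<bar> / D) powr P + (1 - 2 / P)))"
        using P2 D by (intro sum_mono mult_left_mono powr_le_weighted_powr) auto
      also have "\<dots> = D powr 2 * (2 / P * (S / D powr P) + 2 ^ m * (1 - 2 / P))"
      proof -
        have "(\<Sum>k=1..2 ^ m. (\<bar>\<beta> (int m, k)\<bar> / D) powr P) = S / D powr P"
          unfolding S_def sum_divide_distrib by (intro sum.cong refl powr_divide)
        then show ?thesis
          unfolding sum_distrib_left[symmetric] sum.distrib by simp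
      qed
      also have "\<dots> \<le> D powr 2 * (2 / P * 2 ^ m + 2 ^ m * (1 - 2 / P))"
      proof (intro mult_left_mono add_right_mono)
        show "S / D powr P \<le> 2 ^ m" using S D by (simp add: pos_divide_le_eq)
      qed (use P in auto)
      also have "2 / P * 2 ^ m + 2 ^ m * (1 - 2 / P) = 2 ^ m" by (simp add: right_diff_distrib)
      also have "D powr 2 * 2 ^ m = 2 ^ m * D powr r" unfolding r by (rule mult.commute)
      finally show ?thesis unfolding D_def .
    qed
  qed
qed

lemma min_le_powr_mult:
  fixes a b \<tau> :: real
  assumes "a > 0" "b > 0" "0 \<le> \<tau>" "\<tau> \<le> 1"
  shows "min a b \<le> a powr (1 - \<tau>) * b powr \<tau>"
proof -
  define m where "m = min a b"
  have m: "m > 0" "m \<le> a" "m \<le> b" using assms by (auto simp: m_def)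
  have "m = m powr (1 - \<tau>) * m powr \<tau>" using m by (simp flip: powr_add)
  also have "\<dots> \<le> a powr (1 - \<tau>) * b powr \<tau>"
    using m assms by (intro mult_mono powr_mono2) auto
  finally show ?thesis unfolding m_def .
qed

text \<open>\<open>\<tau>\<close> makes T^\<tau> proportional to (N / n)^(1 - \<gamma>); both minima
  are bounded by geometric means, and only powers of n remain to be compared. With G = c / (1 + c)
  <= 1 - \<tau>, the first bound needs 3 \<gamma> + 2 \<delta> <= G / 2, where 3 \<gamma> and 2
  \<delta> may take G / 4 each. The second needs 3 \<gamma> <= d \<tau>, which follows from 6
  \<gamma> <= d / (1 + c) and \<gamma> <= 1 / 2. The factor n^(- \<gamma>) makes the sum over dyadic
  levels geometric.\<close>

lemma level_excess_interpolation:
  fixes n T C N :: real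
  assumes n: "n \<ge> 1" and N: "N > 0" and C: "C > 0" and c: "c > 0"
    and \<gamma>: "0 < \<gamma>" "\<gamma> \<le> 1 / 2" "6 * \<gamma> \<le> c / (2 * (1 + c))" "6 * \<gamma> \<le> d / (1 + c)"
    and \<delta>: "4 * \<delta> = c / (2 * (1 + c))"
    and T: "T = C * (N / n) powr (1 + c)"
  defines "\<tau> \<equiv> (1 - \<gamma>) / (1 + c)"
  shows "n powr (1 + \<gamma>) * (n powr (2 * \<delta>) * min (n powr (- (1 / 2))) T) \<le> C powr \<tau> * (N powr (1 - \<gamma>) * n powr (- \<gamma>))"
    and "n powr (1 + \<gamma>) * min 1 (T * n powr (- d)) \<le> C powr \<tau> * (N powr (1 - \<gamma>) * n powr (- \<gamma>))"
proof -
  have \<tau>: "0 < \<tau>" "\<tau> \<le> 1" "(1 + c) * \<tau> = 1 - \<gamma>" using c \<gamma> by (auto simp: \<tau>_def)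
  have T0: "T > 0" using T C N n by simp
  have T\<tau>: "T powr \<tau> = C powr \<tau> * (N powr (1 - \<gamma>) * n powr (- (1 - \<gamma>)))"
  proof -
    have "T powr \<tau> = C powr \<tau> * (N / n) powr ((1 + c) * \<tau>)"
      unfolding T using C by (simp only: powr_mult powr_powr)
    also have "(N / n) powr ((1 + c) * \<tau>) = N powr (1 - \<gamma>) * n powr (- (1 - \<gamma>))"
      unfolding \<tau>(3) powr_divide powr_minus_divide by simp
    finally show ?thesis .
  qed
  have one_tau: "1 - \<tau> \<ge> c / (1 + c)"
    using c \<gamma> by (simp add: \<tau>_def field_simps)
  show "n powr (1 + \<gamma>) * (n powr (2 * \<delta>) * min (n powr (- (1 / 2))) T) \<le> C powr \<tau> * (N powr (1 - \<gamma>) * n powr (- \<gamma>))"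
  proof -
    have "min (n powr (- (1 / 2))) T \<le> (n powr (- (1 / 2))) powr (1 - \<tau>) * T powr \<tau>"
      using n T0 \<tau> by (intro min_le_powr_mult) auto
    then have "n powr (1 + \<gamma>) * (n powr (2 * \<delta>) * min (n powr (- (1 / 2))) T)
       \<le> n powr (1 + \<gamma>) * (n powr (2 * \<delta>) * ((n powr (- (1 / 2))) powr (1 - \<tau>) * T powr \<tau>))"
      by (intro mult_left_mono) auto
    also have "\<dots> = C powr \<tau> * (N powr (1 - \<gamma>) * (n powr (1 + \<gamma>) * n powr (2 * \<delta>) * n powr (- (1 / 2) * (1 - \<tau>)) * n powr (- (1 - \<gamma>))))"
      unfolding T\<tau> powr_powr by (simp only: mult_ac)
    also have "n powr (1 + \<gamma>) * n powr (2 * \<delta>) * n powr (- (1 / 2) * (1 - \<tau>)) * n powr (- (1 - \<gamma>))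
       = n powr (1 + \<gamma> + 2 * \<delta> + - (1 / 2) * (1 - \<tau>) + - (1 - \<gamma>))"
      by (simp only: powr_add)
    also have "C powr \<tau> * (N powr (1 - \<gamma>) * n powr (1 + \<gamma> + 2 * \<delta> + - (1 / 2) * (1 - \<tau>) + - (1 - \<gamma>)))
       \<le> C powr \<tau> * (N powr (1 - \<gamma>) * n powr (- \<gamma>))"
    proof (intro mult_left_mono powr_mono)
      define G where "G = c / (1 + c)"
      have g: "c / (2 * (1 + c)) = G / 2" by (simp add: G_def)
      show "1 + \<gamma> + 2 * \<delta> + - (1 / 2) * (1 - \<tau>) + - (1 - \<gamma>) \<le> - \<gamma>"
        using one_tau[folded G_def] \<gamma>(3)[unfolded g] \<delta>[unfolded g] by (simp add: right_diff_distrib)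
    qed (use n in auto)
    finally show ?thesis .
  qed
  show "n powr (1 + \<gamma>) * min 1 (T * n powr (- d)) \<le> C powr \<tau> * (N powr (1 - \<gamma>) * n powr (- \<gamma>))"
  proof -
    have "min 1 (T * n powr (- d)) \<le> 1 powr (1 - \<tau>) * (T * n powr (- d)) powr \<tau>"
      using n T0 \<tau> by (intro min_le_powr_mult) auto
    also have "\<dots> = T powr \<tau> * n powr (- d * \<tau>)"
      by (simp only: powr_mult powr_powr powr_one_eq_one mult_1)
    finally have "n powr (1 + \<gamma>) * min 1 (T * n powr (- d)) \<le> n powr (1 + \<gamma>) * (T powr \<tau> * n powr (- d * \<tau>))"
      by (intro mult_left_mono) auto
    also have "\<dots> = C powr \<tau> * (N powr (1 - \<gamma>) * (n powr (1 + \<gamma>) * n powr (- d * \<tau>) * n powr (- (1 - \<gamma>))))"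
      unfolding T\<tau> by (simp only: mult_ac)
    also have "n powr (1 + \<gamma>) * n powr (- d * \<tau>) * n powr (- (1 - \<gamma>)) = n powr (1 + \<gamma> + - d * \<tau> + - (1 - \<gamma>))"
      by (simp only: powr_add)
    also have "C powr \<tau> * (N powr (1 - \<gamma>) * n powr (1 + \<gamma> + - d * \<tau> + - (1 - \<gamma>))) \<le> C powr \<tau> * (N powr (1 - \<gamma>) * n powr (- \<gamma>))"
    proof (intro mult_left_mono powr_mono)
      have "6 * \<gamma> * (1 - \<gamma>) \<le> d / (1 + c) * (1 - \<gamma>)" using \<gamma> by (intro mult_right_mono) auto
      also have "\<dots> = d * \<tau>" by (simp add: \<tau>_def)
      finally have "6 * \<gamma> * (1 - \<gamma>) \<le> d * \<tau>" .
      moreover have "6 * \<gamma> * (1 / 2) \<le> 6 * \<gamma> * (1 - \<gamma>)" using \<gamma> by (intro mult_left_mono) auto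
      ultimately show "1 + \<gamma> + - d * \<tau> + - (1 - \<gamma>) \<le> - \<gamma>" by simp
    qed (use n in auto)
    finally show ?thesis .
  qed
qed

text \<open>2 ln (2^m) >= m because ln 2 >= 2/3, and m + 2 <= 3 m rewrites the bound in terms of the
  shifted level index m + 1. The exponent 3/2 exceeds 1, so these remainders are summable.\<close>

lemma univ_thr_cube_ge:
  assumes "m \<ge> 1"
  shows "1 / univ_thr (2 ^ m) ^ 3 \<le> 3 powr (3 / 2) * (1 + real (m + 1)) powr (- (3 / 2))"
proof -
  have "real m \<le> 2 * ln (real (2 ^ m))"
    using ln2_ge_two_thirds assms by (simp add: ln_realpow)
  then have s: "sqrt (real m) \<le> univ_thr (2 ^ m)" unfolding univ_thr_def by (rule real_sqrt_le_mono)
  have sq: "sqrt (real m) ^ 3 = real m powr (3 / 2)"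
  proof -
    have "sqrt (real m) ^ 3 = (real m powr (1 / 2)) powr (real 3)"
      using assms by (subst powr_realpow) (auto simp: powr_half_sqrt)
    then show ?thesis by (simp add: powr_powr)
  qed
  have "real m powr (3 / 2) \<le> univ_thr (2 ^ m) ^ 3"
    unfolding sq[symmetric] by (intro power_mono s) auto
  then have "1 / univ_thr (2 ^ m) ^ 3 \<le> 1 / real m powr (3 / 2)"
  proof (rule divide_left_mono)
    have "0 < sqrt (real m)" using assms by simp
    with s have "0 < univ_thr (2 ^ m)" by linarith
    then show "0 < univ_thr (2 ^ m) ^ 3 * real m powr (3 / 2)" using assms by simp
  qed auto
  also have "\<dots> \<le> 1 / (((1 + real (m + 1)) / 3) powr (3 / 2))"
    using assms by (intro divide_left_mono powr_mono2) auto
  also have "\<dots> = 3 powr (3 / 2) * (1 + real (m + 1)) powr (- (3 / 2))"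
    by (simp only: powr_divide powr_minus_divide) simp
  finally show ?thesis .
qed

text \<open>A bound for every \<epsilon> > 0, uniform over the ball. The first power of \<epsilon>
  in the error comes from the geometric sum over levels, the second from the summable remainders,
  which total a constant times \<epsilon>^2.\<close>

theorem geb_ideal_adaptivity:
  assumes nstar: "nstar > 2" and \<rho>\<^sub>0: "\<rho>\<^sub>0 > 0" and b\<^sub>0: "b\<^sub>0 > 0" and \<eta>: "\<eta> \<longlonglongrightarrow> 0"
    and pos: "\<And>n. n \<ge> 2 \<Longrightarrow> geb_rho \<rho>\<^sub>0 \<eta> n > 0"
    and \<alpha>: "\<alpha> > 0" and p: "p > ennreal (1 / (\<alpha> + 1 / 2))" and q: "q > 0" and C: "C > 0"
  shows "\<exists>A \<kappa>. A > 0 \<and> \<kappa> > 0 \<and> (\<forall>\<epsilon> \<beta>. \<epsilon> > 0 \<longrightarrow> \<beta> \<in> besov_ball \<alpha> p q C \<longrightarrow>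
     risk \<epsilon> (geb nstar \<rho>\<^sub>0 b\<^sub>0 \<eta> \<epsilon>) \<beta> \<le> ideal_risk \<epsilon> \<beta>
       + ennreal (A * (\<epsilon> powr \<kappa> + \<epsilon> powr (1 / (\<alpha> + 1 / 2))) * \<epsilon> powr (2 * \<alpha> / (\<alpha> + 1 / 2))))"
proof -
  define a where "a = \<alpha> + 1 / 2"
  have a: "a > 1 / 2" "a > 0" using \<alpha> by (auto simp: a_def)
  define r where "r = (if p = \<infinity> then 2 else min 2 (enn2real p))"
  have "0 < 1 / a" using a by simp
  then have p0: "p > 0" using p unfolding a_def[symmetric] by (metis ennreal_less_zero_iff less_trans)
  have r: "0 < r" "r \<le> 2" "1 / a < r"
  proof -
    have *: "1 / a < 2" using a by (simp add: pos_divide_less_eq)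
    have "1 / a < r"
    proof (cases "p = \<infinity>")
      case False
      then have "p = ennreal (enn2real p)" by (simp add: ennreal_enn2real_if)
      then have "1 / a < enn2real p"
        using p \<open>0 < 1 / a\<close> unfolding a_def[symmetric] by (metis ennreal_less_iff less_imp_le)
      then show ?thesis using * False by (simp add: r_def)
    qed (use * in \<open>simp add: r_def\<close>)
    then show "1 / a < r" .
    with \<open>0 < 1 / a\<close> show "0 < r" by (rule less_trans)
    show "r \<le> 2" by (simp add: r_def)
  qed
  \<comment> \<open>Positivity of \<open>c\<close> says r > 1 / a: the hypothesis on
    \<open>p\<close>, or a > 1 / 2 when r = 2.\<close>
  define c where "c = a * r - 1"
  have c: "c > 0" using r a by (simp add: c_def field_simps)
  define \<delta> where "\<delta> = c / (2 * (1 + c)) / 4"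
  define d where "d = \<delta> * r / 2"
  define \<gamma> where "\<gamma> = min (1 / 2) (min (c / (2 * (1 + c)) / 6) (d / (1 + c) / 6))"
  have \<delta>: "\<delta> > 0" "4 * \<delta> = c / (2 * (1 + c))" 
  proof -
    show "\<delta> > 0" using c by (simp add: \<delta>_def)
    have "4 * (X / 4) = X" for X :: real by simp
    then show "4 * \<delta> = c / (2 * (1 + c))" unfolding \<delta>_def .
  qed
  have d: "d > 0" using \<delta> r by (simp add: d_def)
  have \<gamma>: "0 < \<gamma>" "\<gamma> \<le> 1 / 2" "6 * \<gamma> \<le> c / (2 * (1 + c))" "6 * \<gamma> \<le> d / (1 + c)"
  proof -
    have gen: "0 < min (1 / 2) (min (X / 6) (Y / 6)) \<and> min (1 / 2) (min (X / 6) (Y / 6)) \<le> 1 / 2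
      \<and> 6 * min (1 / 2) (min (X / 6) (Y / 6)) \<le> X \<and> 6 * min (1 / 2) (min (X / 6) (Y / 6)) \<le> Y"
      if "X > 0" "Y > 0" for X Y :: real
      using that by (auto simp: min_def)
    have "c / (2 * (1 + c)) > 0" "d / (1 + c) > 0" using c d by auto
    from gen[OF this] show "0 < \<gamma>" "\<gamma> \<le> 1 / 2" "6 * \<gamma> \<le> c / (2 * (1 + c))" "6 * \<gamma> \<le> d / (1 + c)"
      unfolding \<gamma>_def by blast+
  qed
  have pos': "\<forall>n\<ge>2. geb_rho \<rho>\<^sub>0 \<eta> n > 0" using pos by blast
  obtain A\<^sub>1 where A1: "A\<^sub>1 > 0" and A1_all: "\<forall>n \<theta>. \<forall>\<iota> :: nat \<Rightarrow> int \<times> nat. \<forall>I T h. n \<ge> 2 \<longrightarrow> inj_on \<iota> {1..n} \<longrightarrow> \<iota> ` {1..n} \<subseteq> I \<longrightarrow> h \<in> borel_measurable borel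
     \<longrightarrow> (\<Sum>k=1..n. \<bar>\<theta> k\<bar> powr r) \<le> real n * T \<longrightarrow>
     level.level_loss n \<theta> \<iota> I (geb_rho \<rho>\<^sub>0 \<eta> n) (geb_b b\<^sub>0 n) \<le> sep_risk n \<theta> h
       + ennreal (A\<^sub>1 * (real n powr (1 + \<gamma>) * (real n powr (2 * \<delta>) * min (real n powr (- (1 / 2))) T)
            + real n powr (1 + \<gamma>) * min 1 (T * real n powr (- (\<delta> * r / 2))) + 1 / univ_thr n ^ 3))"
    using level_ideal_inequality[OF \<rho>\<^sub>0 b\<^sub>0 \<eta> pos' r(1,2) \<delta>(1) \<gamma>(1), where 'i="int \<times> nat"] by (elim exE conjE) (rule that)
  define \<tau> where "\<tau> = (1 - \<gamma>) / (1 + c)"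
  define C' where "C' = (C powr r) powr \<tau>"
  define J where "J = nat (j_star nstar)"
  have J: "j_star nstar \<ge> 1" by (rule j_star_ge_1[OF nstar])
  define K\<^sub>1 where "K\<^sub>1 = 2 * A\<^sub>1 * C' * 2 powr \<gamma>"
  define K\<^sub>2 where "K\<^sub>2 = A\<^sub>1 * 3 powr (3 / 2) + 2 ^ J * (1 + real J) powr (3 / 2)"
  have K: "K\<^sub>1 \<ge> 0" "K\<^sub>2 \<ge> 0" using A1 by (auto simp: K\<^sub>1_def K\<^sub>2_def C'_def)
  define x :: real where "x = 2 powr (- \<gamma>)"
  have x: "0 < x" "x < 1" using \<gamma>(1) powr_less_mono[of "- \<gamma>" 0 2] by (auto simp: x_def)
  have geo: "summable (\<lambda>i. x ^ i)" using x by (intro summable_geometric) auto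
  have pw: "summable (\<lambda>i. (1 + real i) powr (- (3 / 2)))"
  proof -
    have "summable (\<lambda>i. real i powr (- (3 / 2)))" by (simp add: summable_real_powr_iff)
    then have "summable (\<lambda>i. real (Suc i) powr (- (3 / 2)))" using summable_Suc_iff[of "\<lambda>i. real i powr (- (3 / 2))"] by blast
    then show ?thesis by (simp add: add.commute)
  qed
  define S\<^sub>1 S\<^sub>2 where "S\<^sub>1 = (\<Sum>i. x ^ i)" and "S\<^sub>2 = (\<Sum>i. (1 + real i) powr (- (3 / 2)))"
  have S: "S\<^sub>1 \<ge> 0" "S\<^sub>2 \<ge> 0" unfolding S\<^sub>1_def S\<^sub>2_def using x by (auto intro!: suminf_nonneg geo pw)
  define A where "A = K\<^sub>1 * S\<^sub>1 + K\<^sub>2 * S\<^sub>2 + 1"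
  have A: "A > 0" unfolding A_def using K S by (simp add: add_nonneg_pos)
  have main: "risk \<epsilon> (geb nstar \<rho>\<^sub>0 b\<^sub>0 \<eta> \<epsilon>) \<beta> \<le> ideal_risk \<epsilon> \<beta>
       + ennreal (A * (\<epsilon> powr (\<gamma> / a) + \<epsilon> powr (1 / a)) * \<epsilon> powr (2 * \<alpha> / a))"
    if \<epsilon>: "\<epsilon> > 0" and \<beta>: "\<beta> \<in> besov_ball \<alpha> p q C" for \<epsilon> \<beta>
  proof -
    define N where "N = \<epsilon> powr (- (1 / a))"
    have N: "N > 0" using \<epsilon> by (simp add: N_def)
    define e where "e i = \<epsilon>\<^sup>2 * (K\<^sub>1 * N powr (1 - \<gamma>) * x ^ i + K\<^sub>2 * (1 + real i) powr (- (3 / 2)))" for i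
    have e0: "e i \<ge> 0" for i unfolding e_def using K x by (intro mult_nonneg_nonneg add_nonneg_nonneg) auto
    have sum_e: "summable e" unfolding e_def by (intro summable_mult summable_add geo pw)
    have suminf_e: "suminf e = \<epsilon>\<^sup>2 * (K\<^sub>1 * N powr (1 - \<gamma>) * S\<^sub>1 + K\<^sub>2 * S\<^sub>2)"
      unfolding e_def S\<^sub>1_def S\<^sub>2_def
      by (simp only: suminf_mult suminf_add[symmetric] summable_mult summable_add geo pw)
    have "risk \<epsilon> (geb nstar \<rho>\<^sub>0 b\<^sub>0 \<eta> \<epsilon>) \<beta> \<le> risk \<epsilon> (\<lambda>y (j, k). h j (y (j, k))) \<beta> + ennreal (suminf e)"
      if h: "\<And>j. j \<ge> -1 \<Longrightarrow> h j \<in> borel_measurable borel" for h :: "int \<Rightarrow> real \<Rightarrow> real"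
      unfolding risk_eq
    proof (rule infsum_int_le_add_suminf[OF _ e0 sum_e])
      fix j :: int assume j: "j \<ge> -1"
      let ?g = "geb nstar \<rho>\<^sub>0 b\<^sub>0 \<eta> \<epsilon>" and ?h = "\<lambda>y (j, k). h j (y (j, k))"
      show "level_risk \<epsilon> ?g \<beta> j \<le> level_risk \<epsilon> ?h \<beta> j + ennreal (e (nat (j + 1)))"
      proof (cases "j < j_star nstar")
        case True
        \<comment> \<open>Levels below \<open>j_star\<close> are charged in full instead of being
          compared with the ideal risk. There are finitely many, and the factor (1 + J)^(3/2) in
          \<open>K\<^sub>2\<close> lifts the common summable sequence above 2^J on all of
          them.\<close>
        have size: "real (level_size j) \<le> 2 ^ J"
          unfolding level_size_def J_def using True by (auto intro!: power_increasing)
        have "nat (j + 1) \<le> J" unfolding J_def using True by linarith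
        then have "(1 + real J) powr (- (3 / 2)) \<le> (1 + real (nat (j + 1))) powr (- (3 / 2))"
          by (intro powr_mono2') auto
        then have "2 ^ J * (1 + real J) powr (3 / 2) * (1 + real J) powr (- (3 / 2))
          \<le> 2 ^ J * (1 + real J) powr (3 / 2) * (1 + real (nat (j + 1))) powr (- (3 / 2))"
          by (intro mult_left_mono) auto
        also have "\<dots> \<le> K\<^sub>2 * (1 + real (nat (j + 1))) powr (- (3 / 2))"
          unfolding K\<^sub>2_def using A1 by (intro mult_right_mono) auto
        also have "2 ^ J * (1 + real J) powr (3 / 2) * (1 + real J) powr (- (3 / 2)) = 2 ^ J"
          by (simp add: mult.assoc flip: powr_add)
        finally have "2 ^ J \<le> K\<^sub>2 * (1 + real (nat (j + 1))) powr (- (3 / 2))" .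
        then have "real (level_size j) \<le> K\<^sub>1 * N powr (1 - \<gamma>) * x ^ nat (j + 1) + K\<^sub>2 * (1 + real (nat (j + 1))) powr (- (3 / 2))"
        proof -
          have "0 \<le> K\<^sub>1 * N powr (1 - \<gamma>) * x ^ nat (j + 1)" using K x by simp
          with size \<open>2 ^ J \<le> _\<close> show ?thesis by linarith
        qed
        then have "ennreal (\<epsilon>\<^sup>2 * real (level_size j)) \<le> ennreal (e (nat (j + 1)))"
          unfolding e_def by (intro ennreal_leI mult_left_mono) auto
        then show ?thesis
          unfolding level_risk_geb_low[OF \<epsilon> j True] by (rule order_trans) simp
      next
        case False
        define m where "m = nat j"
        have jm: "j = int m" "m \<ge> 1" "int m \<ge> j_star nstar" using False J by (auto simp: m_def)
        define n where "n = (2 :: nat) ^ m"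
        have n_real: "real n = 2 powr real m" by (simp add: n_def powr_realpow)
        have "(2::nat) ^ 1 \<le> 2 ^ m" using jm by (intro power_increasing) auto
        then have n2: "n \<ge> 2" by (simp add: n_def)
        define \<theta> where "\<theta> = (\<lambda>k. \<beta> (int m, k) / \<epsilon>)"
        define T where "T = C powr r * (N / real n) powr (1 + c)"
        \<comment> \<open>The exponents fit because (1 + c) / a = r, so that the power 1 + c of N =
          \<epsilon>^(- 1 / a) is \<epsilon>^(- r).\<close>
        have T_eq: "T = (C * 2 powr (- (real m * a)) / \<epsilon>) powr r"
        proof -
          have "(C * 2 powr (- (real m * a)) / \<epsilon>) powr r = C powr r * 2 powr (- (real m * a) * r) * \<epsilon> powr (- r)"
            using C \<epsilon> by (simp add: powr_divide powr_mult powr_powr powr_minus_divide)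
          moreover have "(N / real n) powr (1 + c) = 2 powr (- (real m * a) * r) * \<epsilon> powr (- r)"
          proof -
            have "(N / real n) powr (1 + c) = \<epsilon> powr (- (1 / a) * (1 + c)) * 2 powr (- (real m * (1 + c)))"
              unfolding N_def n_real powr_divide powr_powr powr_minus_divide[of 2] times_divide_eq_right mult_1_right ..
            moreover have "- (1 / a) * (1 + c) = - r" using a by (simp add: c_def)
            moreover have "- (real m * (1 + c)) = - (real m * a) * r" by (simp add: c_def)
            ultimately show ?thesis by (simp only: mult.commute)
          qed
          ultimately show ?thesis unfolding T_def by simp
        qed
        have moment: "(\<Sum>k=1..n. \<bar>\<theta> k\<bar> powr r) \<le> real n * T"
        proof -
          have "(\<Sum>k=1..n. \<bar>\<theta> k\<bar> powr r) = (\<Sum>k=1..n. \<bar>\<beta> (int m, k)\<bar> powr r) / \<epsilon> powr r"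
            unfolding \<theta>_def sum_divide_distrib using \<epsilon> by (simp add: powr_divide abs_divide)
          also have "\<dots> \<le> (2 ^ m * (C * 2 powr (- (real m * a))) powr r) / \<epsilon> powr r"
            using besov_ball_level_moment[OF \<beta> q C p0, of m] unfolding r_def[symmetric] n_def a_def
            by (intro divide_right_mono) auto
          also have "\<dots> = real n * T"
            unfolding T_eq powr_divide by (simp add: n_def)
          finally show ?thesis .
        qed
        have excess: "A\<^sub>1 * (real n powr (1 + \<gamma>) * (real n powr (2 * \<delta>) * min (real n powr (- (1 / 2))) T)
            + real n powr (1 + \<gamma>) * min 1 (T * real n powr (- (\<delta> * r / 2))) + 1 / univ_thr n ^ 3)
            \<le> K\<^sub>1 * N powr (1 - \<gamma>) * x ^ nat (j + 1) + K\<^sub>2 * (1 + real (nat (j + 1))) powr (- (3 / 2))"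
        proof -
          have n1: "1 \<le> real n" "0 < C powr r" using n2 C by auto
          note ip = level_excess_interpolation[OF n1(1) N n1(2) c \<gamma> \<delta>(2) T_def, folded \<tau>_def C'_def]
          have nx: "real n powr (- \<gamma>) = 2 powr \<gamma> * x ^ nat (j + 1)"
          proof -
            have "x ^ nat (j + 1) = x powr (real m + 1)" 
            proof -
              have "nat (j + 1) = Suc m" using jm by simp
              moreover have "x powr real (Suc m) = x ^ Suc m" by (rule powr_realpow[OF x(1)])
              ultimately show ?thesis by (simp only: of_nat_Suc add.commute)
            qed
            also have "\<dots> = 2 powr (- \<gamma> * (real m + 1))" by (simp add: x_def powr_powr)
            finally have "2 powr \<gamma> * x ^ nat (j + 1) = 2 powr (\<gamma> + - \<gamma> * (real m + 1))" by (simp only: powr_add)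
            also have "\<gamma> + - \<gamma> * (real m + 1) = real m * - \<gamma>" by (simp add: algebra_simps)
            finally show ?thesis unfolding n_real powr_powr ..
          qed
          have "1 / univ_thr n ^ 3 \<le> 3 powr (3 / 2) * (1 + real (nat (j + 1))) powr (- (3 / 2))"
            using univ_thr_cube_ge[OF jm(2)] jm by (simp add: n_def nat_add_distrib)
          then have "A\<^sub>1 * (real n powr (1 + \<gamma>) * (real n powr (2 * \<delta>) * min (real n powr (- (1 / 2))) T)
            + real n powr (1 + \<gamma>) * min 1 (T * real n powr (- (\<delta> * r / 2))) + 1 / univ_thr n ^ 3)
             \<le> A\<^sub>1 * (C' * (N powr (1 - \<gamma>) * real n powr (- \<gamma>)) + C' * (N powr (1 - \<gamma>) * real n powr (- \<gamma>))
                + 3 powr (3 / 2) * (1 + real (nat (j + 1))) powr (- (3 / 2)))"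
            using A1 ip unfolding d_def by (intro mult_left_mono add_mono) auto
          also have "\<dots> = K\<^sub>1 * N powr (1 - \<gamma>) * x ^ nat (j + 1) + (A\<^sub>1 * 3 powr (3 / 2)) * (1 + real (nat (j + 1))) powr (- (3 / 2))"
            unfolding nx K\<^sub>1_def by (simp add: algebra_simps)
          also have "\<dots> \<le> K\<^sub>1 * N powr (1 - \<gamma>) * x ^ nat (j + 1) + K\<^sub>2 * (1 + real (nat (j + 1))) powr (- (3 / 2))"
            unfolding K\<^sub>2_def by (intro add_left_mono mult_right_mono) auto
          finally show ?thesis .
        qed
        have hj: "h j \<in> borel_measurable borel" by (rule h[OF j])
        then have hm: "(\<lambda>x. h j (\<epsilon> * x) / \<epsilon>) \<in> borel_measurable borel" by measurable
        have "level_risk \<epsilon> ?g \<beta> j = ennreal (\<epsilon>\<^sup>2) * level.level_loss n \<theta> (\<lambda>k. (int m, k)) idx (geb_rho \<rho>\<^sub>0 \<eta> n) (geb_b b\<^sub>0 n)"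
          unfolding jm(1) n_def \<theta>_def
          by (rule level_risk_geb_high[OF \<epsilon> jm(3,2)]) (use pos n2 in \<open>simp add: n_def\<close>)
        also have "\<dots> \<le> ennreal (\<epsilon>\<^sup>2) * (sep_risk n \<theta> (\<lambda>x. h j (\<epsilon> * x) / \<epsilon>)
          + ennreal (A\<^sub>1 * (real n powr (1 + \<gamma>) * (real n powr (2 * \<delta>) * min (real n powr (- (1 / 2))) T)
            + real n powr (1 + \<gamma>) * min 1 (T * real n powr (- (\<delta> * r / 2))) + 1 / univ_thr n ^ 3)))"
        proof (intro mult_left_mono A1_all[rule_format] n2 hm moment)
          show "inj_on (Pair (int m)) {1..n}" by (simp add: inj_on_def)
          show "Pair (int m) ` {1..n} \<subseteq> idx" by (auto simp: idx_def level_size_def n_def)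
        qed simp
        also have "\<dots> \<le> ennreal (\<epsilon>\<^sup>2) * (sep_risk n \<theta> (\<lambda>x. h j (\<epsilon> * x) / \<epsilon>)
          + ennreal (K\<^sub>1 * N powr (1 - \<gamma>) * x ^ nat (j + 1) + K\<^sub>2 * (1 + real (nat (j + 1))) powr (- (3 / 2))))"
          by (intro mult_left_mono add_left_mono ennreal_leI excess) simp
        also have "\<dots> = ennreal (\<epsilon>\<^sup>2) * sep_risk n \<theta> (\<lambda>x. h j (\<epsilon> * x) / \<epsilon>) + ennreal (e (nat (j + 1)))"
          unfolding e_def by (subst distrib_left, subst ennreal_mult'[symmetric]) simp_all
        also have "ennreal (\<epsilon>\<^sup>2) * sep_risk n \<theta> (\<lambda>x. h j (\<epsilon> * x) / \<epsilon>) = level_risk \<epsilon> ?h \<beta> j"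
          using level_risk_separable[OF \<epsilon> j, of h \<beta>, OF hj] by (simp add: jm(1) level_size_def n_def \<theta>_def)
        finally show ?thesis .
      qed
    qed
    \<comment> \<open>The error sum is the same for all \<open>h\<close>, so it is moved to the left
      before the infimum is taken; being finite, it can be moved back.\<close>
    then have "risk \<epsilon> (geb nstar \<rho>\<^sub>0 b\<^sub>0 \<eta> \<epsilon>) \<beta> - ennreal (suminf e) \<le> ideal_risk \<epsilon> \<beta>"
      unfolding ideal_risk_def by (intro INF_greatest) (auto simp: ennreal_minus_le_iff add.commute)
    then have "risk \<epsilon> (geb nstar \<rho>\<^sub>0 b\<^sub>0 \<eta> \<epsilon>) \<beta> \<le> ideal_risk \<epsilon> \<beta> + ennreal (suminf e)"
      by (auto simp: ennreal_minus_le_iff add.commute)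
    also have "\<dots> \<le> ideal_risk \<epsilon> \<beta> + ennreal (A * (\<epsilon> powr (\<gamma> / a) + \<epsilon> powr (1 / a)) * \<epsilon> powr (2 * \<alpha> / a))"
    proof (intro add_left_mono ennreal_leI)
      \<comment> \<open>As 2 \<alpha> = 2 a - 1, the target rate is \<epsilon>^2 N, and a bare
        \<epsilon>^2 is smaller by the factor \<epsilon>^(1 / a).\<close>
      have ex: "2 * \<alpha> / a = 2 + - (1 / a)" using a by (simp add: a_def field_simps)
      have e2: "\<epsilon>\<^sup>2 = \<epsilon> powr 2" using \<epsilon> by simp
      have 1: "\<epsilon>\<^sup>2 * N powr (1 - \<gamma>) = \<epsilon> powr (\<gamma> / a) * \<epsilon> powr (2 * \<alpha> / a)"
      proof -
        have "\<epsilon>\<^sup>2 * N powr (1 - \<gamma>) = \<epsilon> powr (2 + - (1 / a) * (1 - \<gamma>))"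
          unfolding e2 N_def powr_powr powr_add ..
        also have "2 + - (1 / a) * (1 - \<gamma>) = \<gamma> / a + 2 * \<alpha> / a" unfolding ex using a by (simp add: field_simps)
        finally show ?thesis unfolding powr_add .
      qed
      have 2: "\<epsilon>\<^sup>2 = \<epsilon> powr (1 / a) * \<epsilon> powr (2 * \<alpha> / a)"
        unfolding e2 powr_add[symmetric] ex by simp
      have "suminf e = K\<^sub>1 * S\<^sub>1 * (\<epsilon>\<^sup>2 * N powr (1 - \<gamma>)) + K\<^sub>2 * S\<^sub>2 * \<epsilon>\<^sup>2"
        unfolding suminf_e by (simp add: algebra_simps)
      also have "\<dots> \<le> A * (\<epsilon>\<^sup>2 * N powr (1 - \<gamma>)) + A * \<epsilon>\<^sup>2"
        unfolding A_def using K S by (intro add_mono mult_right_mono) auto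
      also have "\<dots> = A * (\<epsilon> powr (\<gamma> / a) * \<epsilon> powr (2 * \<alpha> / a)) + A * (\<epsilon> powr (1 / a) * \<epsilon> powr (2 * \<alpha> / a))"
        unfolding 1 using 2 by simp
      also have "\<dots> = A * (\<epsilon> powr (\<gamma> / a) + \<epsilon> powr (1 / a)) * \<epsilon> powr (2 * \<alpha> / a)"
        by (simp add: algebra_simps)
      finally show "suminf e \<le> A * (\<epsilon> powr (\<gamma> / a) + \<epsilon> powr (1 / a)) * \<epsilon> powr (2 * \<alpha> / a)" .
    qed
    finally show ?thesis .
  qed
  have "\<gamma> / a > 0" using \<gamma> a by simp
  with A main show ?thesis unfolding a_def by blast
qed

section \<open>Passage to the limit in the noise level\<close>

theorem theorem3p6:
  fixes nstar \<rho>\<^sub>0 b\<^sub>0 \<alpha> C :: real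
    and p q :: ennreal
    and \<eta> :: "nat \<Rightarrow> real"
    and B :: "coeffs set"
    and R_til :: "real \<Rightarrow> coeffs \<Rightarrow> ereal"
    and \<beta>_til :: "real \<Rightarrow> coeffs \<Rightarrow> coeffs"
    and r :: "real \<Rightarrow> real"
  assumes "nstar > 2" and "\<rho>\<^sub>0 > 0" and "b\<^sub>0 > 0"
    and "\<eta> \<longlonglongrightarrow> 0"
    and "\<And>n. n \<ge> 2 \<Longrightarrow> geb_rho \<rho>\<^sub>0 \<eta> n > 0"
    and "\<alpha> > 0"
    and "p > ennreal (1 / (\<alpha> + 1 / 2))"
    and "q > 0"
    and "C > 0"
    and "B \<subseteq> besov_ball \<alpha> p q C"
    and "Liminf (at_right 0)
           (\<lambda>\<epsilon>. ennreal (\<epsilon> powr (- (2 * \<alpha> / (\<alpha> + 1 / 2)))) * minimax_risk \<epsilon> B) > 0"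
    and "\<And>\<epsilon> \<beta>. \<epsilon> > 0 \<Longrightarrow> \<beta> \<in> B \<Longrightarrow> R_til \<epsilon> \<beta> \<ge> enn2ereal (ideal_risk \<epsilon> \<beta>)"
    and "\<And>\<epsilon>. \<epsilon> > 0 \<Longrightarrow> \<beta>_til \<epsilon> \<in> estimators"
    and "(r \<longlongrightarrow> 0) (at_right 0)"
    and "\<forall>\<^sub>F \<epsilon> in at_right 0.
           (SUP \<beta>\<in>B. R_til \<epsilon> \<beta> - enn2ereal (risk \<epsilon> (\<beta>_til \<epsilon>) \<beta>))
             \<le> ereal (r \<epsilon> * \<epsilon> powr (2 * \<alpha> / (\<alpha> + 1 / 2)))"
  shows "(Limsup (at_right 0)
           (\<lambda>\<epsilon>. (SUP \<beta>\<in>B. enn2ereal (risk \<epsilon> (geb nstar \<rho>\<^sub>0 b\<^sub>0 \<eta> \<epsilon>) \<beta>)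
                              - enn2ereal (risk \<epsilon> (\<beta>_til \<epsilon>) \<beta>))
                / enn2ereal (minimax_risk \<epsilon> B)) \<le> 0)
    \<and> (Limsup (at_right 0)
           (\<lambda>\<epsilon>. enn2ereal (SUP \<beta>\<in>B. risk \<epsilon> (geb nstar \<rho>\<^sub>0 b\<^sub>0 \<eta> \<epsilon>) \<beta>)
                / enn2ereal (SUP \<beta>\<in>B. risk \<epsilon> (\<beta>_til \<epsilon>) \<beta>)) \<le> 1)"
proof -
  define w where "w \<epsilon> = \<epsilon> powr (2 * \<alpha> / (\<alpha> + 1 / 2))" for \<epsilon> :: real
  define G where "G \<epsilon> \<beta> = risk \<epsilon> (geb nstar \<rho>\<^sub>0 b\<^sub>0 \<eta> \<epsilon>) \<beta>" for \<epsilon> \<beta>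
  define S where "S \<epsilon> \<beta> = risk \<epsilon> (\<beta>_til \<epsilon>) \<beta>" for \<epsilon> \<beta>
  define M where "M \<epsilon> = minimax_risk \<epsilon> B" for \<epsilon>
  obtain A \<kappa> where A: "A > 0" "\<kappa> > 0" and ideal_le: "\<And>\<epsilon> \<beta>. \<epsilon> > 0 \<Longrightarrow> \<beta> \<in> besov_ball \<alpha> p q C \<Longrightarrow>
     G \<epsilon> \<beta> \<le> ideal_risk \<epsilon> \<beta> + ennreal (A * (\<epsilon> powr \<kappa> + \<epsilon> powr (1 / (\<alpha> + 1 / 2))) * w \<epsilon>)"
    using geb_ideal_adaptivity[OF assms(1-5) assms(6-9)] unfolding G_def w_def by blast
  \<comment> \<open>The absolute value keeps \<open>u\<close> nonnegative, so that
    \<open>ennreal (u \<epsilon> * w \<epsilon>)\<close> is not cut off at 0 where \<open>r\<close>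
    is negative.\<close>
  define u where "u \<epsilon> = \<bar>r \<epsilon>\<bar> + A * (\<epsilon> powr \<kappa> + \<epsilon> powr (1 / (\<alpha> + 1 / 2)))" for \<epsilon>
  have pos: "\<forall>\<^sub>F \<epsilon> in at_right 0. \<epsilon> > (0 :: real)" by (rule eventually_at_right_less)
  have u_lim: "(u \<longlongrightarrow> 0) (at_right 0)"
  proof -
    have pw: "((\<lambda>\<epsilon>. \<epsilon> powr k) \<longlongrightarrow> 0) (at_right 0)" if "k > 0" for k :: real
      using that by real_asymp
    have "((\<lambda>\<epsilon>. \<bar>r \<epsilon>\<bar> + A * (\<epsilon> powr \<kappa> + \<epsilon> powr (1 / (\<alpha> + 1 / 2)))) \<longlongrightarrow> \<bar>0\<bar> + A * (0 + 0)) (at_right 0)"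
      using assms(6) by (intro tendsto_intros assms(14) pw A) auto
    then show ?thesis unfolding u_def by simp
  qed
  obtain c where c: "c > 0" and M_ge: "\<forall>\<^sub>F \<epsilon> in at_right 0. ennreal (c * w \<epsilon>) \<le> M \<epsilon>"
  proof -
    obtain y where y: "0 < y" "y < Liminf (at_right 0) (\<lambda>\<epsilon>. ennreal (\<epsilon> powr (- (2 * \<alpha> / (\<alpha> + 1 / 2)))) * minimax_risk \<epsilon> B)"
      using dense[OF assms(11)] by blast
    have "y < top" using y(2) by (rule less_le_trans) simp
    then obtain c where yc: "y = ennreal c" "c \<ge> 0" by (cases y) auto
    have "c > 0" using y(1) yc by simp
    have "\<forall>\<^sub>F \<epsilon> in at_right 0. y < ennreal (\<epsilon> powr (- (2 * \<alpha> / (\<alpha> + 1 / 2)))) * minimax_risk \<epsilon> B"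
      using y(2) by (rule less_LiminfD)
    then have "\<forall>\<^sub>F \<epsilon> in at_right 0. ennreal (c * w \<epsilon>) \<le> M \<epsilon>"
      using pos
    proof eventually_elim
      case (elim \<epsilon>)
      have w: "w \<epsilon> > 0" "\<epsilon> powr (- (2 * \<alpha> / (\<alpha> + 1 / 2))) = 1 / w \<epsilon>"
        using elim by (auto simp: w_def powr_minus_divide)
      have "ennreal (c * w \<epsilon>) = ennreal (w \<epsilon>) * y" using yc w by (simp add: ennreal_mult mult.commute)
      also have "\<dots> \<le> ennreal (w \<epsilon>) * (ennreal (1 / w \<epsilon>) * M \<epsilon>)"
        using elim(1) unfolding w(2) M_def by (intro mult_left_mono) auto
      also have "\<dots> = ennreal (w \<epsilon> * (1 / w \<epsilon>)) * M \<epsilon>"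
        using w by (simp only: mult.assoc[symmetric]) (subst ennreal_mult, auto)
      also have "\<dots> = M \<epsilon>" using w by simp
      finally show ?case .
    qed
    with \<open>c > 0\<close> show ?thesis by (rule that)
  qed
  \<comment> \<open>Both forms are kept: the difference enters the first claim, while the additive
    form passes to suprema for the ratio of the second.\<close>
  have diff: "\<forall>\<^sub>F \<epsilon> in at_right 0. \<forall>\<beta>\<in>B. enn2ereal (G \<epsilon> \<beta>) - enn2ereal (S \<epsilon> \<beta>) \<le> ereal (u \<epsilon> * w \<epsilon>)
      \<and> G \<epsilon> \<beta> \<le> S \<epsilon> \<beta> + ennreal (u \<epsilon> * w \<epsilon>)"
    using assms(15) pos
  proof eventually_elim
    case (elim \<epsilon>)
    show ?case
    proof
      fix \<beta> assume \<beta>: "\<beta> \<in> B"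
      let ?I = "ideal_risk \<epsilon> \<beta>"
      have w0: "w \<epsilon> > 0" using elim by (simp add: w_def)
      define v where "v = A * (\<epsilon> powr \<kappa> + \<epsilon> powr (1 / (\<alpha> + 1 / 2))) * w \<epsilon>"
      have v0: "v \<ge> 0" unfolding v_def using A w0 by simp
      have uw: "r \<epsilon> * w \<epsilon> + v \<le> u \<epsilon> * w \<epsilon>" "0 \<le> u \<epsilon> * w \<epsilon>"
        using w0 A by (auto simp: u_def v_def distrib_right intro!: mult_right_mono add_nonneg_nonneg)
      have "R_til \<epsilon> \<beta> - enn2ereal (S \<epsilon> \<beta>) \<le> ereal (r \<epsilon> * w \<epsilon>)"
        using SUP_upper[OF \<beta>, of "\<lambda>\<beta>. R_til \<epsilon> \<beta> - enn2ereal (risk \<epsilon> (\<beta>_til \<epsilon>) \<beta>)"] elim(1)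
        unfolding S_def w_def by (rule order_trans)
      moreover have "enn2ereal ?I \<le> R_til \<epsilon> \<beta>" by (rule assms(12)) (use elim \<beta> in auto)
      ultimately have I: "enn2ereal ?I - enn2ereal (S \<epsilon> \<beta>) \<le> ereal (r \<epsilon> * w \<epsilon>)"
        by (meson ereal_minus_mono order_refl order_trans)
      \<comment> \<open>In \<open>ereal\<close> infinity minus anything is infinity, even if
        infinity is subtracted, so a real upper bound on the difference forces the ideal risk to be
        finite. The risk of the adaptive rule is then finite as well.\<close>
      have "?I \<noteq> top"
      proof
        assume "?I = top"
        then have "enn2ereal ?I - enn2ereal (S \<epsilon> \<beta>) = \<infinity>" by simp
        with I show False by simp
      qed
      then obtain i where i: "?I = ennreal i" "i \<ge> 0" by (cases ?I) auto
      have Gi: "G \<epsilon> \<beta> \<le> ennreal (i + v)"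
        using ideal_le[of \<epsilon> \<beta>] elim \<beta> assms(10) i v0 unfolding v_def[symmetric] by (auto simp: ennreal_plus)
      show "enn2ereal (G \<epsilon> \<beta>) - enn2ereal (S \<epsilon> \<beta>) \<le> ereal (u \<epsilon> * w \<epsilon>) \<and> G \<epsilon> \<beta> \<le> S \<epsilon> \<beta> + ennreal (u \<epsilon> * w \<epsilon>)"
      proof (cases "S \<epsilon> \<beta>")
        case (real t)
        from Gi have "G \<epsilon> \<beta> < top" by (rule le_less_trans) simp
        then obtain x where x: "G \<epsilon> \<beta> = ennreal x" "x \<ge> 0" by (cases "G \<epsilon> \<beta>") auto
        have "x \<le> i + v" using Gi i(2) v0 unfolding x(1) by (subst (asm) ennreal_le_iff) auto
        moreover have "i - t \<le> r \<epsilon> * w \<epsilon>" using I real i by (simp add: enn2ereal_ennreal)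
        ultimately have "x \<le> t + u \<epsilon> * w \<epsilon>" using uw by linarith
        then show ?thesis using real x uw(2) by (auto simp: enn2ereal_ennreal ennreal_plus[symmetric] simp del: ennreal_plus intro!: ennreal_leI)
      next
        case top
        from Gi have "G \<epsilon> \<beta> < top" by (rule le_less_trans) simp
        then obtain x where x: "G \<epsilon> \<beta> = ennreal x" "x \<ge> 0" by (cases "G \<epsilon> \<beta>") auto
        show ?thesis using top x by (simp add: enn2ereal_ennreal)
      qed
    qed
  qed
  have small: "\<forall>\<^sub>F \<epsilon> in at_right 0. u \<epsilon> * w \<epsilon> \<le> e * (c * w \<epsilon>)" if "e > 0" for e
  proof -
    have "\<forall>\<^sub>F \<epsilon> in at_right 0. u \<epsilon> < e * c" using u_lim that c by (intro order_tendstoD(2)[OF u_lim]) simp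
    then show ?thesis
    proof eventually_elim
      case (elim \<epsilon>)
      then have "u \<epsilon> * w \<epsilon> \<le> e * c * w \<epsilon>" by (intro mult_right_mono) (auto simp: w_def)
      then show ?case by (simp only: mult.assoc)
    qed
  qed
  have part1: "Limsup (at_right 0) (\<lambda>\<epsilon>. (SUP \<beta>\<in>B. enn2ereal (G \<epsilon> \<beta>) - enn2ereal (S \<epsilon> \<beta>)) / enn2ereal (M \<epsilon>)) \<le> 0"
  proof (rule ereal_le_epsilon2)
    fix e :: real assume e: "e > 0"
    have "\<forall>\<^sub>F \<epsilon> in at_right 0. (SUP \<beta>\<in>B. enn2ereal (G \<epsilon> \<beta>) - enn2ereal (S \<epsilon> \<beta>)) / enn2ereal (M \<epsilon>) \<le> ereal e"
      using diff small[OF e] M_ge pos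
    proof eventually_elim
      case (elim \<epsilon>)
      have cw: "c * w \<epsilon> > 0" using elim c by (simp add: w_def)
      have sup: "(SUP \<beta>\<in>B. enn2ereal (G \<epsilon> \<beta>) - enn2ereal (S \<epsilon> \<beta>)) \<le> ereal (e * (c * w \<epsilon>))"
        using elim(1,2) by (intro SUP_least) (meson ereal_less_eq(3) order_trans)
      show ?case
      proof (cases "M \<epsilon>")
        case (real m)
        have m: "c * w \<epsilon> \<le> m" using elim(3) real by (simp add: ennreal_le_iff)
        then have m0: "m > 0" using cw by linarith
        have "(SUP \<beta>\<in>B. enn2ereal (G \<epsilon> \<beta>) - enn2ereal (S \<epsilon> \<beta>)) / enn2ereal (M \<epsilon>) \<le> ereal (e * (c * w \<epsilon>)) / ereal m"
          using real m0 by (simp only: enn2ereal_ennreal) (intro ereal_divide_right_mono sup, simp)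
        also have "\<dots> = ereal (e * (c * w \<epsilon>) / m)" using m0 by simp
        also have "\<dots> \<le> ereal e"
        proof -
          have "e * (c * w \<epsilon>) \<le> e * m" using m e by (intro mult_left_mono) auto
          then show ?thesis using m0 by (simp add: pos_divide_le_eq)
        qed
        finally show ?thesis .
      next
        \<comment> \<open>Division by infinity gives 0 in \<open>ereal\<close>, whatever the
          numerator.\<close>
        case top
        then show ?thesis using e by simp
      qed
    qed
    then show "Limsup (at_right 0) (\<lambda>\<epsilon>. (SUP \<beta>\<in>B. enn2ereal (G \<epsilon> \<beta>) - enn2ereal (S \<epsilon> \<beta>)) / enn2ereal (M \<epsilon>)) \<le> 0 + ereal e"
      by (simp add: Limsup_bounded)
  qed
  have part2: "Limsup (at_right 0) (\<lambda>\<epsilon>. enn2ereal (SUP \<beta>\<in>B. G \<epsilon> \<beta>) / enn2ereal (SUP \<beta>\<in>B. S \<epsilon> \<beta>)) \<le> 1"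
  proof (rule ereal_le_epsilon2)
    fix e :: real assume e: "e > 0"
    have "\<forall>\<^sub>F \<epsilon> in at_right 0. enn2ereal (SUP \<beta>\<in>B. G \<epsilon> \<beta>) / enn2ereal (SUP \<beta>\<in>B. S \<epsilon> \<beta>) \<le> ereal (1 + e)"
      using diff small[OF e] M_ge pos
    proof eventually_elim
      case (elim \<epsilon>)
      have cw: "c * w \<epsilon> > 0" using elim c by (simp add: w_def)
      \<comment> \<open>The competitor belongs to \<open>estimators\<close>, so its maximal risk is
        at least the minimax risk and inherits the lower bound c w. This makes the excess negligible
        relative to that maximal risk.\<close>
      have "M \<epsilon> \<le> (SUP \<beta>\<in>B. S \<epsilon> \<beta>)"
        unfolding M_def minimax_risk_def S_def using assms(13)[of \<epsilon>] elim by (intro INF_lower) auto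
      then have S_ge: "ennreal (c * w \<epsilon>) \<le> (SUP \<beta>\<in>B. S \<epsilon> \<beta>)" using elim(3) by (rule order_trans[rotated])
      have G_le: "(SUP \<beta>\<in>B. G \<epsilon> \<beta>) \<le> (SUP \<beta>\<in>B. S \<epsilon> \<beta>) + ennreal (e * (c * w \<epsilon>))"
      proof (rule SUP_least)
        fix \<beta> assume \<beta>: "\<beta> \<in> B"
        have "G \<epsilon> \<beta> \<le> S \<epsilon> \<beta> + ennreal (u \<epsilon> * w \<epsilon>)" using elim(1) \<beta> by blast
        also have "\<dots> \<le> (SUP \<beta>\<in>B. S \<epsilon> \<beta>) + ennreal (e * (c * w \<epsilon>))"
          using elim(2) \<beta> by (intro add_mono SUP_upper ennreal_leI)
        finally show "G \<epsilon> \<beta> \<le> (SUP \<beta>\<in>B. S \<epsilon> \<beta>) + ennreal (e * (c * w \<epsilon>))" .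
      qed
      show ?case
      proof (cases "SUP \<beta>\<in>B. S \<epsilon> \<beta>")
        case (real s)
        have s: "c * w \<epsilon> \<le> s" using S_ge real by (simp add: ennreal_le_iff)
        then have s0: "s > 0" using cw by linarith
        have "(SUP \<beta>\<in>B. G \<epsilon> \<beta>) \<le> ennreal (s + e * (c * w \<epsilon>))"
          using G_le real e cw by (simp add: ennreal_plus)
        also have "\<dots> \<le> ennreal (s + e * s)"
          using s e by (intro ennreal_leI add_left_mono mult_left_mono) auto
        finally have "enn2ereal (SUP \<beta>\<in>B. G \<epsilon> \<beta>) \<le> enn2ereal (ennreal (s + e * s))" by (simp add: less_eq_ennreal.rep_eq)
        also have "\<dots> = ereal (s + e * s)" using s0 e by (intro enn2ereal_ennreal) simp
        finally have "enn2ereal (SUP \<beta>\<in>B. G \<epsilon> \<beta>) / ereal s \<le> ereal (s + e * s) / ereal s"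
          using s0 by (intro ereal_divide_right_mono) auto
        also have "\<dots> = ereal (1 + e)" using s0 by (simp add: add_divide_distrib)
        finally show ?thesis using real by (simp add: enn2ereal_ennreal)
      next
        case top
        then show ?thesis using e by (simp only: enn2ereal_top) simp
      qed
    qed
    then show "Limsup (at_right 0) (\<lambda>\<epsilon>. enn2ereal (SUP \<beta>\<in>B. G \<epsilon> \<beta>) / enn2ereal (SUP \<beta>\<in>B. S \<epsilon> \<beta>)) \<le> 1 + ereal e"
      by (simp add: Limsup_bounded one_ereal_def)
  qed
  show ?thesis using part1 part2 unfolding G_def S_def M_def by blast
qed

end
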